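(* Let $\mathcal N,\mathcal M\in\mathrm{CPTP}(A\to B)$ be two quantum channels and let $\varepsilon\in(0,1)$. Then the Stein exponents under product strategies without quantum memory assistance satisfy $$\mathrm{E}^{\mathrm{st}}_{\mathrm{PRO},\sup}(\varepsilon|\mathcal N\|\mathcal M)=\mathrm{E}^{\mathrm{st}}_{\mathrm{PRO},\inf}(\varepsilon|\mathcal N\|\mathcal M)=d(\mathcal N\|\mathcal M).$$
   Context: All Hilbert spaces are finite-dimensional; $\mathfrak{D}(A)$ is the set of density operators on $A$, $\mathrm{CPTP}(A\to B)$ the set of quantum channels, $\log$ is base two. $D(\rho\|\sigma)=\operatorname{Tr}[\rho(\log\rho-\log\sigma)]$ if $\operatorname{supp}\rho\subseteq\operatorname{supp}\sigma$, else $+\infty$; $d(\mathcal N\|\mathcal M)=\sup_{\rho\in\mathfrak{D}(A)}D(\mathcal N(\rho)\|\mathcal M(\rho))$. $D_H^\varepsilon(\rho\|\sigma)=-\log\inf\{\operatorname{Tr}[\Pi\sigma]:0\le\Pi\le I,\ \operatorname{Tr}[\Pi\rho]\ge1-\varepsilon\}$. A product strategy without quantum memory with $n$ channel uses chooses input states $\varphi_1,\dots,\varphi_n\in\mathfrak{D}(A)$ (possibly different) and a test $0\le\Pi_n\le I$ on $B^n$, applied to $\bigotimes_{i=1}^n\mathcal N(\varphi_i)$ or $\bigotimes_{i=1}^n\mathcal M(\varphi_i)$. Put $$d_{H,\mathrm{PRO}}^\varepsilon(\mathcal N^{\otimes n}\|\mathcal M^{\otimes n})=\sup_{\varphi_1,\dots,\varphi_n\in\mathfrak{D}(A)}D_H^\varepsilon\Big(\bigotimes_{i=1}^n\mathcal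 N(\varphi_i)\Big\|\bigotimes_{i=1}^n\mathcal M(\varphi_i)\Big),$$ i.e. the supremum of $-\log$(Type-II error) over product strategies with Type-I error at most $\varepsilon$. The Stein exponents are $\mathrm{E}^{\mathrm{st}}_{\mathrm{PRO},\sup}(\varepsilon|\mathcal N\|\mathcal M)=\limsup_{n\to\infty}\frac1n d_{H,\mathrm{PRO}}^\varepsilon(\mathcal N^{\otimes n}\|\mathcal M^{\otimes n})$ and $\mathrm{E}^{\mathrm{st}}_{\mathrm{PRO},\inf}(\varepsilon|\mathcal N\|\mathcal M)=\liminf_{n\to\infty}\frac1n d_{H,\mathrm{PRO}}^\varepsilon(\mathcal N^{\otimes n}\|\mathcal M^{\otimes n})$. *)

theory Defs
  imports
    "HOL-Library.Extended_Real"
    "HOL-Library.Liminf_Limsup"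
    "Jordan_Normal_Form.Schur_Decomposition"
    "Jordan_Normal_Form.Matrix_Kernel"
begin

text \<open>
  A finite-dimensional Hilbert space is represented by its dimension \<open>n\<close>, i.e.\ by the
  coordinate space of complex vectors of length \<open>n\<close>; operators on it are the elements of
  \<open>carrier_mat n n\<close>.
\<close>

section \<open>Operators and states\<close>

definition mat_trace :: "complex mat \<Rightarrow> complex" where
  "mat_trace A = (\<Sum>i<dim_row A. A $$ (i, i))"

definition hermitian_mat :: "nat \<Rightarrow> complex mat \<Rightarrow> bool" where
  "hermitian_mat n A \<longleftrightarrow> A \<in> carrier_mat n n \<and> mat_adjoint A = A"

definition unitary_mat :: "nat \<Rightarrow> complex mat \<Rightarrow> bool" where
  "unitary_mat n U \<longleftrightarrow>
     U \<in> carrier_mat n n \<and> mat_adjoint U * U = 1\<^sub>m n \<and> U * mat_adjoint U = 1\<^sub>m n"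

definition psd_mat :: "nat \<Rightarrow> complex mat \<Rightarrow> bool" where
  "psd_mat n A \<longleftrightarrow> hermitian_mat n A \<and> (\<forall>v\<in>carrier_vec n. 0 \<le> Re ((A *\<^sub>v v) \<bullet>c v))"

definition loewner_le :: "nat \<Rightarrow> complex mat \<Rightarrow> complex mat \<Rightarrow> bool" where
  "loewner_le n A B \<longleftrightarrow> A \<in> carrier_mat n n \<and> B \<in> carrier_mat n n \<and> psd_mat n (B - A)"

definition density_ops :: "nat \<Rightarrow> complex mat set" where
  "density_ops n = {\<rho>. psd_mat n \<rho> \<and> mat_trace \<rho> = 1}"

definition supp_mat :: "complex mat \<Rightarrow> complex vec set" where
  "supp_mat A = {v \<in> carrier_vec (dim_col A). \<forall>w\<in>mat_kernel A. v \<bullet>c w = 0}"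


section \<open>Tensor products\<close>

text \<open>The basis vector \<open>e\<^sub>i \<otimes> e\<^sub>j\<close> has index \<open>i * dim B + j\<close>.\<close>

definition kron :: "complex mat \<Rightarrow> complex mat \<Rightarrow> complex mat" where
  "kron A B = Matrix.mat (dim_row A * dim_row B) (dim_col A * dim_col B)
     (\<lambda>(r, c). A $$ (r div dim_row B, c div dim_col B) * B $$ (r mod dim_row B, c mod dim_col B))"

definition tensor_list :: "complex mat list \<Rightarrow> complex mat" where
  "tensor_list As = foldr kron As (1\<^sub>m 1)"


section \<open>Quantum channels\<close>

text \<open>
  A channel is a HOL function on all complex matrices, of which only the restriction to
  \<open>carrier_mat dA dA\<close> is meaningful.
\<close>

definition linear_superop :: "nat \<Rightarrow> nat \<Rightarrow> (complex mat \<Rightarrow> complex mat) \<Rightarrow> bool" where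
  "linear_superop dA dB N \<longleftrightarrow>
     (\<forall>X\<in>carrier_mat dA dA. N X \<in> carrier_mat dB dB) \<and>
     (\<forall>X\<in>carrier_mat dA dA. \<forall>Y\<in>carrier_mat dA dA. N (X + Y) = N X + N Y) \<and>
     (\<forall>c. \<forall>X\<in>carrier_mat dA dA. N (c \<cdot>\<^sub>m X) = c \<cdot>\<^sub>m N X)"

text \<open>
  \<open>ampliation k dA dB N\<close> is the map \<open>id\<^sub>k \<otimes> N\<close>: it applies \<open>N\<close> to each of the \<open>k * k\<close> blocks,
  of size \<open>dA\<close>, of its argument; see \<open>ampliation_kron\<close> below.
\<close>

definition mat_block :: "nat \<Rightarrow> complex mat \<Rightarrow> nat \<Rightarrow> nat \<Rightarrow> complex mat" where
  "mat_block d X i j = Matrix.mat d d (\<lambda>(a, b). X $$ (i * d + a, j * d + b))"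

definition ampliation ::
    "nat \<Rightarrow> nat \<Rightarrow> nat \<Rightarrow> (complex mat \<Rightarrow> complex mat) \<Rightarrow> complex mat \<Rightarrow> complex mat" where
  "ampliation k dA dB N X = Matrix.mat (k * dB) (k * dB)
     (\<lambda>(r, c). N (mat_block dA X (r div dB) (c div dB)) $$ (r mod dB, c mod dB))"

definition completely_positive :: "nat \<Rightarrow> nat \<Rightarrow> (complex mat \<Rightarrow> complex mat) \<Rightarrow> bool" where
  "completely_positive dA dB N \<longleftrightarrow>
     (\<forall>k X. psd_mat (k * dA) X \<longrightarrow> psd_mat (k * dB) (ampliation k dA dB N X))"

definition trace_preserving :: "nat \<Rightarrow> (complex mat \<Rightarrow> complex mat) \<Rightarrow> bool" where
  "trace_preserving dA N \<longleftrightarrow> (\<forall>X\<in>carrier_mat dA dA. mat_trace (N X) = mat_trace X)"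

definition CPTP :: "nat \<Rightarrow> nat \<Rightarrow> (complex mat \<Rightarrow> complex mat) set" where
  "CPTP dA dB =
     {N. linear_superop dA dB N \<and> completely_positive dA dB N \<and> trace_preserving dA N}"

lemma ampliation_kron:
  assumes N: "linear_superop dA dB N" and E: "E \<in> carrier_mat k k" and X: "X \<in> carrier_mat dA dA"
  shows "ampliation k dA dB N (kron E X) = kron E (N X)"
proof -
  have NX: "N X \<in> carrier_mat dB dB"
    using N X by (auto simp: linear_superop_def)
  have block: "mat_block dA (kron E X) i j = E $$ (i, j) \<cdot>\<^sub>m X" if ij: "i < k" "j < k" for i j
  proof (rule eq_matI)
    fix a b assume "a < dim_row (E $$ (i, j) \<cdot>\<^sub>m X)" "b < dim_col (E $$ (i, j) \<cdot>\<^sub>m X)"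
    then have ab: "a < dA" "b < dA" using X by auto
    have less: "i * dA + a < k * dA" if "i < k" "a < dA" for i a
    proof -
      have "i * dA + a < Suc i * dA" using that by simp
      also have "\<dots> \<le> k * dA" using that by (intro mult_le_mono1) simp
      finally show ?thesis .
    qed
    show "mat_block dA (kron E X) i j $$ (a, b) = (E $$ (i, j) \<cdot>\<^sub>m X) $$ (a, b)"
      using ab ij E X less[of i a] less[of j b] by (simp add: mat_block_def kron_def)
  qed (use X in \<open>auto simp: mat_block_def\<close>)
  have lin: "N (c \<cdot>\<^sub>m X) = c \<cdot>\<^sub>m N X" for c
    using N X by (auto simp: linear_superop_def)
  show ?thesis
  proof (rule eq_matI)
    fix r c assume "r < dim_row (kron E (N X))" "c < dim_col (kron E (N X))"
    then have rc: "r < k * dB" "c < k * dB" using E NX by (auto simp: kron_def)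
    then have "r div dB < k" "c div dB < k" "r mod dB < dB" "c mod dB < dB"
      by (auto simp: less_mult_imp_div_less intro!: mod_less_divisor gr0I)
    moreover from this have "N (mat_block dA (kron E X) (r div dB) (c div dB)) $$ (r mod dB, c mod dB)
        = E $$ (r div dB, c div dB) * N X $$ (r mod dB, c mod dB)"
      using NX by (simp only: block lin) simp
    ultimately show "ampliation k dA dB N (kron E X) $$ (r, c) = kron E (N X) $$ (r, c)"
      using rc E NX by (simp add: ampliation_def) (simp add: kron_def)
  qed (use E NX in \<open>auto simp: ampliation_def kron_def\<close>)
qed


section \<open>Logarithm and relative entropy\<close>

text \<open>
  Functional calculus for Hermitian matrices: \<open>f(U diag(l) U\<^sup>*) = U diag(f l) U\<^sup>*\<close>.
  The result does not depend on the chosen diagonalization (\<open>spectral_fun_unique\<close>).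
\<close>

definition spectral_fun :: "(real \<Rightarrow> real) \<Rightarrow> complex mat \<Rightarrow> complex mat \<Rightarrow> bool" where
  "spectral_fun f A F \<longleftrightarrow> (\<exists>U l. unitary_mat (dim_row A) U \<and>
     A = U * mat_diag (dim_row A) (\<lambda>i. complex_of_real (l i)) * mat_adjoint U \<and>
     F = U * mat_diag (dim_row A) (\<lambda>i. complex_of_real (f (l i))) * mat_adjoint U)"

lemma spectral_fun_unique:
  assumes "spectral_fun f A F" and "spectral_fun f A G"
  shows "F = G"
proof -
  define n where "n = dim_row A"
  let ?D = "\<lambda>l. mat_diag n (\<lambda>i. complex_of_real (l i))"
  from assms(1) obtain U l where U: "unitary_mat n U"
    and AU: "A = U * ?D l * mat_adjoint U" and F: "F = U * ?D (\<lambda>i. f (l i)) * mat_adjoint U"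
    unfolding spectral_fun_def n_def[symmetric] by blast
  from assms(2) obtain V m where V: "unitary_mat n V"
    and AV: "A = V * ?D m * mat_adjoint V" and G: "G = V * ?D (\<lambda>i. f (m i)) * mat_adjoint V"
    unfolding spectral_fun_def n_def[symmetric] by blast
  define U' V' where "U' = mat_adjoint U" and "V' = mat_adjoint V"
  have Uc: "U \<in> carrier_mat n n" and Vc: "V \<in> carrier_mat n n"
    using U V by (auto simp: unitary_mat_def)
  have U'c: "U' \<in> carrier_mat n n" and V'c: "V' \<in> carrier_mat n n"
    using Uc Vc by (auto simp: U'_def V'_def mat_adjoint_def)
  have UU: "U' * U = 1\<^sub>m n" "U * U' = 1\<^sub>m n" and VV: "V' * V = 1\<^sub>m n" "V * V' = 1\<^sub>m n"
    using U V by (auto simp: unitary_mat_def U'_def V'_def)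
  define W where "W = V' * U"
  have Wc: "W \<in> carrier_mat n n" using V'c Uc by (simp add: W_def)
  have eq: "V' * (U * D * U') * U = W * D" "V' * (V * D * V') * U = D * W"
    if D: "D \<in> carrier_mat n n" for D
  proof -
    have "V' * (U * D * U') * U = V' * (U * D * (U' * U))"
      using D Uc U'c V'c by (simp add: assoc_mult_mat[of _ n n _ n _ n] mult_carrier_mat[of _ n n _ n])
    also have "\<dots> = W * D" using D Uc V'c UU
      by (simp add: W_def assoc_mult_mat[of _ n n _ n _ n] mult_carrier_mat[of _ n n _ n])
    finally show "V' * (U * D * U') * U = W * D" .
    have "V' * (V * D * V') * U = (V' * V) * D * (V' * U)"
      using D Uc Vc V'c by (simp add: assoc_mult_mat[of _ n n _ n _ n] mult_carrier_mat[of _ n n _ n])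
    then show "V' * (V * D * V') * U = D * W" using D VV by (simp add: W_def)
  qed
  have WD: "W * ?D l = ?D m * W"
    using eq(1)[of "?D l"] eq(2)[of "?D m"] AU AV by (metis U'_def V'_def mat_diag_dim)
  have comm: "W $$ (i, j) * complex_of_real (l j) = complex_of_real (m i) * W $$ (i, j)"
    if "i < n" "j < n" for i j
  proof -
    have "(W * ?D l) $$ (i, j) = (?D m * W) $$ (i, j)" by (simp add: WD)
    then show ?thesis
      using that mat_diag_mult_right[OF Wc] mat_diag_mult_left[OF Wc] by simp
  qed
  have WDf: "W * ?D (\<lambda>i. f (l i)) = ?D (\<lambda>i. f (m i)) * W"
  proof (rule eq_matI)
    fix i j
    assume "i < dim_row (?D (\<lambda>i. f (m i)) * W)" "j < dim_col (?D (\<lambda>i. f (m i)) * W)"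
    then have ij: "i < n" "j < n" using Wc by (auto simp: mat_diag_def)
    have "W $$ (i, j) = 0 \<or> l j = m i" using comm[OF ij] by (simp add: mult.commute)
    then show "(W * ?D (\<lambda>i. f (l i))) $$ (i, j) = (?D (\<lambda>i. f (m i)) * W) $$ (i, j)"
      using ij by (auto simp: mat_diag_mult_right[OF Wc] mat_diag_mult_left[OF Wc])
  qed (use Wc in \<open>auto simp: mat_diag_def\<close>)
  have Fc: "F \<in> carrier_mat n n" and Gc: "G \<in> carrier_mat n n"
    unfolding F G U'_def[symmetric] V'_def[symmetric] using Uc Vc U'c V'c
    by (metis mult_carrier_mat mat_diag_dim)+
  have VFU: "V' * F * U = V' * G * U"
    using eq(1)[of "?D (\<lambda>i. f (l i))"] eq(2)[of "?D (\<lambda>i. f (m i))"] WDf F G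
    by (metis U'_def V'_def mat_diag_dim)
  have undo: "V * (V' * H * U) * U' = H" if H: "H \<in> carrier_mat n n" for H
  proof -
    have "V * (V' * H * U) * U' = (V * V') * H * (U * U')"
      using H Uc Vc U'c V'c by (simp add: assoc_mult_mat[of _ n n _ n _ n] mult_carrier_mat[of _ n n _ n])
    then show ?thesis using H UU VV by simp
  qed
  show ?thesis using undo[OF Fc] undo[OF Gc] VFU by metis
qed

definition mat_fun :: "(real \<Rightarrow> real) \<Rightarrow> complex mat \<Rightarrow> complex mat" where
  "mat_fun f A = (SOME F. spectral_fun f A F)"

text \<open>
  The logarithm acts on the support only: eigenvalue \<open>0\<close> is sent to \<open>0\<close>. This is the usual
  convention under which \<open>Tr[\<rho> (log \<rho> - log \<sigma>)]\<close> is read when \<open>supp \<rho> \<subseteq> supp \<sigma>\<close>.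
\<close>

definition mat_log2 :: "complex mat \<Rightarrow> complex mat" where
  "mat_log2 = mat_fun (\<lambda>x. if x > 0 then log 2 x else 0)"

definition rel_entropy :: "complex mat \<Rightarrow> complex mat \<Rightarrow> ereal" where
  "rel_entropy \<rho> \<sigma> =
     (if supp_mat \<rho> \<subseteq> supp_mat \<sigma>
      then ereal (Re (mat_trace (\<rho> * (mat_log2 \<rho> - mat_log2 \<sigma>)))) else \<infinity>)"

definition channel_div ::
    "nat \<Rightarrow> (complex mat \<Rightarrow> complex mat) \<Rightarrow> (complex mat \<Rightarrow> complex mat) \<Rightarrow> ereal" where
  "channel_div dA N M = (SUP \<rho>\<in>density_ops dA. rel_entropy (N \<rho>) (M \<rho>))"


section \<open>Hypothesis testing and Stein exponents\<close>

definition neg_log2 :: "real \<Rightarrow> ereal" where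
  "neg_log2 x = (if x > 0 then ereal (- log 2 x) else \<infinity>)"

definition tests :: "nat \<Rightarrow> complex mat set" where
  "tests n = {P. loewner_le n (0\<^sub>m n n) P \<and> loewner_le n P (1\<^sub>m n)}"

definition hyp_div :: "real \<Rightarrow> complex mat \<Rightarrow> complex mat \<Rightarrow> ereal" where
  "hyp_div \<epsilon> \<rho> \<sigma> =
     neg_log2 (INF P\<in>{P \<in> tests (dim_row \<rho>). Re (mat_trace (P * \<rho>)) \<ge> 1 - \<epsilon>}.
       Re (mat_trace (P * \<sigma>)))"

definition hyp_div_PRO ::
    "real \<Rightarrow> nat \<Rightarrow> (complex mat \<Rightarrow> complex mat) \<Rightarrow> (complex mat \<Rightarrow> complex mat) \<Rightarrow> nat \<Rightarrow> ereal"
  where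
  "hyp_div_PRO \<epsilon> dA N M n =
     (SUP \<phi>s\<in>{\<phi>s. length \<phi>s = n \<and> set \<phi>s \<subseteq> density_ops dA}.
        hyp_div \<epsilon> (tensor_list (map N \<phi>s)) (tensor_list (map M \<phi>s)))"

definition stein_PRO_sup ::
    "real \<Rightarrow> nat \<Rightarrow> (complex mat \<Rightarrow> complex mat) \<Rightarrow> (complex mat \<Rightarrow> complex mat) \<Rightarrow> ereal" where
  "stein_PRO_sup \<epsilon> dA N M = limsup (\<lambda>n. ereal (1 / real n) * hyp_div_PRO \<epsilon> dA N M n)"

definition stein_PRO_inf ::
    "real \<Rightarrow> nat \<Rightarrow> (complex mat \<Rightarrow> complex mat) \<Rightarrow> (complex mat \<Rightarrow> complex mat) \<Rightarrow> ereal" where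
  "stein_PRO_inf \<epsilon> dA N M = liminf (\<lambda>n. ereal (1 / real n) * hyp_div_PRO \<epsilon> dA N M n)"

end

theory Submission
  imports Defs
    "HOL-Analysis.Continuum_Not_Denumerable"
begin

text \<open>
  Diagonalize \<open>\<rho> = \<Sum>\<^sub>i r\<^sub>i |e\<^sub>i\<rangle>\<langle>e\<^sub>i|\<close> and \<open>\<sigma> = \<Sum>\<^sub>j s\<^sub>j |f\<^sub>j\<rangle>\<langle>f\<^sub>j|\<close>. The Nussbaum--Szkola distributions
  \<open>p(i,j) = r\<^sub>i |\<langle>f\<^sub>j,e\<^sub>i\<rangle>|\<^sup>2\<close> and \<open>q(i,j) = s\<^sub>j |\<langle>f\<^sub>j,e\<^sub>i\<rangle>|\<^sup>2\<close> have the classical divergence \<open>D(\<rho>\<parallel>\<sigma>)\<close>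
  and are multiplicative under tensor products. For every \<open>l\<close> there is a projective test with
  \<open>Tr P\<sigma> \<le> 1 / l\<close> and \<open>Tr P\<rho> \<ge> p(p \<ge> l q)\<close>, and conversely every test satisfies
  \<open>(1 + t) (1 - Tr P\<rho>) + (1 + 1/t) l Tr P\<sigma> \<ge> \<Sum> min p (l q)\<close> for all \<open>t > 0\<close>. Both parts of Stein's lemma then
  follow from Markov's inequality for \<open>(p/q)\<^sup>u\<close>, with \<open>u < 0\<close> and \<open>u > 0\<close> close to \<open>0\<close>.

  In the converse the inputs vary, so \<open>u\<close> has to be uniform in the input \<open>\<phi>\<close>. If the channel
  divergence is finite, then \<open>\<langle>f, M(\<phi>) f\<rangle> = 0\<close> implies \<open>\<langle>f, N(\<phi>) f\<rangle> = 0\<close>. Both are sums of squares of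
  polynomials, so Hilbert's Nullstellensatz upgrades this to a Lojasiewicz inequality
  \<open>\<langle>f, N(\<phi>) f\<rangle>\<^sup>k \<le> C \<langle>f, M(\<phi>) f\<rangle>\<close>, which controls the moments of \<open>log (p/q)\<close> uniformly.
\<close>

section \<open>Polynomial functions and the Nullstellensatz\<close>

text \<open>The smallest nonzero eigenvalue of M(phi) need not have a positive lower bound as phi
  varies, and eigenbases may jump, so compactness alone does not control log (r_i / s_j). With the
  weight a = r_i |<f_j,e_i>|^2, the Lojasiewicz inequality gives a^k <= C s_j. Hence |log (r_i /
  s_j)| is of order log (1 / a) up to a constant, and a log^2 (1 / a) stays bounded even after
  multiplication by a small negative power of a; exponents up to 1 / (2 (k + 1)) are admissible. The
  Nullstellensatz speaks of complex zeros, so no conjugates may occur inside the squares; this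
  dictates the coordinates chosen for inputs. Polynomials are encoded as functions because only
  evaluation, substitution and growth are used. An infinite divergence at some input is the
  degenerate case u = 0 of achievability: some pair has q = 0 < p, and dropping it leaves a total
  p-mass below 1, so every rate is reached.\<close>

inductive_set polyfun :: "(('v \<Rightarrow> complex) \<Rightarrow> complex) set" where
  polyfun_const: "(\<lambda>z. c) \<in> polyfun"
| polyfun_var: "(\<lambda>z. z v) \<in> polyfun"
| polyfun_add: "f \<in> polyfun \<Longrightarrow> g \<in> polyfun \<Longrightarrow> (\<lambda>z. f z + g z) \<in> polyfun"
| polyfun_mult: "f \<in> polyfun \<Longrightarrow> g \<in> polyfun \<Longrightarrow> (\<lambda>z. f z * g z) \<in> polyfun"

lemma polyfun_diff:
  assumes "f \<in> polyfun" "g \<in> polyfun"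
  shows "(\<lambda>z. f z - g z) \<in> polyfun"
  using polyfun_add[OF assms(1) polyfun_mult[OF polyfun_const[of "-1"] assms(2)]] by simp

lemma polyfun_sum:
  assumes "\<And>i. i \<in> A \<Longrightarrow> f i \<in> polyfun"
  shows "(\<lambda>z. \<Sum>i\<in>A. f i z) \<in> polyfun"
  using assms by (induction A rule: infinite_finite_induct) (auto intro: polyfun.intros)

lemma polyfun_poly: "(\<lambda>z. poly p (z v)) \<in> polyfun"
proof (induction p)
  case (pCons a p)
  have "(\<lambda>z. a + z v * poly p (z v)) \<in> polyfun"
    by (intro polyfun_add polyfun_mult polyfun_const polyfun_var pCons.IH)
  then show ?case by simp
qed (simp add: polyfun_const)

lemma polyfun_compose:
  assumes "f \<in> polyfun" and "\<And>v. (\<lambda>z. g z v) \<in> polyfun"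
  shows "(\<lambda>z. f (g z)) \<in> polyfun"
  using assms(1) by induction (auto intro: polyfun.intros assms(2))

text \<open>Supplies the growth of a multiplier when the bounded functions in
  \<open>lojasiewicz\<close> are shown to form an ideal. The condition \<open>T >= 1\<close> lets
  two different exponents be replaced by their sum.\<close>

lemma polyfun_growth:
  assumes "f \<in> polyfun"
  obtains C k where "C \<ge> 0" "\<And>z T. T \<ge> 1 \<Longrightarrow> (\<And>v. cmod (z v) \<le> T) \<Longrightarrow> cmod (f z) \<le> C * T ^ k"
proof -
  have "\<exists>C\<ge>0. \<exists>k. \<forall>z T. T \<ge> 1 \<longrightarrow> (\<forall>v. cmod (z v) \<le> T) \<longrightarrow> cmod (f z) \<le> C * T ^ k"
    using assms
  proof induction
    case (polyfun_const c)
    show ?case by (rule exI[of _ "cmod c"], auto intro!: exI[of _ 0])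
  next
    case (polyfun_var v)
    show ?case by (rule exI[of _ 1], auto intro!: exI[of _ 1])
  next
    case (polyfun_add f g)
    from polyfun_add.IH(1) obtain C k where C: "C \<ge> 0"
      and f: "\<And>z T. T \<ge> 1 \<Longrightarrow> (\<And>v. cmod (z v) \<le> T) \<Longrightarrow> cmod (f z) \<le> C * T ^ k"
      by blast
    from polyfun_add.IH(2) obtain D l where D: "D \<ge> 0"
      and g: "\<And>z T. T \<ge> 1 \<Longrightarrow> (\<And>v. cmod (z v) \<le> T) \<Longrightarrow> cmod (g z) \<le> D * T ^ l"
      by blast
    have "cmod (f z + g z) \<le> (C + D) * T ^ (k + l)" if T: "T \<ge> 1" "\<And>v. cmod (z v) \<le> T" for z T
    proof -
      have "cmod (f z + g z) \<le> C * T ^ k + D * T ^ l"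
        using norm_triangle_ineq[of "f z" "g z"] f[of T z, OF T(1) T(2)] g[of T z, OF T(1) T(2)] by linarith
      also have "\<dots> \<le> C * T ^ (k + l) + D * T ^ (k + l)"
        using C D T(1) by (intro add_mono mult_left_mono power_increasing) auto
      finally show ?thesis by (simp add: algebra_simps)
    qed
    then show ?case using C D by (intro exI[of _ "C + D"] conjI exI[of _ "k + l"]) auto
  next
    case (polyfun_mult f g)
    from polyfun_mult.IH(1) obtain C k where C: "C \<ge> 0"
      and f: "\<And>z T. T \<ge> 1 \<Longrightarrow> (\<And>v. cmod (z v) \<le> T) \<Longrightarrow> cmod (f z) \<le> C * T ^ k"
      by blast
    from polyfun_mult.IH(2) obtain D l where D: "D \<ge> 0"
      and g: "\<And>z T. T \<ge> 1 \<Longrightarrow> (\<And>v. cmod (z v) \<le> T) \<Longrightarrow> cmod (g z) \<le> D * T ^ l"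
      by blast
    have "cmod (f z * g z) \<le> (C * D) * T ^ (k + l)" if T: "T \<ge> 1" "\<And>v. cmod (z v) \<le> T" for z T
    proof -
      have "cmod (f z * g z) \<le> (C * T ^ k) * (D * T ^ l)"
        unfolding norm_mult using C D T(1) f[of T z, OF T(1) T(2)] g[of T z, OF T(1) T(2)] by (intro mult_mono) auto
      then show ?thesis by (simp add: algebra_simps power_add)
    qed
    then show ?case using C D by (intro exI[of _ "C * D"] conjI exI[of _ "k + l"]) auto
  qed
  then show ?thesis using that by blast
qed

abbreviation monom_fun :: "'v list \<Rightarrow> ('v \<Rightarrow> complex) \<Rightarrow> complex" where
  "monom_fun vs z \<equiv> prod_list (map z vs)"

text \<open>Monomials are words in the variables, numbered by \<open>from_nat\<close>. Reordered
  words repeat a monomial, which is harmless: only a spanning sequence is wanted, with every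
  polynomial in the span of a finite initial segment.\<close>

lemma polyfun_span:
  fixes f :: "('v::countable \<Rightarrow> complex) \<Rightarrow> complex"
  assumes "f \<in> polyfun"
  shows "\<exists>n c. \<forall>z. f z = (\<Sum>i<n. c i * monom_fun (from_nat i :: 'v list) z)"
proof -
  define R where "R = {f. \<exists>n c. \<forall>z. f z = (\<Sum>i<n. c i * monom_fun (from_nat i :: 'v list) z)}"
  have single: "(\<lambda>z. c * monom_fun w z) \<in> R" for c and w :: "'v list"
  proof -
    have "c * monom_fun w z = (\<Sum>i<Suc (to_nat w). (if i = to_nat w then c else 0) * monom_fun (from_nat i :: 'v list) z)" for z
      by (subst sum.remove[of _ "to_nat w"]) auto
    then show ?thesis unfolding R_def
      by (intro CollectI exI[of _ "Suc (to_nat w)"] exI[of _ "\<lambda>i. if i = to_nat w then c else 0"]) blast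
  qed
  have add: "(\<lambda>z. f z + g z) \<in> R" if "f \<in> R" "g \<in> R" for f g
  proof -
    from that obtain n c m d where
      f: "\<And>z. f z = (\<Sum>i<n. c i * monom_fun (from_nat i :: 'v list) z)" and
      g: "\<And>z. g z = (\<Sum>i<m. d i * monom_fun (from_nat i :: 'v list) z)"
      unfolding R_def by blast
    have f': "f z = (\<Sum>i<max n m. (if i < n then c i else 0) * monom_fun (from_nat i :: 'v list) z)" for z
      unfolding f by (rule sum.mono_neutral_cong_left) auto
    have g': "g z = (\<Sum>i<max n m. (if i < m then d i else 0) * monom_fun (from_nat i :: 'v list) z)" for z
      unfolding g by (rule sum.mono_neutral_cong_left) auto
    have "f z + g z = (\<Sum>i<max n m. ((if i < n then c i else 0) + (if i < m then d i else 0))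
       * monom_fun (from_nat i :: 'v list) z)" for z
      unfolding f' g' by (simp add: sum.distrib ring_distribs)
    then show ?thesis unfolding R_def
      by (intro CollectI exI[of _ "max n m"]
          exI[of _ "\<lambda>i. (if i < n then c i else 0) + (if i < m then d i else 0)"]) blast
  qed
  have zero: "(\<lambda>z. 0) \<in> R" unfolding R_def by (auto intro!: exI[of _ 0])
  have sum: "(\<lambda>z. \<Sum>i\<in>A. h i z) \<in> R" if "\<And>i. i \<in> A \<Longrightarrow> h i \<in> R" for A :: "nat set" and h
    using that by (induction A rule: infinite_finite_induct) (auto intro: zero add)
  have "f \<in> R" using assms
  proof induction
    case (polyfun_const c)
    show ?case using single[of c "[]"] by simp
  next
    case (polyfun_var v)
    show ?case using single[of 1 "[v]"] by simp
  next
    case (polyfun_add f g)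
    then show ?case by (intro add)
  next
    case (polyfun_mult f g)
    then obtain n c m d where
      f: "\<And>z. f z = (\<Sum>i<n. c i * monom_fun (from_nat i :: 'v list) z)" and
      g: "\<And>z. g z = (\<Sum>i<m. d i * monom_fun (from_nat i :: 'v list) z)"
      unfolding R_def by blast
    have "(\<lambda>z. \<Sum>i<n. \<Sum>j<m. (c i * d j) * monom_fun ((from_nat i :: 'v list) @ from_nat j) z) \<in> R"
      by (intro sum single)
    moreover have "f z * g z = (\<Sum>i<n. \<Sum>j<m. (c i * d j) * monom_fun ((from_nat i :: 'v list) @ from_nat j) z)" for z
      unfolding f g by (simp add: sum_product algebra_simps)
    ultimately show ?case by simp
  qed
  then show ?thesis by (simp add: R_def)
qed

text \<open>Elimination: a vector with nonzero last entry serves as pivot to clear that entry from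
  all others, and the induction hypothesis applies to what remains.\<close>

lemma linear_dependence:
  fixes c :: "nat \<Rightarrow> nat \<Rightarrow> 'a::field"
  shows "\<exists>d. (\<exists>j\<le>n. d j \<noteq> 0) \<and> (\<forall>i<n. (\<Sum>j\<le>n. d j * c j i) = 0)"
proof (induction n arbitrary: c)
  case 0
  show ?case by (auto intro!: exI[of _ "\<lambda>_. 1"])
next
  case (Suc n)
  show ?case
  proof (cases "\<exists>j\<le>Suc n. c j n \<noteq> 0")
    case False
    obtain d where d: "\<exists>j\<le>n. d j \<noteq> 0" "\<forall>i<n. (\<Sum>j\<le>n. d j * c j i) = 0" using Suc[of c] by auto
    define e where "e j = (if j \<le> n then d j else 0)" for j
    have "(\<Sum>j\<le>Suc n. e j * c j i) = 0" if "i < Suc n" for i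
    proof (cases "i < n")
      case True
      then show ?thesis using d(2) by (simp add: e_def)
    next
      case False
      then have "i = n" using that by simp
      then show ?thesis using \<open>\<not> (\<exists>j\<le>Suc n. c j n \<noteq> 0)\<close> by (intro sum.neutral) auto
    qed
    moreover have "\<exists>j\<le>Suc n. e j \<noteq> 0" using d(1) unfolding e_def by (metis le_SucI)
    ultimately show ?thesis by (intro exI[of _ e]) blast
  next
    case True
    then obtain p where p: "p \<le> Suc n" "c p n \<noteq> 0" by blast
    \<comment> \<open>Enumerates \<open>{..Suc n}\<close> without the pivot index, so that the
      induction hypothesis can speak of \<open>{..n}\<close>.\<close>
    define s where "s j = (if j < p then j else Suc j)" for j
    have bij: "bij_betw s {..n} ({..Suc n} - {p})"
    proof (rule bij_betw_imageI)
      show "inj_on s {..n}" by (auto simp: inj_on_def s_def split: if_splits)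
      have "x \<in> s ` {..n}" if "x \<le> Suc n" "x \<noteq> p" for x
      proof (cases "x < p")
        case True
        then show ?thesis using p by (intro image_eqI[of _ _ x]) (auto simp: s_def)
      next
        case False
        then show ?thesis using that by (intro image_eqI[of _ _ "x - 1"]) (auto simp: s_def)
      qed
      then show "s ` {..n} = {..Suc n} - {p}" using p by (auto simp: s_def)
    qed
    obtain d where d: "\<exists>j\<le>n. d j \<noteq> 0"
      "\<forall>i<n. (\<Sum>j\<le>n. d j * (c (s j) i - c (s j) n / c p n * c p i)) = 0"
      using Suc[of "\<lambda>j i. c (s j) i - c (s j) n / c p n * c p i"] by auto
    define t where "t = the_inv_into {..n} s"
    have t: "t (s j) = j" if "j \<le> n" for j
      using bij that unfolding t_def bij_betw_def by (simp add: the_inv_into_f_f)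
    \<comment> \<open>The pivot receives the coefficient that cancels the last entry; the other
      entries cancel by the choice of \<open>d\<close>.\<close>
    define e where "e j = (if j = p then - (\<Sum>j\<le>n. d j * c (s j) n / c p n) else d (t j))" for j
    have sp: "s j \<noteq> p" for j by (auto simp: s_def)
    have split: "(\<Sum>j\<le>Suc n. e j * c j i) = e p * c p i + (\<Sum>j\<le>n. d j * c (s j) i)" for i
    proof -
      have "(\<Sum>j\<le>Suc n. e j * c j i) = e p * c p i + (\<Sum>j\<in>{..Suc n} - {p}. e j * c j i)"
        using p by (subst sum.remove[of _ p]) auto
      also have "(\<Sum>j\<in>{..Suc n} - {p}. e j * c j i) = (\<Sum>j\<le>n. e (s j) * c (s j) i)"
        using sum.reindex_bij_betw[OF bij, of "\<lambda>j. e j * c j i"] by simp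
      also have "\<dots> = (\<Sum>j\<le>n. d j * c (s j) i)" by (intro sum.cong) (auto simp: e_def sp t)
      finally show ?thesis .
    qed
    have "(\<Sum>j\<le>Suc n. e j * c j i) = 0" if "i < Suc n" for i
    proof (cases "i < n")
      case True
      with d(2) have "(\<Sum>j\<le>n. d j * c (s j) i) = (\<Sum>j\<le>n. d j * c (s j) n / c p n) * c p i"
        by (simp add: right_diff_distrib sum_subtractf sum_distrib_right mult.assoc)
      then show ?thesis unfolding split by (simp add: e_def)
    next
      case False
      then have "i = n" using that by simp
      then show ?thesis unfolding split using p(2)
        by (simp add: e_def sum_distrib_right)
    qed
    moreover have "\<exists>j\<le>Suc n. e j \<noteq> 0"
    proof -
      obtain j where j: "j \<le> n" "d j \<noteq> 0" using d(1) by blast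
      then have "e (s j) \<noteq> 0" by (simp add: e_def sp t)
      then show ?thesis using j bij unfolding bij_betw_def by blast
    qed
    ultimately show ?thesis by (intro exI[of _ e]) blast
  qed
qed

section \<open>Ideals of polynomial functions and their common zeros\<close>

definition poly_ideal :: "(('v \<Rightarrow> complex) \<Rightarrow> complex) set \<Rightarrow> bool" where
  "poly_ideal I \<longleftrightarrow> I \<subseteq> polyfun \<and> (\<lambda>z. 0) \<in> I \<and> (\<forall>f\<in>I. \<forall>g\<in>I. (\<lambda>z. f z + g z) \<in> I) \<and>
     (\<forall>f\<in>polyfun. \<forall>g\<in>I. (\<lambda>z. f z * g z) \<in> I)"

lemma poly_ideal_sum:
  assumes I: "poly_ideal I" and "\<And>i. i \<in> A \<Longrightarrow> f i \<in> I"
  shows "(\<lambda>z. \<Sum>i\<in>A. f i z) \<in> I"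
  using assms(2) by (induction A rule: infinite_finite_induct) (use I in \<open>auto simp: poly_ideal_def\<close>)

text \<open>Zorn's lemma on the proper ideals above \<open>I\<close>. The last clause is maximality
  in the form in which it is used: the quotient by \<open>J\<close> is a field.\<close>

lemma exists_maximal_ideal:
  fixes I :: "(('v \<Rightarrow> complex) \<Rightarrow> complex) set"
  assumes I: "poly_ideal I" and one: "(\<lambda>z. 1) \<notin> I"
  shows "\<exists>J. poly_ideal J \<and> I \<subseteq> J \<and> (\<lambda>z. 1) \<notin> J \<and>
    (\<forall>f\<in>polyfun. f \<notin> J \<longrightarrow> (\<exists>b\<in>polyfun. (\<lambda>z. b z * f z - 1) \<in> J))"
proof -
  define A where "A = {J. poly_ideal J \<and> I \<subseteq> J \<and> (\<lambda>z::'v \<Rightarrow> complex. 1::complex) \<notin> J}"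
  have "\<exists>J\<in>A. \<forall>X\<in>A. J \<subseteq> X \<longrightarrow> X = J"
  proof (rule subset_Zorn_nonempty)
    show "A \<noteq> {}" using I one by (auto simp: A_def)
    fix C assume C: "C \<noteq> {}" "subset.chain A C"
    then have CA: "C \<subseteq> A" and ch: "\<And>X Y. X \<in> C \<Longrightarrow> Y \<in> C \<Longrightarrow> X \<subseteq> Y \<or> Y \<subseteq> X"
      by (auto simp: subset.chain_def)
    have id: "poly_ideal X" if "X \<in> C" for X using CA that by (auto simp: A_def)
    have "(\<lambda>z. f z + g z) \<in> \<Union>C" if "f \<in> \<Union>C" "g \<in> \<Union>C" for f g
    proof -
      from that obtain X Y where XY: "X \<in> C" "Y \<in> C" "f \<in> X" "g \<in> Y" by blast
      then obtain Z where "Z \<in> C" "f \<in> Z" "g \<in> Z" using ch[of X Y] by blast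
      then show ?thesis using id[of Z] unfolding poly_ideal_def by blast
    qed
    moreover have "(\<lambda>z. f z * g z) \<in> \<Union>C" if "f \<in> polyfun" "g \<in> \<Union>C" for f g
      using that id unfolding poly_ideal_def by blast
    moreover have "\<Union>C \<subseteq> polyfun" "(\<lambda>z. 0) \<in> \<Union>C" using id C(1) unfolding poly_ideal_def by blast+
    ultimately have "poly_ideal (\<Union>C)" unfolding poly_ideal_def by blast
    then show "\<Union>C \<in> A" using CA C(1) by (auto simp: A_def)
  qed
  then obtain J where J: "J \<in> A" and mx: "\<And>X. X \<in> A \<Longrightarrow> J \<subseteq> X \<Longrightarrow> X = J" by blast
  have Ji: "poly_ideal J" using J by (simp add: A_def)
  have "\<exists>b\<in>polyfun. (\<lambda>z. b z * f z - 1) \<in> J" if f: "f \<in> polyfun" "f \<notin> J" for f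
  proof -
    \<comment> \<open>The ideal generated by \<open>J\<close> and \<open>f\<close>. It is larger
      than \<open>J\<close>, so by maximality it contains 1, and this yields the inverse
      \<open>b\<close> of \<open>f\<close> modulo \<open>J\<close>.\<close>
    define X where "X = {\<lambda>z. b z * f z + g z | b g. b \<in> polyfun \<and> g \<in> J}"
    have JX: "J \<subseteq> X"
    proof
      fix g assume "g \<in> J"
      then have "(\<lambda>z. 0 * f z + g z) \<in> X"
        unfolding X_def using polyfun_const[of 0] by (intro CollectI exI[of _ "\<lambda>z. 0"] exI[of _ g]) auto
      then show "g \<in> X" by simp
    qed
    have fX: "f \<in> X"
    proof -
      have "(\<lambda>z. 1 * f z + 0) \<in> X" unfolding X_def using polyfun_const[of 1] Ji
        by (intro CollectI exI[of _ "\<lambda>z. 1"] exI[of _ "\<lambda>z. 0"]) (auto simp: poly_ideal_def)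
      then show ?thesis by simp
    qed
    have "poly_ideal X" unfolding poly_ideal_def
    proof (intro conjI ballI)
      show "X \<subseteq> polyfun" using Ji f unfolding X_def poly_ideal_def by (auto intro!: polyfun.intros)
      show "(\<lambda>z. 0) \<in> X" using JX Ji by (auto simp: poly_ideal_def)
    next
      fix h h' assume "h \<in> X" "h' \<in> X"
      then obtain b g b' g' where h: "h = (\<lambda>z. b z * f z + g z)" "h' = (\<lambda>z. b' z * f z + g' z)"
        "b \<in> polyfun" "b' \<in> polyfun" "g \<in> J" "g' \<in> J" unfolding X_def by blast
      then have "(\<lambda>z. (b z + b' z) * f z + (g z + g' z)) \<in> X"
        using Ji polyfun_add[of b b'] unfolding X_def poly_ideal_def
        by (intro CollectI exI[of _ "\<lambda>z. b z + b' z"] exI[of _ "\<lambda>z. g z + g' z"]) auto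
      then show "(\<lambda>z. h z + h' z) \<in> X" unfolding h by (simp add: algebra_simps)
    next
      fix h h' :: "('v \<Rightarrow> complex) \<Rightarrow> complex" assume "h \<in> polyfun" "h' \<in> X"
      then obtain b g where h: "h' = (\<lambda>z. b z * f z + g z)"
        "b \<in> polyfun" "h \<in> polyfun" "g \<in> J" unfolding X_def by blast
      then have "(\<lambda>z. (h z * b z) * f z + (h z * g z)) \<in> X"
        using Ji polyfun_mult[of h b] unfolding X_def poly_ideal_def
        by (intro CollectI exI[of _ "\<lambda>z. h z * b z"] exI[of _ "\<lambda>z. h z * g z"]) auto
      then show "(\<lambda>z. h z * h' z) \<in> X" unfolding h by (simp add: algebra_simps)
    qed
    moreover have "X \<noteq> J" using fX f by blast
    ultimately have "(\<lambda>z. 1) \<in> X" using mx[of X] JX J by (auto simp: A_def)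
    then obtain b g where bg: "(\<lambda>z. 1) = (\<lambda>z. b z * f z + g z)" "b \<in> polyfun" "g \<in> J"
      unfolding X_def by blast
    have "(\<lambda>z. h z * h' z) \<in> J" if "h \<in> polyfun" "h' \<in> J" for h h'
      using Ji that unfolding poly_ideal_def by blast
    from this[OF polyfun_const bg(3)] have "(\<lambda>z. (-1) * g z) \<in> J" .
    moreover have "(\<lambda>z. (-1) * g z) = (\<lambda>z. b z * f z - 1)"
    proof
      fix z show "(-1) * g z = b z * f z - 1" using fun_cong[OF bg(1), of z] by (simp add: algebra_simps)
    qed
    ultimately show ?thesis using bg(2) by auto
  qed
  then show ?thesis using J by (auto simp: A_def)
qed

lemma uncountable_UNIV_complex: "uncountable (UNIV :: complex set)"
proof
  assume "countable (UNIV :: complex set)"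
  then have "countable (Re ` UNIV)" by (rule countable_image)
  moreover have "Re ` UNIV = (UNIV :: real set)" by (metis Re_complex_of_real surj_def)
  ultimately show False using uncountable_UNIV_real by simp
qed

text \<open>
  The quotient by a maximal ideal has countable dimension, so the inverses of \<open>X\<^sub>v - a\<close>,
  where \<open>a\<close> runs through the uncountable field, cannot be linearly independent.
\<close>

theorem nullstellensatz:
  fixes I :: "(('v::countable \<Rightarrow> complex) \<Rightarrow> complex) set"
  assumes "poly_ideal I" and "(\<lambda>z. 1) \<notin> I"
  shows "\<exists>x. \<forall>f\<in>I. f x = 0"
proof -
  obtain J where J: "poly_ideal J" and IJ: "I \<subseteq> J" and one: "(\<lambda>z. 1) \<notin> J"
    and inv: "\<And>f. f \<in> polyfun \<Longrightarrow> f \<notin> J \<Longrightarrow> \<exists>b\<in>polyfun. (\<lambda>z. b z * f z - 1) \<in> J"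
    using exists_maximal_ideal[OF assms] by blast
  have Jadd: "(\<lambda>z. f z + g z) \<in> J" if "f \<in> J" "g \<in> J" for f g
    using J that unfolding poly_ideal_def by blast
  have Jmult: "(\<lambda>z. f z * g z) \<in> J" if "f \<in> polyfun" "g \<in> J" for f g
    using J that unfolding poly_ideal_def by blast
  have J0: "(\<lambda>z. 0) \<in> J" using J unfolding poly_ideal_def by blast
  have const: "c = 0" if "(\<lambda>z. c) \<in> J" for c
  proof (rule ccontr)
    assume "c \<noteq> 0"
    then show False using Jmult[OF polyfun_const[of "1 / c"] that] one by simp
  qed
  \<comment> \<open>A field has no zero divisors: of the linear factors of \<open>p\<close>, which
    exist over the complex numbers, one must vanish in the quotient.\<close>
  have lin: "\<exists>a. (\<lambda>z. z v - a) \<in> J" if "p \<noteq> 0" "(\<lambda>z. poly p (z v)) \<in> J" for p v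
    using that
  proof (induction "degree p" arbitrary: p)
    case 0
    then obtain c where "p = [:c:]" by (metis degree_eq_zeroE)
    then show ?case using const[of c] 0 by simp
  next
    case (Suc n)
    then have "\<not> constant (poly p)" by (simp add: constant_degree)
    then obtain a where "poly p a = 0" using fundamental_theorem_of_algebra by blast
    then obtain q where q: "p = [:- a, 1:] * q" by (auto simp: poly_eq_0_iff_dvd)
    have q0: "q \<noteq> 0" using Suc q by auto
    have deg: "degree q = n" using Suc(2) q0 unfolding q by (subst (asm) degree_mult_eq) auto
    show ?case
    proof (cases "(\<lambda>z. z v - a) \<in> J")
      case False
      moreover have "(\<lambda>z. z v - a) \<in> polyfun" by (intro polyfun_diff polyfun.intros)
      ultimately obtain b where b: "b \<in> polyfun" "(\<lambda>z. b z * (z v - a) - 1) \<in> J" using inv by blast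
      have "(\<lambda>z. b z * poly p (z v) + (-1 * poly q (z v)) * (b z * (z v - a) - 1)) \<in> J"
        using b Suc(4) by (intro Jadd Jmult polyfun_mult polyfun_poly polyfun_const)
      also have "(\<lambda>z. b z * poly p (z v) + (-1 * poly q (z v)) * (b z * (z v - a) - 1)) = (\<lambda>z. poly q (z v))"
        unfolding q by (simp add: algebra_simps fun_eq_iff)
      finally show ?thesis using Suc(1)[of q] deg q0 by simp
    qed blast
  qed
  have "\<exists>a. (\<lambda>z. z v - a) \<in> J" for v
  proof (rule ccontr)
    assume neg: "\<nexists>a. (\<lambda>z. z v - a) \<in> J"
    have "\<exists>b\<in>polyfun. (\<lambda>z. b z * (z v - a) - 1) \<in> J" for a
      using neg by (intro inv polyfun_diff polyfun.intros) auto
    then have "\<forall>a. \<exists>b. b \<in> polyfun \<and> (\<lambda>z. b z * (z v - a) - 1) \<in> J" by blast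
    from choice[OF this] obtain b where b: "\<And>a. b a \<in> polyfun" "\<And>a. (\<lambda>z. b a z * (z v - a) - 1) \<in> J"
      by blast
    have "\<forall>a. \<exists>n c. \<forall>z. b a z = (\<Sum>i<n. c i * monom_fun (from_nat i :: 'v list) z)"
      using polyfun_span[OF b(1)] by blast
    from choice[OF this] obtain n where
      "\<forall>a. \<exists>c. \<forall>z. b a z = (\<Sum>i<n a. c i * monom_fun (from_nat i :: 'v list) z)" by blast
    from choice[OF this] obtain c where
      nc: "\<And>a z. b a z = (\<Sum>i<n a. c a i * monom_fun (from_nat i :: 'v list) z)" by blast
    \<comment> \<open>There are uncountably many \<open>a\<close> but only countably many values
      \<open>n a\<close>. So infinitely many inverses lie in the span of the same \<open>m\<close>
      monomials, and any \<open>m + 1\<close> of them are dependent.\<close>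
    have "\<exists>m. infinite {a. n a = m}"
    proof (rule ccontr)
      assume "\<nexists>m. infinite {a. n a = m}"
      then have "countable (\<Union>m. {a. n a = m})" by (intro countable_UN) (auto intro: countable_finite)
      moreover have "(\<Union>m. {a. n a = m}) = UNIV" by auto
      ultimately show False using uncountable_UNIV_complex by simp
    qed
    then obtain m where "infinite {a. n a = m}" by blast
    then obtain s :: "nat \<Rightarrow> complex" where s: "inj s" "\<And>j. n (s j) = m"
      using infinite_countable_subset[of "{a. n a = m}"] by auto
    obtain d j0 where j0: "j0 \<le> m" "d j0 \<noteq> 0"
      and d: "\<forall>i<m. (\<Sum>j\<le>m. d j * c (s j) i) = 0"
      using linear_dependence[of m "\<lambda>j. c (s j)"] by blast
    have zero: "(\<Sum>j\<le>m. d j * b (s j) z) = 0" for z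
    proof -
      have "(\<Sum>j\<le>m. d j * b (s j) z) = (\<Sum>j\<le>m. \<Sum>i<m. d j * c (s j) i * monom_fun (from_nat i :: 'v list) z)"
        by (simp add: nc s sum_distrib_left mult.assoc)
      also have "\<dots> = (\<Sum>i<m. (\<Sum>j\<le>m. d j * c (s j) i) * monom_fun (from_nat i :: 'v list) z)"
        by (subst sum.swap) (simp add: sum_distrib_right)
      also have "\<dots> = 0" using d by simp
      finally show ?thesis .
    qed
    \<comment> \<open>Clearing denominators in the relation between the inverses of
      \<open>z v - s j\<close> makes \<open>G\<close> vanish modulo \<open>J\<close>. At
      \<open>s j0\<close> only the summand \<open>j0\<close> of \<open>G\<close> survives, so
      \<open>G\<close> itself is not zero.\<close>
    define P where "P j = (\<Prod>i\<in>{..m} - {j}. [:- s i, 1:])" for j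
    define G where "G = (\<Sum>j\<le>m. smult (d j) (P j))"
    have P0: "poly (P j) (s k) = 0" if "k \<le> m" "k \<noteq> j" for j k
      unfolding P_def poly_prod using that by (intro prod_zero) auto
    have "poly G (s j0) = d j0 * poly (P j0) (s j0)"
      unfolding G_def poly_sum using j0(1)
      by (subst sum.remove[of _ j0]) (auto intro!: sum.neutral simp: P0)
    moreover have "poly (P j0) (s j0) \<noteq> 0"
      using s(1) by (auto simp: P_def poly_prod inj_def)
    ultimately have G0: "G \<noteq> 0" using j0 by auto
    define W where "W = (\<Prod>i\<le>m. [:- s i, 1:])"
    have W: "W = [:- s j, 1:] * P j" if "j \<le> m" for j
      unfolding W_def P_def using that by (subst prod.remove[of _ j]) auto
    \<comment> \<open>Modulo \<open>J\<close>, each \<open>P j\<close> equals \<open>b (s j)\<close>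
      times \<open>W\<close>; the relation \<open>zero\<close> then removes all multiples of
      \<open>W\<close> and leaves \<open>G\<close>.\<close>
    have "(\<lambda>z. \<Sum>j\<le>m. (- d j * poly (P j) (z v)) * (b (s j) z * (z v - s j) - 1)) \<in> J"
      by (intro poly_ideal_sum[OF J] Jmult b polyfun_mult polyfun_poly polyfun_const)
    also have "(\<lambda>z. \<Sum>j\<le>m. (- d j * poly (P j) (z v)) * (b (s j) z * (z v - s j) - 1)) = (\<lambda>z. poly G (z v))"
    proof
      fix z
      have "(- d j * poly (P j) (z v)) * (b (s j) z * (z v - s j) - 1)
          = d j * poly (P j) (z v) - d j * b (s j) z * poly W (z v)" if "j \<le> m" for j
        unfolding W[OF that] by (simp add: algebra_simps)
      then have "(\<Sum>j\<le>m. (- d j * poly (P j) (z v)) * (b (s j) z * (z v - s j) - 1))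
          = (\<Sum>j\<le>m. d j * poly (P j) (z v)) - (\<Sum>j\<le>m. d j * b (s j) z) * poly W (z v)"
        by (simp add: sum_subtractf sum_distrib_right)
      then show "(\<Sum>j\<le>m. (- d j * poly (P j) (z v)) * (b (s j) z * (z v - s j) - 1)) = poly G (z v)"
        by (simp add: zero G_def poly_sum)
    qed
    finally show False using lin[OF G0] neg by blast
  qed
  then have "\<forall>v. \<exists>a. (\<lambda>z. z v - a) \<in> J" by blast
  from choice[OF this] obtain x where x: "\<And>v. (\<lambda>z. z v - x v) \<in> J" by blast
  \<comment> \<open>The coordinates are constant modulo \<open>J\<close>, hence so is every
    polynomial. As \<open>J\<close> is proper, the value at \<open>x\<close> of an element of
    \<open>J\<close> must be 0.\<close>
  have red: "(\<lambda>z. f z - f x) \<in> J" if "f \<in> polyfun" for f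
    using that
  proof induction
    case (polyfun_const c)
    show ?case using J0 by simp
  next
    case (polyfun_var v)
    show ?case by (rule x)
  next
    case (polyfun_add f g)
    have "(\<lambda>z. (f z - f x) + (g z - g x)) \<in> J" by (intro Jadd polyfun_add)
    then show ?case by (simp add: algebra_simps)
  next
    case (polyfun_mult f g)
    have "(\<lambda>z. f z * (g z - g x) + g x * (f z - f x)) \<in> J"
      by (intro Jadd Jmult polyfun_mult polyfun.polyfun_const)
    then show ?case by (simp add: algebra_simps)
  qed
  have "f x = 0" if "f \<in> I" for f
  proof -
    have fp: "f \<in> polyfun" "f \<in> J" using that IJ J by (auto simp: poly_ideal_def)
    have "(\<lambda>z. f z + (-1) * (f z - f x)) \<in> J"
      by (intro Jadd Jmult red fp polyfun_const)
    then show ?thesis using const[of "f x"] by simp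
  qed
  then show ?thesis by blast
qed

text \<open>Rabinowitsch's trick made quantitative. With new variables y_a, the equations q_b = 0
  and sum y_a p_a = 1 have no common solution. At y_a = conj p_a / G, where G is the sum of the
  |p_a|^2, the resulting identity for 1 has coefficients that grow at most like a power of 1 / G,
  and this is the claim.\<close>

lemma lojasiewicz:
  fixes p q :: "nat \<Rightarrow> ('v::countable \<Rightarrow> complex) \<Rightarrow> complex"
  assumes p: "\<And>a. a < K \<Longrightarrow> p a \<in> polyfun" and q: "\<And>b. b < L \<Longrightarrow> q b \<in> polyfun"
    and zeros: "\<And>x a. (\<And>b. b < L \<Longrightarrow> q b x = 0) \<Longrightarrow> a < K \<Longrightarrow> p a x = 0"
  shows "\<exists>C\<ge>1. \<exists>k\<ge>1::nat. \<forall>x. (\<forall>v. cmod (x v) \<le> 1) \<longrightarrow>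
    (\<Sum>a<K. (cmod (p a x))\<^sup>2) ^ k \<le> C * (\<Sum>b<L. cmod (q b x))"
proof -
  define Q where "Q x = (\<Sum>b<L. cmod (q b x))" for x
  have Q0: "Q x \<ge> 0" for x unfolding Q_def by (intro sum_nonneg) auto
  define px where "px z = (\<lambda>v. z (Inl v))" for z :: "'v + nat \<Rightarrow> complex"
  define R where "R z = (\<Sum>a<K. z (Inr a) * p a (px z))" for z
  define D where "D z T \<longleftrightarrow> T \<ge> 1 \<and> (\<forall>v. cmod (z (Inl v)) \<le> 1) \<and> (\<forall>a. cmod (z (Inr a)) \<le> T) \<and> R z = 1"
    for z and T :: real
  \<comment> \<open>Instead of tracking cofactors, the estimate that they would give is made the
    definition of an ideal; the Nullstellensatz then only has to show that 1 belongs to it.\<close>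
  define I where "I = {f \<in> polyfun. \<exists>C\<ge>0. \<exists>k. \<forall>z T. D z T \<longrightarrow> cmod (f z) \<le> C * T ^ k * Q (px z)}"
  have IE: "\<exists>C k. C \<ge> 0 \<and> (\<forall>z T. D z T \<longrightarrow> cmod (f z) \<le> C * T ^ k * Q (px z))" if "f \<in> I" for f
    using that unfolding I_def by blast
  have comp: "(\<lambda>z. f (px z)) \<in> polyfun" if "f \<in> polyfun" for f
    unfolding px_def using that by (rule polyfun_compose) (rule polyfun_var)
  have ideal: "poly_ideal I" unfolding poly_ideal_def
  proof (intro conjI ballI)
    show "I \<subseteq> polyfun" by (auto simp: I_def)
    show "(\<lambda>z. 0) \<in> I" by (auto simp: I_def polyfun_const Q0 intro!: exI[of _ 0])
  next
    fix f g assume fg: "f \<in> I" "g \<in> I"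
    from IE[OF fg(1)] obtain C k where C: "C \<ge> 0" "\<And>z T. D z T \<Longrightarrow> cmod (f z) \<le> C * T ^ k * Q (px z)" by blast
    from IE[OF fg(2)] obtain E l where E: "E \<ge> 0" "\<And>z T. D z T \<Longrightarrow> cmod (g z) \<le> E * T ^ l * Q (px z)" by blast
    have "cmod (f z + g z) \<le> (C + E) * T ^ (k + l) * Q (px z)" if D: "D z T" for z T
    proof -
      have T: "T \<ge> 1" using D by (simp add: D_def)
      have "cmod (f z + g z) \<le> C * T ^ k * Q (px z) + E * T ^ l * Q (px z)"
        using norm_triangle_ineq[of "f z" "g z"] C(2)[OF D] E(2)[OF D] by linarith
      also have "\<dots> \<le> C * T ^ (k + l) * Q (px z) + E * T ^ (k + l) * Q (px z)"
        using C(1) E(1) T Q0[of "px z"]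
        by (intro add_mono mult_right_mono mult_left_mono power_increasing) auto
      finally show ?thesis by (simp add: algebra_simps)
    qed
    moreover have "(\<lambda>z. f z + g z) \<in> polyfun" using fg by (intro polyfun_add) (auto simp: I_def)
    ultimately show "(\<lambda>z. f z + g z) \<in> I" unfolding I_def using C(1) E(1)
      by (intro CollectI conjI exI[of _ "C + E"] exI[of _ "k + l"]) auto
  next
    fix f g :: "('v + nat \<Rightarrow> complex) \<Rightarrow> complex" assume fg: "f \<in> polyfun" "g \<in> I"
    obtain C k where C: "C \<ge> 0" "\<And>z T. T \<ge> 1 \<Longrightarrow> (\<And>v. cmod (z v) \<le> T) \<Longrightarrow> cmod (f z) \<le> C * T ^ k"
      using polyfun_growth[OF fg(1)] by blast
    from IE[OF fg(2)] obtain E l where E: "E \<ge> 0" "\<And>z T. D z T \<Longrightarrow> cmod (g z) \<le> E * T ^ l * Q (px z)" by blast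
    have "cmod (f z * g z) \<le> (C * E) * T ^ (k + l) * Q (px z)" if D: "D z T" for z T
    proof -
      have T: "T \<ge> 1" using D by (simp add: D_def)
      have "cmod (z v) \<le> T" for v
        using D by (cases v) (auto simp: D_def intro: order_trans[of _ 1])
      then have "cmod (f z) \<le> C * T ^ k" using C(2)[of T z] T by blast
      then have "cmod (f z * g z) \<le> (C * T ^ k) * (E * T ^ l * Q (px z))"
        unfolding norm_mult using E(2)[OF D] C(1) T by (intro mult_mono) auto
      then show ?thesis by (simp add: algebra_simps power_add)
    qed
    moreover have "(\<lambda>z. f z * g z) \<in> polyfun" using fg by (intro polyfun_mult) (auto simp: I_def)
    ultimately show "(\<lambda>z. f z * g z) \<in> I" unfolding I_def using C(1) E(1)
      by (intro CollectI conjI exI[of _ "C * E"] exI[of _ "k + l"]) auto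
  qed
  have qI: "(\<lambda>z. q b (px z)) \<in> I" if "b < L" for b
  proof -
    have "cmod (q b x) \<le> Q x" for x
      unfolding Q_def using that by (intro member_le_sum) auto
    then show ?thesis unfolding I_def using comp[OF q[OF that]]
      by (intro CollectI conjI exI[of _ 1] exI[of _ 0]) auto
  qed
  have "(\<lambda>z. R z) \<in> polyfun" unfolding R_def
    by (intro polyfun_sum polyfun_mult polyfun_var comp p) auto
  then have RI: "(\<lambda>z. R z - 1) \<in> I" unfolding I_def
    by (intro CollectI conjI exI[of _ 0] exI[of _ 0] polyfun_diff polyfun_const) (auto simp: D_def)
  have "(\<lambda>z. 1) \<in> I"
  proof (rule ccontr)
    assume "(\<lambda>z. 1) \<notin> I"
    then obtain z where z: "\<And>f. f \<in> I \<Longrightarrow> f z = 0" using nullstellensatz[OF ideal] by blast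
    have "q b (px z) = 0" if "b < L" for b using z[OF qI[OF that]] .
    then have "p a (px z) = 0" if "a < K" for a using zeros that by blast
    then have "R z = 0" by (simp add: R_def)
    then show False using z[OF RI] by simp
  qed
  from IE[OF this] obtain C k where C: "C \<ge> 0"
    and bound: "\<And>z T. D z T \<Longrightarrow> 1 \<le> C * T ^ k * Q (px z)" by auto
  have "\<exists>E\<ge>0. \<forall>x. (\<forall>v. cmod (x v) \<le> 1) \<longrightarrow> cmod (p a x) \<le> E" if a: "a < K" for a
  proof -
    obtain E l where E: "E \<ge> 0" "\<And>z T. T \<ge> 1 \<Longrightarrow> (\<And>v. cmod (z v) \<le> T) \<Longrightarrow> cmod (p a z) \<le> E * T ^ l"
      using polyfun_growth[OF p[OF a]] by blast
    show ?thesis using E(1) E(2)[of 1] by (intro exI[of _ E]) auto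
  qed
  then have "\<forall>a. \<exists>E. a < K \<longrightarrow> E \<ge> 0 \<and> (\<forall>x. (\<forall>v. cmod (x v) \<le> 1) \<longrightarrow> cmod (p a x) \<le> E)" by blast
  from choice[OF this] obtain E where E0: "\<And>a. a < K \<Longrightarrow> E a \<ge> 0"
    and E: "\<And>a x. a < K \<Longrightarrow> (\<forall>v. cmod (x v) \<le> 1) \<Longrightarrow> cmod (p a x) \<le> E a" by blast
  define B0 where "B0 = 1 + (\<Sum>a<K. E a)"
  \<comment> \<open>Large enough to dominate both G and every |p_a|, so that
    \<open>T = B / G\<close> below is at least 1 and bounds the new variables.\<close>
  define B where "B = real (K + 1) * B0\<^sup>2"
  have B01: "B0 \<ge> 1" unfolding B0_def using sum_nonneg[of "{..<K}" E] E0 by simp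
  have pB0: "cmod (p a x) \<le> B0" if "a < K" "\<forall>v. cmod (x v) \<le> 1" for a x
  proof -
    have "E a \<le> (\<Sum>a<K. E a)" using that E0 by (intro member_le_sum) auto
    then show ?thesis using E[OF that] by (simp add: B0_def)
  qed
  have B0sq: "B0 \<le> B0\<^sup>2" using B01 by (simp add: power2_eq_square)
  have B0B: "B0 \<le> B"
  proof -
    have "1 * B0\<^sup>2 \<le> real (K + 1) * B0\<^sup>2" by (intro mult_right_mono) auto
    then show ?thesis using B0sq unfolding B_def by linarith
  qed
  \<comment> \<open>The exponent \<open>Suc k\<close> instead of \<open>k\<close> makes the left
    side vanish when all \<open>p a x\<close> do.\<close>
  have main: "(\<Sum>a<K. (cmod (p a x))\<^sup>2) ^ Suc k \<le> max 1 (C * B ^ Suc k) * Q x"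
    if x: "\<forall>v. cmod (x v) \<le> 1" for x
  proof -
    define G where "G = (\<Sum>a<K. (cmod (p a x))\<^sup>2)"
    have G0: "G \<ge> 0" unfolding G_def by (intro sum_nonneg) auto
    show ?thesis
    proof (cases "G = 0")
      case True
      then show ?thesis using Q0[of x] unfolding G_def[symmetric] by simp
    next
      case False
      then have Gp: "G > 0" using G0 by simp
      have GB: "G \<le> B"
      proof -
        have "G \<le> (\<Sum>a<K. B0\<^sup>2)" unfolding G_def using pB0 x by (intro sum_mono power_mono) auto
        also have "\<dots> \<le> B" unfolding B_def by (simp add: mult_right_mono)
        finally show ?thesis .
      qed
      define T where "T = B / G"
      define z where "z = case_sum x (\<lambda>a. if a < K then cnj (p a x) / of_real G else 0)"
      have pz: "px z = x" by (simp add: px_def z_def)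
      have "D z T" unfolding D_def
      proof (intro conjI allI)
        show T1: "T \<ge> 1" using GB Gp by (simp add: T_def)
        show "cmod (z (Inl v)) \<le> 1" for v using x by (simp add: z_def)
        show "cmod (z (Inr a)) \<le> T" for a
        proof (cases "a < K")
          case True
          have "cmod (p a x) / G \<le> B / G" using pB0[OF True x] B0B Gp by (intro divide_right_mono) auto
          then show ?thesis using True Gp by (simp add: z_def T_def norm_divide)
        next
          case False
          then show ?thesis using T1 by (simp add: z_def)
        qed
        have "R z = of_real (\<Sum>a<K. (cmod (p a x))\<^sup>2) / of_real G"
          unfolding R_def pz sum_divide_distrib of_real_sum
          by (intro sum.cong) (auto simp: z_def complex_norm_square mult.commute simp del: of_real_power)
        then show "R z = 1" using Gp unfolding G_def[symmetric] by simp
      qed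
      from bound[OF this] have "1 \<le> C * T ^ k * Q x" by (simp add: pz)
      moreover have "T \<ge> 1" using \<open>D z T\<close> by (simp add: D_def)
      then have "C * T ^ k * Q x \<le> C * T ^ Suc k * Q x"
        using C Q0[of x] by (intro mult_right_mono mult_left_mono power_increasing) auto
      ultimately have "1 * G ^ Suc k \<le> C * T ^ Suc k * Q x * G ^ Suc k"
        using G0 by (intro mult_right_mono) auto
      also have "\<dots> = C * B ^ Suc k * Q x"
        using Gp by (simp add: T_def power_divide field_simps)
      also have "\<dots> \<le> max 1 (C * B ^ Suc k) * Q x" using Q0[of x] by (intro mult_right_mono) auto
      finally show ?thesis by (simp add: G_def)
    qed
  qed
  show ?thesis
    by (rule exI[of _ "max 1 (C * B ^ Suc k)"], intro conjI exI[of _ "Suc k"] allI impI main[unfolded Q_def]) auto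
qed

section \<open>Diagonalization of Hermitian matrices\<close>

lemma mat_adjoint_carrier [simp]:
  "A \<in> carrier_mat n m \<Longrightarrow> mat_adjoint A \<in> carrier_mat m n"
  by (auto simp: mat_adjoint_def)

lemma mat_adjoint_index [simp]:
  fixes A :: "complex mat"
  assumes "A \<in> carrier_mat n m" "i < m" "j < n"
  shows "mat_adjoint A $$ (i, j) = cnj (A $$ (j, i))"
  using assms by (auto simp: mat_adjoint_def mat_of_rows_def cols_def)

lemma mat_mult_index:
  assumes "A \<in> carrier_mat n m" "B \<in> carrier_mat m l" "i < n" "j < l"
  shows "(A * B) $$ (i, j) = (\<Sum>k<m. A $$ (i, k) * B $$ (k, j))"
  using assms by (auto simp: scalar_prod_def atLeast0LessThan intro!: sum.cong)

lemma mat_adjoint_mult: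
  fixes A B :: "complex mat"
  assumes "A \<in> carrier_mat n m" "B \<in> carrier_mat m l"
  shows "mat_adjoint (A * B) = mat_adjoint B * mat_adjoint A"
proof (rule eq_matI)
  have AB: "A * B \<in> carrier_mat n l" using assms by simp
  fix i j assume "i < dim_row (mat_adjoint B * mat_adjoint A)" "j < dim_col (mat_adjoint B * mat_adjoint A)"
  then have ij: "i < l" "j < n" using assms by (auto simp: mat_adjoint_def)
  show "mat_adjoint (A * B) $$ (i, j) = (mat_adjoint B * mat_adjoint A) $$ (i, j)"
    using assms ij
    by (simp only: mat_adjoint_index[OF AB] mat_mult_index[OF assms]
        mat_mult_index[OF mat_adjoint_carrier[OF assms(2)] mat_adjoint_carrier[OF assms(1)]])
      (simp add: mat_adjoint_index[OF assms(1)] mat_adjoint_index[OF assms(2)] mult.commute)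
qed (use assms in \<open>auto simp: mat_adjoint_def\<close>)

lemma mat_adjoint_adjoint:
  fixes A :: "complex mat"
  assumes A: "A \<in> carrier_mat n m"
  shows "mat_adjoint (mat_adjoint A) = A"
proof (rule eq_matI)
  fix i j assume "i < dim_row A" "j < dim_col A"
  then have ij: "i < n" "j < m" using A by auto
  show "mat_adjoint (mat_adjoint A) $$ (i, j) = A $$ (i, j)"
    unfolding mat_adjoint_index[OF mat_adjoint_carrier[OF A] ij] mat_adjoint_index[OF A ij(2,1)] by simp
qed (use A in \<open>auto simp: mat_adjoint_def\<close>)

lemma hermitian_mat_index:
  "hermitian_mat n A \<longleftrightarrow> A \<in> carrier_mat n n \<and> (\<forall>i<n. \<forall>j<n. A $$ (i, j) = cnj (A $$ (j, i)))"
proof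
  assume "hermitian_mat n A"
  then have A: "A \<in> carrier_mat n n" "mat_adjoint A = A" by (auto simp: hermitian_mat_def)
  then show "A \<in> carrier_mat n n \<and> (\<forall>i<n. \<forall>j<n. A $$ (i, j) = cnj (A $$ (j, i)))"
    using mat_adjoint_index[OF A(1)] by metis
next
  assume A: "A \<in> carrier_mat n n \<and> (\<forall>i<n. \<forall>j<n. A $$ (i, j) = cnj (A $$ (j, i)))"
  then have Ac: "A \<in> carrier_mat n n" by blast
  have "mat_adjoint A = A"
  proof (rule eq_matI)
    fix i j assume "i < dim_row A" "j < dim_col A"
    then have ij: "i < n" "j < n" using Ac by auto
    have "mat_adjoint A $$ (i, j) = cnj (A $$ (j, i))" using mat_adjoint_index[OF Ac ij] .
    also have "\<dots> = A $$ (i, j)" using A ij by metis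
    finally show "mat_adjoint A $$ (i, j) = A $$ (i, j)" .
  qed (use Ac in \<open>auto simp: mat_adjoint_def\<close>)
  with Ac show "hermitian_mat n A" by (simp add: hermitian_mat_def)
qed

lemma unitary_mat_cols:
  assumes U: "unitary_mat n U" and ij: "i < n" "j < n"
  shows "(\<Sum>a<n. cnj (U $$ (a, i)) * U $$ (a, j)) = (if i = j then 1 else 0)"
proof -
  have Uc: "U \<in> carrier_mat n n" using U by (simp add: unitary_mat_def)
  have "(\<Sum>a<n. cnj (U $$ (a, i)) * U $$ (a, j)) = (mat_adjoint U * U) $$ (i, j)"
    unfolding mat_mult_index[OF mat_adjoint_carrier[OF Uc] Uc ij] using mat_adjoint_index[OF Uc ij(1)]
    by (intro sum.cong) auto
  then show ?thesis using U ij by (simp add: unitary_mat_def)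
qed

lemma unitary_mat_col_norm:
  assumes "unitary_mat n U" "i < n"
  shows "(\<Sum>a<n. (cmod (U $$ (a, i)))\<^sup>2) = 1"
proof -
  have "complex_of_real (\<Sum>a<n. (cmod (U $$ (a, i)))\<^sup>2) = 1"
    using unitary_mat_cols[OF assms(1,2,2)]
    unfolding of_real_sum complex_norm_square by (simp add: mult.commute)
  then show ?thesis by (simp only: of_real_eq_1_iff)
qed

lemma unitary_mat_rows:
  assumes U: "unitary_mat n U" and ij: "i < n" "j < n"
  shows "(\<Sum>a<n. U $$ (i, a) * cnj (U $$ (j, a))) = (if i = j then 1 else 0)"
proof -
  have Uc: "U \<in> carrier_mat n n" using U by (simp add: unitary_mat_def)
  have "(\<Sum>a<n. U $$ (i, a) * cnj (U $$ (j, a))) = (U * mat_adjoint U) $$ (i, j)"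
    unfolding mat_mult_index[OF Uc mat_adjoint_carrier[OF Uc] ij] using mat_adjoint_index[OF Uc _ ij(2)]
    by (intro sum.cong) auto
  then show ?thesis using U ij by (simp add: unitary_mat_def)
qed

lemma unitary_matI:
  assumes Uc: "U \<in> carrier_mat n n"
    and cols: "\<And>i j. i < n \<Longrightarrow> j < n \<Longrightarrow> (\<Sum>a<n. cnj (U $$ (a, i)) * U $$ (a, j)) = (if i = j then 1 else 0)"
  shows "unitary_mat n U"
proof -
  have "mat_adjoint U * U = 1\<^sub>m n"
  proof (rule eq_matI)
    fix i j assume "i < dim_row (1\<^sub>m n :: complex mat)" "j < dim_col (1\<^sub>m n :: complex mat)"
    then have ij: "i < n" "j < n" by auto
    have "(mat_adjoint U * U) $$ (i, j) = (\<Sum>a<n. cnj (U $$ (a, i)) * U $$ (a, j))"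
      unfolding mat_mult_index[OF mat_adjoint_carrier[OF Uc] Uc ij] using mat_adjoint_index[OF Uc ij(1)]
      by (intro sum.cong) auto
    then show "(mat_adjoint U * U) $$ (i, j) = 1\<^sub>m n $$ (i, j)" using cols[OF ij] ij by simp
  qed (use Uc in \<open>auto simp: mat_adjoint_def\<close>)
  moreover from this have "U * mat_adjoint U = 1\<^sub>m n"
    using mat_mult_left_right_inverse[of "mat_adjoint U" n U] Uc by simp
  ultimately show ?thesis using Uc by (simp add: unitary_mat_def)
qed

text \<open>The factorization demanded by \<open>spectral_fun\<close>, with eigenbasis and
  eigenvalues as explicit arguments, since the later estimates refer to both.\<close>

definition eigen_dec :: "nat \<Rightarrow> complex mat \<Rightarrow> complex mat \<Rightarrow> (nat \<Rightarrow> real) \<Rightarrow> bool" where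
  "eigen_dec n A U r \<longleftrightarrow> unitary_mat n U \<and>
     A = U * mat_diag n (\<lambda>i. complex_of_real (r i)) * mat_adjoint U"

lemma mult_diag_adjoint_index:
  fixes U :: "complex mat"
  assumes U: "U \<in> carrier_mat n n" and ab: "a < n" "b < n"
  shows "(U * mat_diag n d * mat_adjoint U) $$ (a, b) = (\<Sum>i<n. U $$ (a, i) * d i * cnj (U $$ (b, i)))"
proof -
  have c: "U * mat_diag n d \<in> carrier_mat n n" using U by (metis mat_diag_dim mult_carrier_mat)
  show ?thesis
    unfolding mat_mult_index[OF c mat_adjoint_carrier[OF U] ab]
    using ab U mat_diag_mult_right[OF U, of d]  mat_adjoint_index[OF U _ ab(2)] by (intro sum.cong) auto
qed

lemma eigen_dec_carrier:
  assumes "eigen_dec n A U r"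
  shows "A \<in> carrier_mat n n" "U \<in> carrier_mat n n" "unitary_mat n U"
proof -
  show u: "unitary_mat n U" using assms by (simp add: eigen_dec_def)
  then show U: "U \<in> carrier_mat n n" by (simp add: unitary_mat_def)
  show "A \<in> carrier_mat n n" using assms U unfolding eigen_dec_def
    by (metis mat_adjoint_carrier mat_diag_dim mult_carrier_mat)
qed

lemma eigen_dec_index:
  assumes "eigen_dec n A U r" "a < n" "b < n"
  shows "A $$ (a, b) = (\<Sum>i<n. U $$ (a, i) * of_real (r i) * cnj (U $$ (b, i)))"
  using mult_diag_adjoint_index[OF eigen_dec_carrier(2)[OF assms(1)] assms(2,3)] assms(1)
  by (simp add: eigen_dec_def)

lemma eigen_decI:
  assumes A: "A \<in> carrier_mat n n" and U: "unitary_mat n U"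
    and ab: "\<And>a b. a < n \<Longrightarrow> b < n \<Longrightarrow> A $$ (a, b) = (\<Sum>i<n. U $$ (a, i) * of_real (r i) * cnj (U $$ (b, i)))"
  shows "eigen_dec n A U r"
proof -
  have Uc: "U \<in> carrier_mat n n" using U by (simp add: unitary_mat_def)
  have Dc: "U * mat_diag n (\<lambda>i. complex_of_real (r i)) * mat_adjoint U \<in> carrier_mat n n"
    using Uc by (metis mat_adjoint_carrier mat_diag_dim mult_carrier_mat)
  have "A = U * mat_diag n (\<lambda>i. complex_of_real (r i)) * mat_adjoint U"
  proof (rule eq_matI)
    fix a b assume "a < dim_row (U * mat_diag n (\<lambda>i. complex_of_real (r i)) * mat_adjoint U)"
      "b < dim_col (U * mat_diag n (\<lambda>i. complex_of_real (r i)) * mat_adjoint U)"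
    then have "a < n" "b < n" using Dc by auto
    then show "A $$ (a, b) = (U * mat_diag n (\<lambda>i. complex_of_real (r i)) * mat_adjoint U) $$ (a, b)"
      using ab mult_diag_adjoint_index[OF Uc] by simp
  qed (use A Dc in auto)
  then show ?thesis using U by (simp add: eigen_dec_def)
qed

lemma unitary_mat_mult:
  assumes "unitary_mat n U" "unitary_mat n V"
  shows "unitary_mat n (U * V)"
proof -
  define U' V' where "U' = mat_adjoint U" and "V' = mat_adjoint V"
  have c: "U \<in> carrier_mat n n" "V \<in> carrier_mat n n" using assms by (auto simp: unitary_mat_def)
  then have c': "U' \<in> carrier_mat n n" "V' \<in> carrier_mat n n" by (auto simp: U'_def V'_def)
  have e: "U' * U = 1\<^sub>m n" "U * U' = 1\<^sub>m n" "V' * V = 1\<^sub>m n" "V * V' = 1\<^sub>m n"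
    using assms by (auto simp: unitary_mat_def U'_def V'_def)
  have "V' * U' * (U * V) = V' * (U' * U) * V" "U * V * (V' * U') = U * (V * V') * U'"
    using c c' by (auto simp: assoc_mult_mat[of _ n n _ n _ n] mult_carrier_mat[of _ n n _ n])
  then show ?thesis
    using c c' e unfolding unitary_mat_def mat_adjoint_mult[OF c] U'_def[symmetric] V'_def[symmetric]
    by (simp add: mult_carrier_mat[of _ n n _ n])
qed

lemma eigen_dec_conj:
  assumes A: "eigen_dec n A U r" and H: "unitary_mat n H"
  shows "eigen_dec n (H * A * mat_adjoint H) (H * U) r"
proof -
  define H' U' where "H' = mat_adjoint H" and "U' = mat_adjoint U"
  have c: "H \<in> carrier_mat n n" "U \<in> carrier_mat n n" using H eigen_dec_carrier[OF A] by (auto simp: unitary_mat_def)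
  then have c': "H' \<in> carrier_mat n n" "U' \<in> carrier_mat n n" by (auto simp: H'_def U'_def)
  define D where "D = mat_diag n (\<lambda>i. complex_of_real (r i))"
  have D: "D \<in> carrier_mat n n" by (simp add: D_def)
  have "A = U * D * U'" using A by (simp add: eigen_dec_def U'_def D_def)
  then have "H * A * H' = H * U * D * (U' * H')"
    using c c' D by (auto simp: assoc_mult_mat[of _ n n _ n _ n] mult_carrier_mat[of _ n n _ n])
  then show ?thesis unfolding eigen_dec_def mat_adjoint_mult[OF c]
    using unitary_mat_mult[OF H] A by (simp add: H'_def U'_def D_def eigen_dec_def)
qed

text \<open>The Householder reflection along w = v - e_n. It can send e_n to v because the last
  entry c of v is real; c <= 0 keeps |w|^2 = 2 (1 - c) away from 0, and \<open>\<beta>\<close> is 2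
  / |w|^2.\<close>

lemma exists_reflection:
  fixes v :: "nat \<Rightarrow> complex"
  assumes norm: "(\<Sum>a<Suc n. v a * cnj (v a)) = 1" and vn: "v n = of_real c" "c \<le> 0"
  obtains H where "unitary_mat (Suc n) H" "mat_adjoint H = H" "\<And>a. a < Suc n \<Longrightarrow> H $$ (a, n) = v a"
proof -
  define w where "w a = v a - (if a = n then 1 else 0)" for a
  define \<beta> :: complex where "\<beta> = 1 / (1 - of_real c)"
  define m where "m = Suc n"
  have c1: "1 - complex_of_real c \<noteq> 0"
  proof
    assume "1 - complex_of_real c = 0"
    then have "complex_of_real c = of_real 1" by simp
    then have "c = 1" by (simp only: of_real_eq_iff)
    then show False using vn(2) by simp
  qed
  have wn: "(\<Sum>a<m. w a * cnj (w a)) = 2 * (1 - of_real c)"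
  proof -
    have "w a * cnj (w a) = v a * cnj (v a) - (if a = n then v a + cnj (v a) - 1 else 0)" for a
      by (simp add: w_def algebra_simps)
    then have "(\<Sum>a<m. w a * cnj (w a)) = 1 - (v n + cnj (v n) - 1)"
      using norm by (simp add: sum_subtractf m_def)
    then show ?thesis by (simp add: vn)
  qed
  define H where "H = Matrix.mat m m (\<lambda>(a, b). (if a = b then 1 else 0) - \<beta> * w a * cnj (w b))"
  have Hc: "H \<in> carrier_mat m m" by (simp add: H_def)
  have \<beta>: "cnj \<beta> = \<beta>" by (simp add: \<beta>_def)
  have Hab: "H $$ (a, b) = (if a = b then 1 else 0) - \<beta> * w a * cnj (w b)" if "a < m" "b < m" for a b
    using that by (simp add: H_def)
  have "hermitian_mat m H" unfolding hermitian_mat_index using Hc by (auto simp: Hab \<beta>)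
  then have adj: "mat_adjoint H = H" by (simp add: hermitian_mat_def)
  have "unitary_mat m H"
  proof (rule unitary_matI[OF Hc])
    fix i j assume ij: "i < m" "j < m"
    have "(\<Sum>a<m. cnj (H $$ (a, i)) * H $$ (a, j))
        = (\<Sum>a<m. (if a = i then (if i = j then 1 else 0) - \<beta> * w i * cnj (w j) else 0)
            - (if a = j then \<beta> * w i * cnj (w j) else 0)
            + \<beta> * \<beta> * w i * cnj (w j) * (w a * cnj (w a)))"
      using ij by (intro sum.cong) (auto simp: Hab \<beta> algebra_simps)
    also have "\<dots> = (if i = j then 1 else 0) - 2 * \<beta> * w i * cnj (w j)
        + \<beta> * \<beta> * w i * cnj (w j) * (\<Sum>a<m. w a * cnj (w a))"
      using ij by (simp add: sum.distrib sum_subtractf sum_distrib_left)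
    also have "\<dots> = (if i = j then 1 else 0)"
    proof -
      have "\<beta> * \<beta> * w i * cnj (w j) * (2 * (1 - of_real c))
          = 2 * \<beta> * w i * cnj (w j) * (\<beta> * (1 - of_real c))" by (simp only: mult_ac)
      also have "\<beta> * (1 - of_real c) = 1" using c1 by (simp add: \<beta>_def)
      finally show ?thesis unfolding wn by simp
    qed
    finally show "(\<Sum>a<m. cnj (H $$ (a, i)) * H $$ (a, j)) = (if i = j then 1 else 0)" .
  qed
  moreover have "H $$ (a, n) = v a" if "a < m" for a
  proof -
    have "\<beta> * w a * cnj (w n) = - w a" using c1 by (simp add: \<beta>_def w_def[of n] vn field_simps)
    then show ?thesis using Hab[OF that, of n] by (simp add: m_def w_def)
  qed
  ultimately show ?thesis using adj that unfolding m_def by blast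
qed

lemma eigenvector_exists:
  fixes A :: "complex mat"
  assumes A: "A \<in> carrier_mat (Suc n) (Suc n)"
  obtains k v where "v \<in> carrier_vec (Suc n)" "v \<noteq> 0\<^sub>v (Suc n)" "A *\<^sub>v v = k \<cdot>\<^sub>v v"
proof -
  have "degree (char_poly A) = Suc n" using degree_monic_char_poly[OF A] by blast
  then have "\<not> constant (poly (char_poly A))" by (simp add: constant_degree)
  then obtain k where "poly (char_poly A) k = 0" using fundamental_theorem_of_algebra by blast
  then have "eigenvalue A k" using eigenvalue_root_char_poly[OF A] by simp
  then show ?thesis using that A unfolding eigenvalue_def eigenvector_def by auto
qed

text \<open>Deflation: a reflection moves a unit eigenvector to the last basis vector, Hermitian
  symmetry clears the rest of the last row and column, and the remaining block is diagonalized by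
  induction.\<close>

theorem hermitian_eigen_dec:
  assumes "hermitian_mat n A"
  shows "\<exists>U r. eigen_dec n A U r"
  using assms
proof (induction n arbitrary: A)
  case 0
  then have "A \<in> carrier_mat 0 0" by (simp add: hermitian_mat_def)
  then have "eigen_dec 0 A (1\<^sub>m 0) (\<lambda>_. 0)" by (intro eigen_decI unitary_matI) auto
  then show ?case by blast
next
  case (Suc n)
  let ?m = "Suc n"
  have A: "A \<in> carrier_mat ?m ?m" "mat_adjoint A = A" using Suc.prems by (auto simp: hermitian_mat_def)
  obtain k x where x: "x \<in> carrier_vec ?m" "x \<noteq> 0\<^sub>v ?m" "A *\<^sub>v x = k \<cdot>\<^sub>v x"
    using eigenvector_exists[OF A(1)] .
  define N where "N = (\<Sum>a<?m. (cmod (x $ a))\<^sup>2)"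
  obtain a0 where a0: "a0 < ?m" "x $ a0 \<noteq> 0" using x by (metis eq_vecI carrier_vecD index_zero_vec)
  have "(cmod (x $ a0))\<^sup>2 \<le> N" unfolding N_def using a0 by (intro member_le_sum) auto
  moreover have "(cmod (x $ a0))\<^sup>2 > 0" using a0 by simp
  ultimately have N: "N > 0" by linarith
  \<comment> \<open>The phase that turns the last entry of the eigenvector into a nonpositive real
    number, as \<open>exists_reflection\<close> demands.\<close>
  define ph where "ph = (if x $ n = 0 then 1 else - cnj (x $ n) / of_real (cmod (x $ n)))"
  have ph1: "ph * cnj ph = 1"
  proof -
    have "cmod ph = 1" by (simp add: ph_def norm_divide)
    then show ?thesis by (metis complex_norm_square of_real_1 one_power2)
  qed
  have phx: "ph * x $ n = of_real (- cmod (x $ n))"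
    by (simp add: ph_def power2_eq_square field_simps complex_norm_square[symmetric] flip: complex_norm_square)
  define s where "s = ph / of_real (sqrt N)"
  define v where "v a = s * x $ a" for a
  have ss: "s * cnj s = 1 / of_real N"
  proof -
    have "s * cnj s = (ph * cnj ph) / (of_real (sqrt N) * of_real (sqrt N))" by (simp add: s_def)
    also have "\<dots> = 1 / of_real (sqrt N * sqrt N)" by (simp only: ph1 of_real_mult)
    finally show ?thesis using N by simp
  qed
  have norm: "(\<Sum>a<?m. v a * cnj (v a)) = 1"
  proof -
    have "(\<Sum>a<?m. v a * cnj (v a)) = (\<Sum>a<?m. (s * cnj s) * (x $ a * cnj (x $ a)))"
      by (intro sum.cong) (auto simp: v_def)
    also have "\<dots> = (s * cnj s) * of_real N"
      unfolding N_def of_real_sum sum_distrib_left[symmetric]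
      by (intro arg_cong2[of _ _ _ _ "(*)"] sum.cong refl complex_norm_square[symmetric])
    finally show ?thesis using ss N by simp
  qed
  have vn: "v n = of_real (- cmod (x $ n) / sqrt N)" using phx by (simp add: v_def s_def)
  obtain H where H: "unitary_mat ?m H" "mat_adjoint H = H" "\<And>a. a < ?m \<Longrightarrow> H $$ (a, n) = v a"
    using exists_reflection[OF norm vn] N by auto
  have Hc: "H \<in> carrier_mat ?m ?m" using H by (simp add: unitary_mat_def)
  have HH: "H * H = 1\<^sub>m ?m" using H by (simp add: unitary_mat_def)
  define e :: "complex vec" where "e = unit_vec ?m n"
  have ec: "e \<in> carrier_vec ?m" by (simp add: e_def)
  have He: "H *\<^sub>v e = s \<cdot>\<^sub>v x"
  proof (rule eq_vecI)
    fix a assume "a < dim_vec (s \<cdot>\<^sub>v x)"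
    then have a: "a < ?m" using x by simp
    have "(H *\<^sub>v e) $ a = H $$ (a, n)"
      using a Hc by (simp add: e_def)
    then show "(H *\<^sub>v e) $ a = (s \<cdot>\<^sub>v x) $ a" using H(3)[OF a] x a by (simp add: v_def)
  qed (use Hc x in auto)
  define B where "B = H * A * H"
  have Bc: "B \<in> carrier_mat ?m ?m" using Hc A by (simp add: B_def)
  have "mat_adjoint B = B"
    unfolding B_def mat_adjoint_mult[OF mult_carrier_mat[OF Hc A(1)] Hc] mat_adjoint_mult[OF Hc A(1)] H(2) A(2)
    using Hc A by (simp add: assoc_mult_mat[of _ ?m ?m _ ?m _ ?m])
  then have "hermitian_mat ?m B" using Bc by (simp only: hermitian_mat_def)
  then have Bh: "\<And>i j. i < ?m \<Longrightarrow> j < ?m \<Longrightarrow> B $$ (i, j) = cnj (B $$ (j, i))"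
    unfolding hermitian_mat_index by blast
  have "B *\<^sub>v e = H *\<^sub>v (A *\<^sub>v (H *\<^sub>v e))"
    using Hc A ec by (simp add: B_def assoc_mult_mat_vec[of _ ?m ?m _ ?m] mult_carrier_mat[of _ ?m ?m _ ?m] mult_mat_vec_carrier[of _ ?m ?m])
  also have "A *\<^sub>v (H *\<^sub>v e) = k \<cdot>\<^sub>v (H *\<^sub>v e)"
    unfolding He using x A(1) by (simp add: mult_mat_vec[of _ ?m ?m] smult_smult_assoc mult.commute)
  also have "H *\<^sub>v (k \<cdot>\<^sub>v (H *\<^sub>v e)) = k \<cdot>\<^sub>v ((H * H) *\<^sub>v e)"
    using Hc ec by (simp add: mult_mat_vec[of _ ?m ?m] assoc_mult_mat_vec[of _ ?m ?m _ ?m] mult_mat_vec_carrier[of _ ?m ?m])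
  also have "\<dots> = k \<cdot>\<^sub>v e" unfolding HH using ec by simp
  finally have Be: "B *\<^sub>v e = k \<cdot>\<^sub>v e" .
  have Bn: "B $$ (a, n) = (if a = n then k else 0)" if a: "a < ?m" for a
  proof -
    have "B $$ (a, n) = (B *\<^sub>v e) $ a" using a Bc by (simp add: e_def)
    also have "\<dots> = (if a = n then k else 0)" unfolding Be using a by (simp add: e_def)
    finally show ?thesis .
  qed
  have Bn': "B $$ (n, a) = (if a = n then k else 0)" if a: "a < n" for a
    using Bh[of n a] Bn[of a] a by simp
  \<comment> \<open>The eigenvalue is a diagonal entry of the Hermitian matrix \<open>B\<close>,
    hence real.\<close>
  have "k = cnj k" using Bh[of n n] Bn[of n] by (metis lessI)
  then have kr: "k = of_real (Re k)" by (metis Reals_cnj_iff of_real_Re)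
  define B' where "B' = Matrix.mat n n (\<lambda>(a, b). B $$ (a, b))"
  have "hermitian_mat n B'" unfolding hermitian_mat_index by (auto simp: B'_def intro: Bh)
  from Suc.IH[OF this] obtain U' r' where U': "eigen_dec n B' U' r'" by blast
  note U'c = eigen_dec_carrier[OF U']
  define U where "U = Matrix.mat ?m ?m (\<lambda>(a, b). if a < n \<and> b < n then U' $$ (a, b) else if a = b then 1 else 0)"
  define r where "r i = (if i < n then r' i else Re k)" for i
  have "eigen_dec ?m B U r"
  proof (rule eigen_decI[OF Bc])
    show "unitary_mat ?m U"
    proof (rule unitary_matI)
      fix i j assume ij: "i < ?m" "j < ?m"
      show "(\<Sum>a<?m. cnj (U $$ (a, i)) * U $$ (a, j)) = (if i = j then 1 else 0)"
        using ij unitary_mat_cols[OF U'c(3), of i j] by (cases "i < n"; cases "j < n") (auto simp: U_def)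
    qed (simp add: U_def)
    fix a b assume ab: "a < ?m" "b < ?m"
    show "B $$ (a, b) = (\<Sum>i<?m. U $$ (a, i) * of_real (r i) * cnj (U $$ (b, i)))"
    proof (cases "a < n \<and> b < n")
      case True
      then have "B $$ (a, b) = B' $$ (a, b)" by (simp add: B'_def)
      then show ?thesis using True eigen_dec_index[OF U', of a b] by (simp add: U_def r_def)
    next
      case False
      then show ?thesis using ab Bn[of a] Bn'[of b] kr
        by (cases "a < n"; cases "b < n") (auto simp: U_def r_def less_Suc_eq)
    qed
  qed
  from eigen_dec_conj[OF this H(1)] have "eigen_dec ?m (H * B * H) (H * U) r" by (simp add: H(2))
  moreover have "H * B * H = (H * H) * A * (H * H)"
    using Hc A by (simp add: B_def assoc_mult_mat[of _ ?m ?m _ ?m _ ?m] mult_carrier_mat[of _ ?m ?m _ ?m])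
  then have "H * B * H = A" using A by (simp add: HH)
  ultimately show ?case by auto
qed

section \<open>Coordinates in an orthonormal basis\<close>

text \<open>Coordinates with respect to the columns of \<open>U\<close>, when \<open>U\<close> is
  unitary. Vectors are functions on indices of which only the values below \<open>n\<close>
  count.\<close>

definition coef :: "nat \<Rightarrow> complex mat \<Rightarrow> (nat \<Rightarrow> complex) \<Rightarrow> nat \<Rightarrow> complex" where
  "coef n U x i = (\<Sum>a<n. cnj (U $$ (a, i)) * x a)"

lemma coef_cong: "(\<And>a. a < n \<Longrightarrow> x a = y a) \<Longrightarrow> coef n U x i = coef n U y i"
  unfolding coef_def by (intro sum.cong) auto

lemma coef_col:
  assumes "unitary_mat n U" "i < n" "j < n"
  shows "coef n U (\<lambda>a. U $$ (a, i)) j = (if i = j then 1 else 0)"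
  unfolding coef_def using unitary_mat_cols[OF assms(1,3,2)] by auto

lemma coef_linear_comb:
  "coef n V (\<lambda>a. \<Sum>i\<in>I. f i a * y i) j = (\<Sum>i\<in>I. coef n V (f i) j * y i)"
proof -
  have "coef n V (\<lambda>a. \<Sum>i\<in>I. f i a * y i) j = (\<Sum>a<n. \<Sum>i\<in>I. cnj (V $$ (a, j)) * f i a * y i)"
    by (simp add: coef_def sum_distrib_left mult.assoc)
  also have "\<dots> = (\<Sum>i\<in>I. coef n V (f i) j * y i)"
    by (subst sum.swap) (simp add: coef_def sum_distrib_right)
  finally show ?thesis .
qed

lemma coef_synthesis:
  assumes "unitary_mat n U" "j < n"
  shows "coef n U (\<lambda>a. \<Sum>i<n. U $$ (a, i) * y i) j = y j"
proof -
  have "coef n U (\<lambda>a. \<Sum>i<n. U $$ (a, i) * y i) j = (\<Sum>i<n. if i = j then y i else 0)"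
    unfolding coef_linear_comb using coef_col[OF assms(1) _ assms(2)] by (intro sum.cong) auto
  then show ?thesis using assms by simp
qed

lemma coef_expand:
  assumes U: "unitary_mat n U" and a: "a < n"
  shows "(\<Sum>i<n. U $$ (a, i) * coef n U x i) = x a"
proof -
  have "(\<Sum>i<n. U $$ (a, i) * coef n U x i) = (\<Sum>i<n. \<Sum>b<n. U $$ (a, i) * cnj (U $$ (b, i)) * x b)"
    by (simp add: coef_def sum_distrib_left mult.assoc)
  also have "\<dots> = (\<Sum>b<n. (\<Sum>i<n. U $$ (a, i) * cnj (U $$ (b, i))) * x b)"
    by (subst sum.swap) (simp add: sum_distrib_right)
  also have "\<dots> = (\<Sum>b<n. if b = a then x b else 0)"
    using unitary_mat_rows[OF U a] by (intro sum.cong) auto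
  finally show ?thesis using a by simp
qed

lemma coef_parseval:
  assumes U: "unitary_mat n U"
  shows "(\<Sum>i<n. coef n U x i * cnj (coef n U y i)) = (\<Sum>a<n. x a * cnj (y a))"
proof -
  have "(\<Sum>a<n. x a * cnj (y a)) = (\<Sum>a<n. \<Sum>i<n. coef n U x i * (U $$ (a, i) * cnj (y a)))"
    by (intro sum.cong refl, subst coef_expand[OF U, symmetric]) (auto simp: sum_distrib_left sum_distrib_right mult_ac)
  also have "\<dots> = (\<Sum>i<n. coef n U x i * (\<Sum>a<n. U $$ (a, i) * cnj (y a)))"
    by (subst sum.swap) (simp add: sum_distrib_left)
  also have "\<dots> = (\<Sum>i<n. coef n U x i * cnj (coef n U y i))"
    by (simp add: coef_def)
  finally show ?thesis by simp
qed

lemma coef_parseval_norm: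
  assumes U: "unitary_mat n U"
  shows "(\<Sum>i<n. (cmod (coef n U x i))\<^sup>2) = (\<Sum>a<n. (cmod (x a))\<^sup>2)"
proof -
  have "complex_of_real (\<Sum>i<n. (cmod (coef n U x i))\<^sup>2) = of_real (\<Sum>a<n. (cmod (x a))\<^sup>2)"
    unfolding of_real_sum complex_norm_square by (rule coef_parseval[OF U])
  then show ?thesis by (simp only: of_real_eq_iff)
qed

lemma eigen_dec_apply:
  assumes A: "eigen_dec n A U r" and a: "a < n"
  shows "(\<Sum>b<n. A $$ (a, b) * x b) = (\<Sum>i<n. U $$ (a, i) * (of_real (r i) * coef n U x i))"
proof -
  have "(\<Sum>b<n. A $$ (a, b) * x b) = (\<Sum>b<n. \<Sum>i<n. U $$ (a, i) * of_real (r i) * cnj (U $$ (b, i)) * x b)"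
    using eigen_dec_index[OF A a] by (simp add: sum_distrib_right)
  also have "\<dots> = (\<Sum>i<n. U $$ (a, i) * (of_real (r i) * coef n U x i))"
    by (subst sum.swap) (simp add: coef_def sum_distrib_left mult_ac)
  finally show ?thesis .
qed

lemma coef_eigen_dec:
  assumes A: "eigen_dec n A U r" and i: "i < n"
  shows "coef n U (\<lambda>a. \<Sum>b<n. A $$ (a, b) * x b) i = of_real (r i) * coef n U x i"
proof -
  have "coef n U (\<lambda>a. \<Sum>b<n. A $$ (a, b) * x b) i
      = coef n U (\<lambda>a. \<Sum>i<n. U $$ (a, i) * (of_real (r i) * coef n U x i)) i"
    by (intro coef_cong eigen_dec_apply[OF A])
  then show ?thesis using coef_synthesis[OF eigen_dec_carrier(3)[OF A] i] by simp
qed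

section \<open>Quadratic forms and traces in eigenbases\<close>

definition quad_form :: "nat \<Rightarrow> complex mat \<Rightarrow> (nat \<Rightarrow> complex) \<Rightarrow> complex" where
  "quad_form n A x = (\<Sum>a<n. \<Sum>b<n. cnj (x a) * A $$ (a, b) * x b)"

lemma quad_form_cong: "(\<And>a. a < n \<Longrightarrow> x a = y a) \<Longrightarrow> quad_form n A x = quad_form n A y"
  unfolding quad_form_def by (intro sum.cong) auto

lemma quad_form_eigen_dec:
  assumes A: "eigen_dec n A U r"
  shows "quad_form n A x = of_real (\<Sum>i<n. r i * (cmod (coef n U x i))\<^sup>2)"
proof -
  have "quad_form n A x = (\<Sum>a<n. (\<Sum>b<n. A $$ (a, b) * x b) * cnj (x a))"
    unfolding quad_form_def by (simp add: sum_distrib_left sum_distrib_right mult_ac)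
  also have "\<dots> = (\<Sum>i<n. coef n U (\<lambda>a. \<Sum>b<n. A $$ (a, b) * x b) i * cnj (coef n U x i))"
    by (rule coef_parseval[OF eigen_dec_carrier(3)[OF A], symmetric])
  also have "\<dots> = (\<Sum>i<n. (of_real (r i) * coef n U x i) * cnj (coef n U x i))"
    using coef_eigen_dec[OF A] by (intro sum.cong) auto
  also have "\<dots> = of_real (\<Sum>i<n. r i * (cmod (coef n U x i))\<^sup>2)"
    unfolding of_real_sum of_real_mult complex_norm_square by (simp add: mult.assoc)
  finally show ?thesis .
qed

lemma quad_form_scalar_prod:
  assumes "A \<in> carrier_mat n n" "v \<in> carrier_vec n"
  shows "(A *\<^sub>v v) \<bullet>c v = quad_form n A (\<lambda>a. v $ a)"
  using assms unfolding quad_form_def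
  by (auto simp: scalar_prod_def atLeast0LessThan sum_distrib_left sum_distrib_right mult_ac intro!: sum.cong)

lemma psd_mat_quad_form:
  "psd_mat n A \<longleftrightarrow> hermitian_mat n A \<and> (\<forall>x. 0 \<le> Re (quad_form n A x))"
proof (cases "hermitian_mat n A")
  case True
  then have A: "A \<in> carrier_mat n n" by (simp add: hermitian_mat_def)
  have "0 \<le> Re (quad_form n A x)" if "\<forall>v\<in>carrier_vec n. 0 \<le> Re ((A *\<^sub>v v) \<bullet>c v)" for x
  proof -
    have "quad_form n A x = quad_form n A (\<lambda>a. Matrix.vec n x $ a)" by (intro quad_form_cong) simp
    then show ?thesis
      using that[rule_format, of "Matrix.vec n x"] quad_form_scalar_prod[OF A, of "Matrix.vec n x"] by simp
  qed
  then show ?thesis unfolding psd_mat_def using quad_form_scalar_prod[OF A] by auto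
qed (simp add: psd_mat_def)

lemma eigen_dec_eigenvalue:
  assumes A: "eigen_dec n A U r" and i: "i < n"
  shows "quad_form n A (\<lambda>a. U $$ (a, i)) = of_real (r i)"
proof -
  have "(\<Sum>j<n. r j * (cmod (coef n U (\<lambda>a. U $$ (a, i)) j))\<^sup>2) = (\<Sum>j<n. if j = i then r j else 0)"
    using coef_col[OF eigen_dec_carrier(3)[OF A] i] by (intro sum.cong) auto
  then show ?thesis unfolding quad_form_eigen_dec[OF A] using i by simp
qed

lemma psd_eigen_dec:
  assumes "psd_mat n A"
  obtains U r where "eigen_dec n A U r" "\<And>i. i < n \<Longrightarrow> 0 \<le> r i"
proof -
  obtain U r where U: "eigen_dec n A U r"
    using hermitian_eigen_dec assms unfolding psd_mat_def by blast
  have "0 \<le> r i" if "i < n" for i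
    using eigen_dec_eigenvalue[OF U that] assms unfolding psd_mat_quad_form by (metis Re_complex_of_real)
  with U show ?thesis using that by blast
qed

lemma trace_mult_eigen_dec:
  assumes P: "P \<in> carrier_mat n n" and A: "eigen_dec n A U r"
  shows "mat_trace (P * A) = (\<Sum>i<n. of_real (r i) * quad_form n P (\<lambda>a. U $$ (a, i)))"
proof -
  have "mat_trace (P * A) = (\<Sum>a<n. \<Sum>b<n. \<Sum>i<n. P $$ (a, b) * (U $$ (b, i) * of_real (r i) * cnj (U $$ (a, i))))"
    using P eigen_dec_carrier[OF A] unfolding mat_trace_def
    by (intro sum.cong) (auto simp: mat_mult_index[OF P eigen_dec_carrier(1)[OF A]] eigen_dec_index[OF A] sum_distrib_left
        simp del: index_mult_mat(1))
  also have "\<dots> = (\<Sum>a<n. \<Sum>i<n. \<Sum>b<n. P $$ (a, b) * (U $$ (b, i) * of_real (r i) * cnj (U $$ (a, i))))"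
    by (intro sum.cong refl sum.swap)
  also have "\<dots> = (\<Sum>i<n. of_real (r i) * quad_form n P (\<lambda>a. U $$ (a, i)))"
    unfolding quad_form_def sum_distrib_left by (subst sum.swap) (simp add: mult_ac)
  finally show ?thesis .
qed

lemma trace_eigen_dec:
  assumes A: "eigen_dec n A U r"
  shows "mat_trace A = of_real (\<Sum>i<n. r i)"
proof -
  have "mat_trace A = (\<Sum>a<n. \<Sum>i<n. U $$ (a, i) * of_real (r i) * cnj (U $$ (a, i)))"
    using eigen_dec_carrier(1)[OF A] eigen_dec_index[OF A] by (simp add: mat_trace_def)
  also have "\<dots> = (\<Sum>i<n. of_real (r i) * (\<Sum>a<n. cnj (U $$ (a, i)) * U $$ (a, i)))"
    by (subst sum.swap) (simp add: sum_distrib_left mult_ac)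
  also have "\<dots> = (\<Sum>i<n. of_real (r i))"
    using unitary_mat_cols[OF eigen_dec_carrier(3)[OF A]] by simp
  finally show ?thesis by simp
qed

text \<open>
  For eigenbases \<open>U\<close> of \<open>\<rho>\<close> and \<open>V\<close> of \<open>\<sigma>\<close> with eigenvalues \<open>r\<close> and \<open>s\<close>, the weights
  \<open>r\<^sub>i * overlap i j\<close> and \<open>s\<^sub>j * overlap i j\<close> are the Nussbaum--Szkola distributions.
\<close>

definition overlap :: "nat \<Rightarrow> complex mat \<Rightarrow> complex mat \<Rightarrow> nat \<Rightarrow> nat \<Rightarrow> real" where
  "overlap n U V i j = (cmod (coef n V (\<lambda>a. U $$ (a, i)) j))\<^sup>2"

lemma overlap_nonneg [simp]: "0 \<le> overlap n U V i j"
  by (simp add: overlap_def)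

lemma overlap_sum_right:
  assumes U: "unitary_mat n U" and V: "unitary_mat n V" and i: "i < n"
  shows "(\<Sum>j<n. overlap n U V i j) = 1"
  unfolding overlap_def coef_parseval_norm[OF V] by (rule unitary_mat_col_norm[OF U i])

lemma overlap_le_1:
  assumes "unitary_mat n U" "unitary_mat n V" "i < n" "j < n"
  shows "overlap n U V i j \<le> 1"
  using overlap_sum_right[OF assms(1-3)] member_le_sum[of j "{..<n}" "overlap n U V i"] assms(4) by simp

lemma overlap_commute: "overlap n U V i j = overlap n V U j i"
proof -
  have "coef n V (\<lambda>a. U $$ (a, i)) j = cnj (coef n U (\<lambda>a. V $$ (a, j)) i)"
    by (simp add: coef_def mult.commute)
  then show ?thesis by (simp add: overlap_def)
qed

lemma quad_form_col:
  assumes "eigen_dec n A U r"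
  shows "quad_form n A (\<lambda>a. V $$ (a, j)) = of_real (\<Sum>i<n. r i * overlap n U V i j)"
  unfolding quad_form_eigen_dec[OF assms] overlap_commute[of n U V] by (simp add: overlap_def)

section \<open>Supports and relative entropy\<close>

text \<open>Absolute continuity of the first Nussbaum--Szkola distribution with respect to the
  second.\<close>

definition dominated :: "nat \<Rightarrow> complex mat \<Rightarrow> (nat \<Rightarrow> real) \<Rightarrow> complex mat \<Rightarrow> (nat \<Rightarrow> real) \<Rightarrow> bool" where
  "dominated n U r V s \<longleftrightarrow> (\<forall>i<n. \<forall>j<n. s j = 0 \<longrightarrow> r i * overlap n U V i j = 0)"

lemma kernel_eigen_dec:
  assumes A: "eigen_dec n A U r"
  shows "w \<in> mat_kernel A \<longleftrightarrow> w \<in> carrier_vec n \<and> (\<forall>i<n. r i = 0 \<or> coef n U (\<lambda>a. w $ a) i = 0)"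
proof -
  have Ac: "A \<in> carrier_mat n n" using eigen_dec_carrier[OF A] by blast
  have Aw: "(A *\<^sub>v w) $ a = (\<Sum>b<n. A $$ (a, b) * w $ b)" if "a < n" "w \<in> carrier_vec n" for a
    using that Ac by (auto simp: scalar_prod_def atLeast0LessThan intro!: sum.cong)
  show ?thesis
  proof
    assume "w \<in> mat_kernel A"
    then have w: "w \<in> carrier_vec n" and 0: "A *\<^sub>v w = 0\<^sub>v n" using mat_kernelD[OF Ac] by auto
    have "r i = 0 \<or> coef n U (\<lambda>a. w $ a) i = 0" if i: "i < n" for i
    proof -
      have "of_real (r i) * coef n U (\<lambda>a. w $ a) i = coef n U (\<lambda>a. (A *\<^sub>v w) $ a) i"
        unfolding coef_eigen_dec[OF A i, symmetric] by (intro coef_cong) (simp add: Aw w)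
      also have "\<dots> = 0" unfolding 0 by (simp add: coef_def)
      finally show ?thesis by simp
    qed
    with w show "w \<in> carrier_vec n \<and> (\<forall>i<n. r i = 0 \<or> coef n U (\<lambda>a. w $ a) i = 0)" by blast
  next
    assume w: "w \<in> carrier_vec n \<and> (\<forall>i<n. r i = 0 \<or> coef n U (\<lambda>a. w $ a) i = 0)"
    have "A *\<^sub>v w = 0\<^sub>v n"
    proof (rule eq_vecI)
      fix a assume "a < dim_vec (0\<^sub>v n :: complex vec)"
      then have a: "a < n" by simp
      have "(A *\<^sub>v w) $ a = (\<Sum>i<n. U $$ (a, i) * (of_real (r i) * coef n U (\<lambda>a. w $ a) i))"
        using Aw[OF a] w eigen_dec_apply[OF A a] by simp
      also have "\<dots> = 0" using w by (intro sum.neutral) auto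
      finally show "(A *\<^sub>v w) $ a = 0\<^sub>v n $ a" using a by simp
    qed (use Ac in auto)
    then show "w \<in> mat_kernel A" using w by (intro mat_kernelI[OF Ac]) auto
  qed
qed

lemma supp_eigen_dec:
  assumes A: "eigen_dec n A U r"
  shows "v \<in> supp_mat A \<longleftrightarrow> v \<in> carrier_vec n \<and> (\<forall>i<n. r i = 0 \<longrightarrow> coef n U (\<lambda>a. v $ a) i = 0)"
proof -
  have Ac: "A \<in> carrier_mat n n" and U: "unitary_mat n U" using eigen_dec_carrier[OF A] by auto
  have inner: "v \<bullet>c w = (\<Sum>i<n. coef n U (\<lambda>a. v $ a) i * cnj (coef n U (\<lambda>a. w $ a) i))"
    if "v \<in> carrier_vec n" "w \<in> carrier_vec n" for w
    unfolding coef_parseval[OF U] using that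
    by (auto simp: scalar_prod_def atLeast0LessThan intro!: sum.cong)
  show ?thesis
  proof
    assume v: "v \<in> supp_mat A"
    then have vc: "v \<in> carrier_vec n" and orth: "\<And>w. w \<in> mat_kernel A \<Longrightarrow> v \<bullet>c w = 0"
      using Ac by (auto simp: supp_mat_def)
    have "coef n U (\<lambda>a. v $ a) i = 0" if i: "i < n" "r i = 0" for i
    proof -
      define w where "w = Matrix.vec n (\<lambda>a. U $$ (a, i))"
      have w: "coef n U (\<lambda>a. w $ a) j = (if i = j then 1 else 0)" if "j < n" for j
        unfolding coef_col[OF U i(1) that, symmetric] by (intro coef_cong) (simp add: w_def)
      have "w \<in> mat_kernel A" unfolding kernel_eigen_dec[OF A] using w i by (auto simp: w_def)
      then have "0 = (\<Sum>j<n. coef n U (\<lambda>a. v $ a) j * cnj (coef n U (\<lambda>a. w $ a) j))"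
        using orth inner[OF vc, of w] by (simp add: w_def)
      also have "\<dots> = (\<Sum>j<n. if j = i then coef n U (\<lambda>a. v $ a) j else 0)"
        using w by (intro sum.cong) auto
      finally show ?thesis using i by simp
    qed
    with vc show "v \<in> carrier_vec n \<and> (\<forall>i<n. r i = 0 \<longrightarrow> coef n U (\<lambda>a. v $ a) i = 0)" by blast
  next
    assume v: "v \<in> carrier_vec n \<and> (\<forall>i<n. r i = 0 \<longrightarrow> coef n U (\<lambda>a. v $ a) i = 0)"
    have "v \<bullet>c w = 0" if "w \<in> mat_kernel A" for w
    proof -
      have w: "w \<in> carrier_vec n" "\<forall>i<n. r i = 0 \<or> coef n U (\<lambda>a. w $ a) i = 0"
        using that kernel_eigen_dec[OF A] by auto
      have "(\<Sum>i<n. coef n U (\<lambda>a. v $ a) i * cnj (coef n U (\<lambda>a. w $ a) i)) = 0"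
        using v w(2) by (intro sum.neutral) fastforce
      then show ?thesis using inner[OF _ w(1)] v by simp
    qed
    then show "v \<in> supp_mat A" using v Ac by (auto simp: supp_mat_def)
  qed
qed

text \<open>Forward, an eigenvector of \<open>A\<close> with nonzero eigenvalue lies in the support
  of \<open>A\<close>, hence is orthogonal to the kernel of \<open>B\<close>; backward, a vector in
  the support of \<open>A\<close> is a combination of such eigenvectors.\<close>

lemma supp_subset_iff_dominated:
  assumes A: "eigen_dec n A U r" and B: "eigen_dec n B V s"
  shows "supp_mat A \<subseteq> supp_mat B \<longleftrightarrow> dominated n U r V s"
proof
  have U: "unitary_mat n U" and V: "unitary_mat n V" using eigen_dec_carrier[OF A] eigen_dec_carrier[OF B] by auto
  {
    assume sub: "supp_mat A \<subseteq> supp_mat B"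
    have "overlap n U V i j = 0" if ij: "i < n" "j < n" "s j = 0" "r i \<noteq> 0" for i j
    proof -
      define v where "v = Matrix.vec n (\<lambda>a. U $$ (a, i))"
      have v: "coef n W (\<lambda>a. v $ a) j = coef n W (\<lambda>a. U $$ (a, i)) j" for W j
        by (intro coef_cong) (simp add: v_def)
      have "v \<in> supp_mat A" unfolding supp_eigen_dec[OF A] v using ij coef_col[OF U ij(1)]
        by (auto simp: v_def)
      then have "coef n V (\<lambda>a. v $ a) j = 0" using sub ij supp_eigen_dec[OF B] by blast
      then show ?thesis by (simp add: v overlap_def)
    qed
    then show "dominated n U r V s" unfolding dominated_def by auto
  next
    assume dom: "dominated n U r V s"
    show "supp_mat A \<subseteq> supp_mat B"
    proof
      fix v assume "v \<in> supp_mat A"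
      then have v: "v \<in> carrier_vec n" "\<forall>i<n. r i = 0 \<longrightarrow> coef n U (\<lambda>a. v $ a) i = 0"
        using supp_eigen_dec[OF A] by auto
      have "coef n V (\<lambda>a. v $ a) j = 0" if j: "j < n" "s j = 0" for j
      proof -
        have "coef n V (\<lambda>a. v $ a) j = coef n V (\<lambda>a. \<Sum>i<n. U $$ (a, i) * coef n U (\<lambda>a. v $ a) i) j"
          by (intro coef_cong coef_expand[OF U, symmetric])
        also have "\<dots> = (\<Sum>i<n. coef n V (\<lambda>a. U $$ (a, i)) j * coef n U (\<lambda>a. v $ a) i)"
          by (rule coef_linear_comb)
        also have "\<dots> = 0" using dom j v(2) by (intro sum.neutral) (fastforce simp: dominated_def overlap_def)
        finally show ?thesis .
      qed
      then show "v \<in> supp_mat B" using v supp_eigen_dec[OF B] by blast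
    qed
  }
qed

abbreviation lg0 :: "real \<Rightarrow> real" where
  "lg0 x \<equiv> (if x > 0 then log 2 x else 0)"

text \<open>\<open>mat_log2\<close> is defined by Hilbert choice; \<open>spectral_fun_unique\<close>
  identifies it with the logarithm taken in the given eigenbasis.\<close>

lemma mat_log2_eigen_dec:
  assumes A: "eigen_dec n A U r"
  shows "eigen_dec n (mat_log2 A) U (\<lambda>i. lg0 (r i))"
proof -
  define L where "L = U * mat_diag n (\<lambda>i. complex_of_real (lg0 (r i))) * mat_adjoint U"
  have n: "dim_row A = n" using eigen_dec_carrier(1)[OF A] by simp
  have "spectral_fun (\<lambda>x. lg0 x) A L"
    unfolding spectral_fun_def n L_def using A by (auto simp: eigen_dec_def)
  then have "mat_log2 A = L"
    unfolding mat_log2_def mat_fun_def by (metis someI_ex spectral_fun_unique)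
  then show ?thesis using A by (simp add: eigen_dec_def L_def)
qed

text \<open>The overlaps of a fixed \<open>i\<close> sum to 1, so Tr A log A can be spread over the
  pairs (i, j) and combined with Tr A log B into one classical divergence.\<close>

lemma rel_entropy_eigen_dec:
  assumes A: "eigen_dec n A U r" and B: "eigen_dec n B V s"
  shows "rel_entropy A B = (if dominated n U r V s
    then ereal (\<Sum>i<n. \<Sum>j<n. r i * overlap n U V i j * (lg0 (r i) - lg0 (s j))) else \<infinity>)"
proof -
  note Ac = eigen_dec_carrier[OF A] and Bc = eigen_dec_carrier[OF B]
  note LA = mat_log2_eigen_dec[OF A] and LB = mat_log2_eigen_dec[OF B]
  note LAc = eigen_dec_carrier(1)[OF LA] and LBc = eigen_dec_carrier(1)[OF LB]
  have "mat_trace (A * (mat_log2 A - mat_log2 B)) = mat_trace (A * mat_log2 A) - mat_trace (A * mat_log2 B)"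
    unfolding mult_minus_distrib_mat[OF Ac(1) LAc LBc] using Ac LAc LBc
    by (simp add: mat_trace_def sum_subtractf)
  also have "mat_trace (A * mat_log2 A) = of_real (\<Sum>i<n. r i * lg0 (r i))"
    unfolding trace_mult_eigen_dec[OF Ac(1) LA] of_real_sum
    by (intro sum.cong) (auto simp: eigen_dec_eigenvalue[OF A])
  also have "mat_trace (A * mat_log2 B) = of_real (\<Sum>j<n. lg0 (s j) * (\<Sum>i<n. r i * overlap n U V i j))"
    unfolding trace_mult_eigen_dec[OF Ac(1) LB] of_real_sum
    by (intro sum.cong) (auto simp: quad_form_col[OF A])
  finally have "Re (mat_trace (A * (mat_log2 A - mat_log2 B)))
      = (\<Sum>i<n. r i * lg0 (r i)) - (\<Sum>j<n. lg0 (s j) * (\<Sum>i<n. r i * overlap n U V i j))"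
    by (simp only: minus_complex.sel Re_complex_of_real)
  also have "(\<Sum>i<n. r i * lg0 (r i)) = (\<Sum>i<n. \<Sum>j<n. r i * overlap n U V i j * lg0 (r i))"
  proof (intro sum.cong refl)
    fix i assume "i \<in> {..<n}"
    then have "(\<Sum>j<n. overlap n U V i j) = 1" using overlap_sum_right[OF Ac(3) Bc(3)] by simp
    then show "r i * lg0 (r i) = (\<Sum>j<n. r i * overlap n U V i j * lg0 (r i))"
      by (metis mult.right_neutral sum_distrib_left sum_distrib_right)
  qed
  also have "(\<Sum>j<n. lg0 (s j) * (\<Sum>i<n. r i * overlap n U V i j)) = (\<Sum>i<n. \<Sum>j<n. r i * overlap n U V i j * lg0 (s j))"
    unfolding sum_distrib_left by (subst sum.swap) (simp add: mult_ac)
  finally show ?thesis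
    unfolding rel_entropy_def supp_subset_iff_dominated[OF A B]
    by (simp add: right_diff_distrib sum_subtractf)
qed

section \<open>Tensor products of diagonalizations\<close>

lemma mult_add_less:
  fixes i a :: nat
  assumes "i < n" "a < m"
  shows "i * m + a < n * m"
proof -
  have "i * m + a < Suc i * m" using assms by simp
  also have "\<dots> \<le> n * m" using assms by (intro mult_le_mono1) simp
  finally show ?thesis .
qed

lemma sum_div_mod:
  fixes f :: "nat \<Rightarrow> nat \<Rightarrow> 'a::comm_monoid_add"
  shows "(\<Sum>i<n * m. f (i div m) (i mod m)) = (\<Sum>i<n. \<Sum>j<m. f i j)"
proof (cases "m = 0")
  case False
  have "bij_betw (\<lambda>(i, j). i * m + j) ({..<n} \<times> {..<m}) {..<n * m}"
  proof (rule bij_betw_byWitness[where f' = "\<lambda>k. (k div m, k mod m)"])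
    show "(\<lambda>(i, j). i * m + j) ` ({..<n} \<times> {..<m}) \<subseteq> {..<n * m}" by (auto intro: mult_add_less)
  qed (use False in \<open>auto simp: less_mult_imp_div_less\<close>)
  then have "(\<Sum>i<n * m. f (i div m) (i mod m)) = (\<Sum>(i, j)\<in>{..<n} \<times> {..<m}. f ((i * m + j) div m) ((i * m + j) mod m))"
    by (subst sum.reindex_bij_betw[symmetric]) (auto simp: case_prod_unfold)
  also have "\<dots> = (\<Sum>(i, j)\<in>{..<n} \<times> {..<m}. f i j)" by (intro sum.cong) auto
  finally show ?thesis by (simp add: sum.cartesian_product)
qed simp

lemma kron_carrier:
  "A \<in> carrier_mat n n' \<Longrightarrow> B \<in> carrier_mat m m' \<Longrightarrow> kron A B \<in> carrier_mat (n * m) (n' * m')"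
  by (auto simp: kron_def)

lemma kron_index:
  assumes "A \<in> carrier_mat n n'" "B \<in> carrier_mat m m'" "a < n * m" "b < n' * m'"
  shows "kron A B $$ (a, b) = A $$ (a div m, b div m') * B $$ (a mod m, b mod m')"
  using assms by (auto simp: kron_def)

lemma div_mod_less:
  fixes a :: nat
  assumes "a < n * m"
  shows "a div m < n" "a mod m < m"
  using assms by (auto simp: less_mult_imp_div_less intro!: mod_less_divisor gr0I)

lemma coef_kron:
  assumes U: "U \<in> carrier_mat n n" "U' \<in> carrier_mat m m" and V: "V \<in> carrier_mat n n" "V' \<in> carrier_mat m m"
    and ij: "i < n * m" "j < n * m"
  shows "coef (n * m) (kron V V') (\<lambda>a. kron U U' $$ (a, i)) j
    = coef n V (\<lambda>a. U $$ (a, i div m)) (j div m) * coef m V' (\<lambda>a. U' $$ (a, i mod m)) (j mod m)"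
proof -
  have "coef (n * m) (kron V V') (\<lambda>a. kron U U' $$ (a, i)) j
     = (\<Sum>a<n * m. (cnj (V $$ (a div m, j div m)) * U $$ (a div m, i div m))
         * (cnj (V' $$ (a mod m, j mod m)) * U' $$ (a mod m, i mod m)))"
    unfolding coef_def using kron_index[OF V _ ij(2)] kron_index[OF U _ ij(1)]
    by (intro sum.cong) auto
  also have "\<dots> = coef n V (\<lambda>a. U $$ (a, i div m)) (j div m) * coef m V' (\<lambda>a. U' $$ (a, i mod m)) (j mod m)"
    unfolding coef_def sum_product
    by (rule sum_div_mod[of "\<lambda>a b. (cnj (V $$ (a, j div m)) * U $$ (a, i div m))
         * (cnj (V' $$ (b, j mod m)) * U' $$ (b, i mod m))"])
  finally show ?thesis .
qed

lemma overlap_kron: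
  assumes "U \<in> carrier_mat n n" "U' \<in> carrier_mat m m" "V \<in> carrier_mat n n" "V' \<in> carrier_mat m m"
    and "i < n * m" "j < n * m"
  shows "overlap (n * m) (kron U U') (kron V V') i j
    = overlap n U V (i div m) (j div m) * overlap m U' V' (i mod m) (j mod m)"
  unfolding overlap_def coef_kron[OF assms] by (simp add: norm_mult power_mult_distrib)

lemma unitary_mat_kron:
  assumes U: "unitary_mat n U" and V: "unitary_mat m V"
  shows "unitary_mat (n * m) (kron U V)"
proof (rule unitary_matI)
  have c: "U \<in> carrier_mat n n" "V \<in> carrier_mat m m" using U V by (auto simp: unitary_mat_def)
  then show "kron U V \<in> carrier_mat (n * m) (n * m)" by (rule kron_carrier)
  fix i j assume ij: "i < n * m" "j < n * m"
  have "(\<Sum>a<n * m. cnj (kron U V $$ (a, i)) * kron U V $$ (a, j)) = coef (n * m) (kron U V) (\<lambda>a. kron U V $$ (a, j)) i"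
    by (simp add: coef_def)
  also have "\<dots> = (if j div m = i div m then 1 else 0) * (if j mod m = i mod m then 1 else 0)"
    unfolding coef_kron[OF c c ij(2,1)] using div_mod_less[OF ij(1)] div_mod_less[OF ij(2)]
    by (simp add: coef_col[OF U] coef_col[OF V])
  also have "\<dots> = (if i = j then 1 else 0)" by (auto, metis div_mult_mod_eq)
  finally show "(\<Sum>a<n * m. cnj (kron U V $$ (a, i)) * kron U V $$ (a, j)) = (if i = j then 1 else 0)" .
qed

lemma eigen_dec_kron:
  assumes A: "eigen_dec n A U r" and B: "eigen_dec m B V s"
  shows "eigen_dec (n * m) (kron A B) (kron U V) (\<lambda>i. r (i div m) * s (i mod m))"
proof (rule eigen_decI)
  note Ac = eigen_dec_carrier[OF A] and Bc = eigen_dec_carrier[OF B]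
  show "kron A B \<in> carrier_mat (n * m) (n * m)" using Ac Bc by (intro kron_carrier)
  show "unitary_mat (n * m) (kron U V)" using Ac Bc by (intro unitary_mat_kron)
  fix a b assume ab: "a < n * m" "b < n * m"
  note abl = div_mod_less[OF ab(1)] div_mod_less[OF ab(2)]
  let ?f = "\<lambda>i j. (U $$ (a div m, i) * of_real (r i) * cnj (U $$ (b div m, i)))
    * (V $$ (a mod m, j) * of_real (s j) * cnj (V $$ (b mod m, j)))"
  have "kron A B $$ (a, b) = (\<Sum>i<n. \<Sum>j<m. ?f i j)"
    unfolding kron_index[OF Ac(1) Bc(1) ab] eigen_dec_index[OF A abl(1,3)] eigen_dec_index[OF B abl(2,4)]
    by (rule sum_product)
  also have "\<dots> = (\<Sum>i<n * m. ?f (i div m) (i mod m))" by (rule sum_div_mod[symmetric])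
  also have "\<dots> = (\<Sum>i<n * m. kron U V $$ (a, i) * of_real (r (i div m) * s (i mod m)) * cnj (kron U V $$ (b, i)))"
    using kron_index[OF Ac(2) Bc(2) ab(1)] kron_index[OF Ac(2) Bc(2) ab(2)] by (intro sum.cong) auto
  finally show "kron A B $$ (a, b) = (\<Sum>i<n * m. kron U V $$ (a, i) * of_real (r (i div m) * s (i mod m)) * cnj (kron U V $$ (b, i)))" .
qed

section \<open>Tests\<close>

lemma quad_form_one_minus:
  assumes P: "P \<in> carrier_mat n n"
  shows "quad_form n (1\<^sub>m n - P) x = of_real (\<Sum>a<n. (cmod (x a))\<^sup>2) - quad_form n P x"
proof -
  have "quad_form n (1\<^sub>m n - P) x
      = (\<Sum>a<n. \<Sum>b<n. (if b = a then cnj (x a) * x a else 0) - cnj (x a) * P $$ (a, b) * x b)"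
    unfolding quad_form_def using P by (intro sum.cong) (auto simp: algebra_simps)
  also have "\<dots> = (\<Sum>a<n. cnj (x a) * x a) - quad_form n P x"
    unfolding quad_form_def by (simp add: sum_subtractf)
  also have "(\<Sum>a<n. cnj (x a) * x a) = of_real (\<Sum>a<n. (cmod (x a))\<^sup>2)"
    unfolding of_real_sum complex_norm_square by (simp add: mult.commute)
  finally show ?thesis .
qed

lemma tests_iff:
  "P \<in> tests n \<longleftrightarrow> hermitian_mat n P \<and>
    (\<forall>x. 0 \<le> Re (quad_form n P x) \<and> Re (quad_form n P x) \<le> (\<Sum>a<n. (cmod (x a))\<^sup>2))"
proof (cases "P \<in> carrier_mat n n")
  case True
  have P0: "P - 0\<^sub>m n n = P" using True by auto
  have "hermitian_mat n (1\<^sub>m n - P)" if "hermitian_mat n P"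
    unfolding hermitian_mat_index
  proof (intro conjI allI impI)
    fix i j assume ij: "i < n" "j < n"
    have "P $$ (i, j) = cnj (P $$ (j, i))" using that ij unfolding hermitian_mat_index by blast
    then show "(1\<^sub>m n - P) $$ (i, j) = cnj ((1\<^sub>m n - P) $$ (j, i))"
      using ij True by simp
  qed (use True in \<open>simp add: minus_carrier_mat\<close>)
  moreover have "Re (quad_form n (1\<^sub>m n - P) x) = (\<Sum>a<n. (cmod (x a))\<^sup>2) - Re (quad_form n P x)" for x
    using quad_form_one_minus[OF True] by simp
  ultimately show ?thesis
    unfolding tests_def loewner_le_def psd_mat_quad_form using True by (auto simp: P0)
next
  case False
  then show ?thesis unfolding tests_def loewner_le_def hermitian_mat_def by auto
qed

text \<open>The spectrum of a test lies in [0, 1], where p^2 <= p and (1 - p)^2 <= 1 - p.\<close>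

lemma test_norm_bounds:
  assumes P: "P \<in> tests n"
  shows "(\<Sum>a<n. (cmod (\<Sum>b<n. P $$ (a, b) * x b))\<^sup>2) \<le> Re (quad_form n P x)"
    and "(\<Sum>a<n. (cmod (x a - (\<Sum>b<n. P $$ (a, b) * x b)))\<^sup>2)
      \<le> (\<Sum>a<n. (cmod (x a))\<^sup>2) - Re (quad_form n P x)"
proof -
  obtain W p where W: "eigen_dec n P W p" using hermitian_eigen_dec P tests_iff by blast
  note Wu = eigen_dec_carrier(3)[OF W]
  have p: "0 \<le> p k" "p k \<le> 1" if k: "k < n" for k
  proof -
    show "0 \<le> p k" "p k \<le> 1"
      using eigen_dec_eigenvalue[OF W k] unitary_mat_col_norm[OF Wu k] P unfolding tests_iff
      by (metis Re_complex_of_real)+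
  qed
  define y where "y a = (\<Sum>b<n. P $$ (a, b) * x b)" for a
  have cy: "coef n W y k = of_real (p k) * coef n W x k" if "k < n" for k
    unfolding y_def by (rule coef_eigen_dec[OF W that])
  have qf: "Re (quad_form n P x) = (\<Sum>k<n. p k * (cmod (coef n W x k))\<^sup>2)"
    unfolding quad_form_eigen_dec[OF W] by simp
  have "(\<Sum>a<n. (cmod (y a))\<^sup>2) = (\<Sum>k<n. (cmod (coef n W y k))\<^sup>2)"
    by (rule coef_parseval_norm[OF Wu, symmetric])
  also have "\<dots> = (\<Sum>k<n. (p k * p k) * (cmod (coef n W x k))\<^sup>2)"
    by (intro sum.cong) (auto simp: cy norm_mult power_mult_distrib power2_eq_square)
  also have "\<dots> \<le> Re (quad_form n P x)" unfolding qf
    using p by (intro sum_mono mult_right_mono) (auto intro: mult_left_le)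
  finally show "(\<Sum>a<n. (cmod (\<Sum>b<n. P $$ (a, b) * x b))\<^sup>2) \<le> Re (quad_form n P x)"
    by (simp add: y_def)
  have cxy: "coef n W (\<lambda>a. x a - y a) k = of_real (1 - p k) * coef n W x k" if "k < n" for k
    using cy[OF that] unfolding coef_def by (simp add: algebra_simps sum_subtractf)
  have "(\<Sum>a<n. (cmod (x a - y a))\<^sup>2) = (\<Sum>k<n. (cmod (coef n W (\<lambda>a. x a - y a) k))\<^sup>2)"
    by (rule coef_parseval_norm[OF Wu, symmetric])
  also have "\<dots> = (\<Sum>k<n. ((1 - p k) * (1 - p k)) * (cmod (coef n W x k))\<^sup>2)"
  proof (intro sum.cong refl)
    fix k assume "k \<in> {..<n}"
    then have "k < n" by simp
    show "(cmod (coef n W (\<lambda>a. x a - y a) k))\<^sup>2 = ((1 - p k) * (1 - p k)) * (cmod (coef n W x k))\<^sup>2"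
      unfolding cxy[OF \<open>k < n\<close>] norm_mult norm_of_real power_mult_distrib power2_abs
      by (simp add: power2_eq_square)
  qed
  also have "\<dots> \<le> (\<Sum>k<n. (1 - p k) * (cmod (coef n W x k))\<^sup>2)"
    using p by (intro sum_mono mult_right_mono) (auto intro: mult_left_le)
  also have "\<dots> = (\<Sum>a<n. (cmod (x a))\<^sup>2) - Re (quad_form n P x)"
    unfolding qf coef_parseval_norm[OF Wu, of x, symmetric] by (simp add: left_diff_distrib sum_subtractf)
  finally show "(\<Sum>a<n. (cmod (x a - (\<Sum>b<n. P $$ (a, b) * x b)))\<^sup>2)
      \<le> (\<Sum>a<n. (cmod (x a))\<^sup>2) - Re (quad_form n P x)" by (simp add: y_def)
qed

text \<open>Young's inequality for the cross term 2 |a| |b|, weighted by \<open>t\<close>.\<close>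

lemma norm_add_square_le:
  fixes a b :: complex
  assumes t: "t > 0"
  shows "(cmod (a + b))\<^sup>2 \<le> (1 + t) * (cmod a)\<^sup>2 + (1 + 1 / t) * (cmod b)\<^sup>2"
proof -
  have "(cmod (a + b))\<^sup>2 \<le> (cmod a + cmod b)\<^sup>2" by (intro power_mono norm_triangle_ineq) auto
  also have "\<dots> = (cmod a)\<^sup>2 + (cmod b)\<^sup>2 + 2 * (sqrt t * cmod a) * (cmod b / sqrt t)"
    using t by (simp add: power2_eq_square field_simps)
  also have "2 * (sqrt t * cmod a) * (cmod b / sqrt t) \<le> (sqrt t * cmod a)\<^sup>2 + (cmod b / sqrt t)\<^sup>2"
    by (rule sum_squares_bound)
  also have "(sqrt t * cmod a)\<^sup>2 + (cmod b / sqrt t)\<^sup>2 = t * (cmod a)\<^sup>2 + 1 / t * (cmod b)\<^sup>2"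
    using t by (simp add: power_mult_distrib power_divide)
  finally show ?thesis by (simp add: algebra_simps)
qed

text \<open>
  The free parameter \<open>t\<close> makes the factor in front of the type I error arbitrarily close to 1;
  this is what yields a strong converse for all \<open>\<epsilon> < 1\<close>.
\<close>

lemma test_converse_bound:
  assumes A: "eigen_dec n A U r" and r: "\<And>i. i < n \<Longrightarrow> 0 \<le> r i"
    and B: "eigen_dec n B V s" and s: "\<And>j. j < n \<Longrightarrow> 0 \<le> s j"
    and P: "P \<in> tests n" and t: "t > 0" and l: "l \<ge> 0"
  shows "(\<Sum>i<n. \<Sum>j<n. min (r i) (l * s j) * overlap n U V i j)
    \<le> (1 + t) * ((\<Sum>i<n. r i) - Re (mat_trace (P * A))) + (1 + 1 / t) * (l * Re (mat_trace (P * B)))"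
proof -
  have U: "unitary_mat n U" and V: "unitary_mat n V" using eigen_dec_carrier[OF A] eigen_dec_carrier[OF B] by auto
  have Pc: "P \<in> carrier_mat n n" and Ph: "hermitian_mat n P" using P tests_iff by (auto simp: hermitian_mat_def)
  define y where "y i a = (\<Sum>b<n. P $$ (a, b) * U $$ (b, i))" for i a
  define z where "z j a = (\<Sum>b<n. P $$ (a, b) * V $$ (b, j))" for j a
  \<comment> \<open>The amplitude of u_i along v_j splits into the contributions of
    \<open>1 - P\<close> and \<open>P\<close>. Summing |\<alpha>|^2 over j leads to the type I
    error, summing |\<beta>|^2 over i to the type II error.\<close>
  define \<alpha> where "\<alpha> i j = coef n V (\<lambda>a. U $$ (a, i) - y i a) j" for i j
  define \<beta> where "\<beta> i j = coef n V (y i) j" for i j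
  have \<alpha>: "(\<Sum>j<n. (cmod (\<alpha> i j))\<^sup>2) \<le> 1 - Re (quad_form n P (\<lambda>a. U $$ (a, i)))" if i: "i < n" for i
    unfolding \<alpha>_def coef_parseval_norm[OF V] unitary_mat_col_norm[OF U i, symmetric] y_def by (rule test_norm_bounds(2)[OF P])
  \<comment> \<open>\<open>P\<close> is moved to the other side of the inner product, since \<beta>
    has to be summed over \<open>i\<close> with v_j fixed.\<close>
  have "\<beta> i j = cnj (coef n U (z j) i)" if "i < n" "j < n" for i j
  proof -
    have "\<beta> i j = (\<Sum>a<n. \<Sum>b<n. cnj (V $$ (a, j)) * P $$ (a, b) * U $$ (b, i))"
      by (simp add: \<beta>_def coef_def y_def sum_distrib_left mult.assoc)
    also have "\<dots> = (\<Sum>b<n. \<Sum>a<n. cnj (V $$ (a, j)) * cnj (P $$ (b, a)) * U $$ (b, i))"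
    proof (subst sum.swap, intro sum.cong refl)
      fix a b assume "a \<in> {..<n}" "b \<in> {..<n}"
      then have "P $$ (a, b) = cnj (P $$ (b, a))" using Ph unfolding hermitian_mat_index by blast
      then show "cnj (V $$ (a, j)) * P $$ (a, b) * U $$ (b, i) = cnj (V $$ (a, j)) * cnj (P $$ (b, a)) * U $$ (b, i)"
        by (simp only:)
    qed
    also have "\<dots> = cnj (coef n U (z j) i)"
      by (simp add: coef_def z_def sum_distrib_left mult_ac)
    finally show ?thesis .
  qed
  then have "(\<Sum>i<n. (cmod (\<beta> i j))\<^sup>2) = (\<Sum>i<n. (cmod (coef n U (z j) i))\<^sup>2)" if "j < n" for j
    using that by (intro sum.cong) auto
  then have \<beta>: "(\<Sum>i<n. (cmod (\<beta> i j))\<^sup>2) \<le> Re (quad_form n P (\<lambda>a. V $$ (a, j)))" if "j < n" for j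
    using that test_norm_bounds(1)[OF P, of "\<lambda>a. V $$ (a, j)"] unfolding coef_parseval_norm[OF U] z_def by simp
  \<comment> \<open>The minimum is estimated by \<open>r i\<close> next to \<alpha> and by
    \<open>l * s j\<close> next to \<beta>.\<close>
  have ov: "min (r i) (l * s j) * overlap n U V i j
      \<le> (1 + t) * (r i * (cmod (\<alpha> i j))\<^sup>2) + (1 + 1 / t) * (l * (s j * (cmod (\<beta> i j))\<^sup>2))"
    if ij: "i < n" "j < n" for i j
  proof -
    have "coef n V (\<lambda>a. U $$ (a, i)) j = \<alpha> i j + \<beta> i j"
      by (simp add: \<alpha>_def \<beta>_def coef_def algebra_simps sum_subtractf)
    then have "overlap n U V i j \<le> (1 + t) * (cmod (\<alpha> i j))\<^sup>2 + (1 + 1 / t) * (cmod (\<beta> i j))\<^sup>2"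
      using norm_add_square_le[OF t] by (simp add: overlap_def)
    then have "min (r i) (l * s j) * overlap n U V i j
        \<le> min (r i) (l * s j) * ((1 + t) * (cmod (\<alpha> i j))\<^sup>2 + (1 + 1 / t) * (cmod (\<beta> i j))\<^sup>2)"
      using r s ij l by (intro mult_left_mono) auto
    also have "\<dots> = min (r i) (l * s j) * ((1 + t) * (cmod (\<alpha> i j))\<^sup>2) + min (r i) (l * s j) * ((1 + 1 / t) * (cmod (\<beta> i j))\<^sup>2)"
      by (simp add: distrib_left)
    also have "\<dots> \<le> r i * ((1 + t) * (cmod (\<alpha> i j))\<^sup>2) + (l * s j) * ((1 + 1 / t) * (cmod (\<beta> i j))\<^sup>2)"
      using t by (intro add_mono mult_right_mono) auto
    finally show ?thesis by (simp add: mult_ac)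
  qed
  have "(\<Sum>i<n. \<Sum>j<n. min (r i) (l * s j) * overlap n U V i j)
      \<le> (\<Sum>i<n. \<Sum>j<n. (1 + t) * (r i * (cmod (\<alpha> i j))\<^sup>2) + (1 + 1 / t) * (l * (s j * (cmod (\<beta> i j))\<^sup>2)))"
    using ov by (intro sum_mono) auto
  also have "\<dots> = (1 + t) * (\<Sum>i<n. r i * (\<Sum>j<n. (cmod (\<alpha> i j))\<^sup>2))
      + (\<Sum>i<n. \<Sum>j<n. (1 + 1 / t) * (l * (s j * (cmod (\<beta> i j))\<^sup>2)))"
    by (simp add: sum.distrib sum_distrib_left)
  also have "(\<Sum>i<n. \<Sum>j<n. (1 + 1 / t) * (l * (s j * (cmod (\<beta> i j))\<^sup>2)))
      = (1 + 1 / t) * (l * (\<Sum>j<n. s j * (\<Sum>i<n. (cmod (\<beta> i j))\<^sup>2)))"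
    unfolding sum_distrib_left by (rule sum.swap)
  also have "(1 + t) * (\<Sum>i<n. r i * (\<Sum>j<n. (cmod (\<alpha> i j))\<^sup>2))
      + (1 + 1 / t) * (l * (\<Sum>j<n. s j * (\<Sum>i<n. (cmod (\<beta> i j))\<^sup>2)))
      \<le> (1 + t) * (\<Sum>i<n. r i * (1 - Re (quad_form n P (\<lambda>a. U $$ (a, i)))))
      + (1 + 1 / t) * (l * (\<Sum>j<n. s j * Re (quad_form n P (\<lambda>a. V $$ (a, j)))))"
    using \<alpha> \<beta> r s t l by (intro add_mono mult_left_mono sum_mono) auto
  also have "(\<Sum>i<n. r i * (1 - Re (quad_form n P (\<lambda>a. U $$ (a, i))))) = (\<Sum>i<n. r i) - Re (mat_trace (P * A))"
    unfolding trace_mult_eigen_dec[OF Pc A] by (simp add: right_diff_distrib sum_subtractf)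
  also have "(\<Sum>j<n. s j * Re (quad_form n P (\<lambda>a. V $$ (a, j)))) = Re (mat_trace (P * B))"
    unfolding trace_mult_eigen_dec[OF Pc B] by simp
  finally show ?thesis .
qed

text \<open>To be read in the eigenbasis of the second state: \<open>P\<close> is the matrix of an
  orthogonal projection whose range contains the vectors \<open>v k\<close>. The clause on nonzero
  entries is the invariant that carries the induction, and the last clause becomes the bound on the
  type II error.\<close>

definition nested_projection ::
    "nat \<Rightarrow> real \<Rightarrow> (nat \<Rightarrow> real) \<Rightarrow> ('k \<Rightarrow> real) \<Rightarrow> ('k \<Rightarrow> nat \<Rightarrow> complex) \<Rightarrow> 'k set \<Rightarrow>
      (nat \<Rightarrow> nat \<Rightarrow> complex) \<Rightarrow> bool" where
  "nested_projection n l s r v S P \<longleftrightarrow> (\<forall>a<n. \<forall>b<n. P a b = cnj (P b a)) \<and>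
    (\<forall>a<n. \<forall>c<n. (\<Sum>b<n. P a b * P b c) = P a c) \<and>
    (\<forall>k\<in>S. \<forall>a<n. (\<Sum>b<n. P a b * v k b) = v k a) \<and>
    (\<forall>a<n. \<forall>b<n. P a b \<noteq> 0 \<longrightarrow> (\<exists>k\<in>S. l * s a \<le> r k)) \<and>
    (\<Sum>a<n. l * s a * Re (P a a)) \<le> (\<Sum>k\<in>S. r k)"

lemma nested_projectionD:
  assumes "nested_projection n l s r v S P"
  shows "\<And>a b. a < n \<Longrightarrow> b < n \<Longrightarrow> P a b = cnj (P b a)"
    and "\<And>a c. a < n \<Longrightarrow> c < n \<Longrightarrow> (\<Sum>b<n. P a b * P b c) = P a c"
    and "\<And>k a. k \<in> S \<Longrightarrow> a < n \<Longrightarrow> (\<Sum>b<n. P a b * v k b) = v k a"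
    and "\<And>a b. a < n \<Longrightarrow> b < n \<Longrightarrow> P a b \<noteq> 0 \<Longrightarrow> \<exists>k\<in>S. l * s a \<le> r k"
    and "(\<Sum>a<n. l * s a * Re (P a a)) \<le> (\<Sum>k\<in>S. r k)"
  using assms unfolding nested_projection_def by blast+

text \<open>
  Gram--Schmidt in the order of increasing \<open>r\<close>: the coordinate subspaces on which \<open>l * s \<le> r\<^sub>k\<close>
  are nested, so the vector added for \<open>k\<close> contributes at most \<open>r\<^sub>k\<close> to the trace.
\<close>

lemma exists_nested_projection:
  fixes v :: "'k \<Rightarrow> nat \<Rightarrow> complex" and r :: "'k \<Rightarrow> real" and s :: "nat \<Rightarrow> real"
  assumes "finite S" and "\<And>k. k \<in> S \<Longrightarrow> 0 \<le> r k"
    and "\<And>k a. k \<in> S \<Longrightarrow> a < n \<Longrightarrow> v k a \<noteq> 0 \<Longrightarrow> l * s a \<le> r k"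
  shows "\<exists>P. nested_projection n l s r v S P"
  using assms
proof (induction S rule: finite_ranking_induct[where f = r])
  case empty
  show ?case by (intro exI[of _ "\<lambda>a b. 0"]) (simp add: nested_projection_def)
next
  case (insert x S)
  from insert.IH[OF insert.prems(1)[OF insertI2] insert.prems(2)[OF insertI2]]
  obtain P where P: "nested_projection n l s r v S P" by blast
  note herm = nested_projectionD(1)[OF P] and idem = nested_projectionD(2)[OF P]
    and fixed = nested_projectionD(3)[OF P] and nest = nested_projectionD(4)[OF P]
    and tr = nested_projectionD(5)[OF P]
  define y where "y a = (\<Sum>b<n. P a b * v x b)" for a
  define w where "w a = v x a - y a" for a
  define N where "N = (\<Sum>a<n. (cmod (w a))\<^sup>2)"
  have sumr: "(\<Sum>k\<in>S. r k) + (if x \<in> S then 0 else r x) = (\<Sum>k\<in>insert x S. r k)"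
    using insert.hyps(1) by (simp add: insert_absorb)
  have rx: "0 \<le> r x" using insert.prems by auto
  show ?case
  proof (cases "x \<in> S \<or> N = 0")
    case True
    have "(\<Sum>b<n. P a b * v x b) = v x a" if "a < n" for a
    proof (cases "x \<in> S")
      case False
      then have "w a = 0" using True that unfolding N_def by (simp add: sum_nonneg_eq_0_iff)
      then show ?thesis by (simp add: w_def y_def)
    qed (use fixed that in blast)
    then have "\<forall>k\<in>insert x S. \<forall>a<n. (\<Sum>b<n. P a b * v k b) = v k a" using fixed by auto
    moreover have "(\<Sum>a<n. l * s a * Re (P a a)) \<le> (\<Sum>k\<in>insert x S. r k)"
      using tr rx sumr by (auto split: if_splits)
    ultimately show ?thesis
      unfolding nested_projection_def
      by (intro exI[of _ P] conjI allI impI herm idem) (use nest in blast)+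
  next
    case False
    then have xS: "x \<notin> S" and N: "N > 0" unfolding N_def by (auto simp: sum_nonneg less_le)
    have Nc: "complex_of_real N = (\<Sum>a<n. cnj (w a) * w a)"
      unfolding N_def of_real_sum complex_norm_square by (simp add: mult.commute)
    have Py: "(\<Sum>b<n. P a b * y b) = y a" if "a < n" for a
    proof -
      have "(\<Sum>b<n. P a b * y b) = (\<Sum>b<n. \<Sum>c<n. P a b * P b c * v x c)"
        by (simp add: y_def sum_distrib_left mult.assoc)
      also have "\<dots> = (\<Sum>c<n. (\<Sum>b<n. P a b * P b c) * v x c)"
        by (subst sum.swap) (simp add: sum_distrib_right)
      also have "\<dots> = y a" using idem[OF that] by (simp add: y_def)
      finally show ?thesis .
    qed
    have Pw: "(\<Sum>b<n. P a b * w b) = 0" if "a < n" for a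
      using Py[OF that] by (simp add: w_def right_diff_distrib sum_subtractf y_def[of a])
    have wP: "(\<Sum>b<n. cnj (w b) * P b c) = 0" if "c < n" for c
    proof -
      have e: "cnj (w b) * P b c = cnj (P c b * w b)" if "b < n" for b
        using herm[OF that \<open>c < n\<close>] by (simp add: mult.commute)
      have "(\<Sum>b<n. cnj (w b) * P b c) = (\<Sum>b<n. cnj (P c b * w b))"
        by (intro sum.cong refl, rule e) simp
      then have "(\<Sum>b<n. cnj (w b) * P b c) = cnj (\<Sum>b<n. P c b * w b)" by (simp only: cnj_sum)
      then show ?thesis using Pw[OF that] by simp
    qed
    have wPu: "(\<Sum>b<n. cnj (w b) * (\<Sum>c<n. P b c * u c)) = 0" for u
    proof -
      have "(\<Sum>b<n. cnj (w b) * (\<Sum>c<n. P b c * u c)) = (\<Sum>c<n. (\<Sum>b<n. cnj (w b) * P b c) * u c)"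
        unfolding sum_distrib_left sum_distrib_right by (subst sum.swap) (simp add: mult.assoc)
      then show ?thesis using wP by simp
    qed
    \<comment> \<open>Adds the rank-one projection onto the remainder \<open>w\<close>, which is
      orthogonal to the range of \<open>P\<close>.\<close>
    define P' where "P' a b = P a b + w a * cnj (w b) / of_real N" for a b
    have P'u: "(\<Sum>b<n. P' a b * u b) = (\<Sum>b<n. P a b * u b) + w a * (\<Sum>b<n. cnj (w b) * u b) / of_real N" for a u
      by (simp add: P'_def distrib_right sum.distrib sum_distrib_left sum_divide_distrib mult.assoc)
    have herm': "P' a b = cnj (P' b a)" if "a < n" "b < n" for a b
      using herm[OF that] unfolding P'_def by (simp add: mult.commute)
    have idem': "(\<Sum>b<n. P' a b * P' b c) = P' a c" if ac: "a < n" "c < n" for a c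
    proof -
      have "(\<Sum>b<n. P a b * P' b c) = (\<Sum>b<n. P a b * P b c) + (\<Sum>b<n. P a b * w b) * cnj (w c) / of_real N"
        by (simp add: P'_def distrib_left sum.distrib sum_distrib_right sum_divide_distrib mult.assoc)
      moreover have "(\<Sum>b<n. cnj (w b) * P' b c) = (\<Sum>b<n. cnj (w b) * P b c) + (\<Sum>b<n. cnj (w b) * w b) * cnj (w c) / of_real N"
        by (simp add: P'_def distrib_left sum.distrib sum_distrib_right sum_divide_distrib mult.assoc)
      ultimately show ?thesis
        unfolding P'u[of a "\<lambda>b. P' b c"] using idem[OF ac] Pw[OF ac(1)] wP[OF ac(2)] N
        by (simp add: Nc[symmetric] P'_def)
    qed
    have fixed': "(\<Sum>b<n. P' a b * v k b) = v k a" if k: "k \<in> insert x S" and a: "a < n" for k a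
    proof (cases "k = x")
      case True
      have "(\<Sum>b<n. cnj (w b) * v x b) = (\<Sum>b<n. cnj (w b) * w b) + (\<Sum>b<n. cnj (w b) * y b)"
        by (simp add: w_def algebra_simps sum.distrib sum_subtractf)
      also have "(\<Sum>b<n. cnj (w b) * y b) = 0" unfolding y_def by (rule wPu)
      finally have "(\<Sum>b<n. cnj (w b) * v x b) = of_real N" by (simp add: Nc)
      then show ?thesis unfolding True P'u using N by (simp add: w_def y_def)
    next
      case False
      then have "k \<in> S" using k by simp
      have "(\<Sum>b<n. cnj (w b) * v k b) = (\<Sum>b<n. cnj (w b) * (\<Sum>c<n. P b c * v k c))"
        using fixed[OF \<open>k \<in> S\<close>] by simp
      then show ?thesis unfolding P'u using fixed[OF \<open>k \<in> S\<close> a] wPu by simp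
    qed
    \<comment> \<open>A nonzero entry of \<open>w\<close> comes from \<open>v x\<close> or from the
      old range. In the second case \<open>l * s a\<close> is at most \<open>r k\<close> for some k
      in \<open>S\<close>, and r k <= r x by the order of insertion.\<close>
    have nestw: "l * s a \<le> r x" if a: "a < n" and "w a \<noteq> 0" for a
    proof (cases "v x a = 0")
      case True
      then have "y a \<noteq> 0" using that by (simp add: w_def)
      then obtain b where "b \<in> {..<n}" "P a b * v x b \<noteq> 0"
        unfolding y_def by (rule sum.not_neutral_contains_not_neutral)
      then have "b < n" "P a b \<noteq> 0" by auto
      then obtain k where "k \<in> S" "l * s a \<le> r k" using nest a by blast
      then show ?thesis using insert.hyps(2)[of k] by linarith
    next
      case False
      then show ?thesis using insert.prems a by blast
    qed
    have nest': "\<exists>k\<in>insert x S. l * s a \<le> r k" if "a < n" "b < n" "P' a b \<noteq> 0" for a b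
    proof (cases "w a = 0")
      case True
      then have "P a b \<noteq> 0" using that by (simp add: P'_def)
      then show ?thesis using nest that by blast
    qed (use nestw that in blast)
    have "(\<Sum>a<n. l * s a * Re (P' a a)) = (\<Sum>a<n. l * s a * Re (P a a)) + (\<Sum>a<n. l * s a * (cmod (w a))\<^sup>2) / N"
    proof -
      have "Re (P' a a) = Re (P a a) + (cmod (w a))\<^sup>2 / N" for a
        unfolding P'_def complex_norm_square[symmetric] by (simp flip: of_real_divide)
      then show ?thesis by (simp add: distrib_left sum.distrib sum_divide_distrib)
    qed
    also have "(\<Sum>a<n. l * s a * (cmod (w a))\<^sup>2) \<le> (\<Sum>a<n. r x * (cmod (w a))\<^sup>2)"
    proof (intro sum_mono)
      fix a assume "a \<in> {..<n}"
      then show "l * s a * (cmod (w a))\<^sup>2 \<le> r x * (cmod (w a))\<^sup>2"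
        using nestw[of a] by (cases "w a = 0") (auto intro!: mult_right_mono)
    qed
    also have "(\<Sum>a<n. r x * (cmod (w a))\<^sup>2) = r x * N" by (simp add: N_def sum_distrib_left)
    finally have "(\<Sum>a<n. l * s a * Re (P' a a)) \<le> (\<Sum>a<n. l * s a * Re (P a a)) + r x"
      using N by (simp add: divide_right_mono)
    also have "\<dots> \<le> (\<Sum>k\<in>insert x S. r k)" using tr sumr xS by simp
    finally show ?thesis unfolding nested_projection_def
      by (intro exI[of _ P'] conjI allI impI ballI herm' idem' fixed' nest')
  qed
qed

lemma quad_form_conj:
  assumes V: "V \<in> carrier_mat n n" and Q: "Q \<in> carrier_mat n n"
  shows "quad_form n (V * Q * mat_adjoint V) x = quad_form n Q (coef n V x)"
proof -
  let ?T = "\<lambda>a b i j. cnj (x a) * V $$ (a, i) * Q $$ (i, j) * cnj (V $$ (b, j)) * x b"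
  have VQ: "V * Q \<in> carrier_mat n n" using V Q by simp
  have "quad_form n (V * Q * mat_adjoint V) x
    = (\<Sum>a<n. \<Sum>b<n. \<Sum>j<n. \<Sum>i<n. ?T a b i j)"
    unfolding quad_form_def
  proof (intro sum.cong refl)
    fix a b assume "a \<in> {..<n}" "b \<in> {..<n}"
    then have ab: "a < n" "b < n" by auto
    have "(V * Q * mat_adjoint V) $$ (a, b) = (\<Sum>j<n. (\<Sum>i<n. V $$ (a, i) * Q $$ (i, j)) * cnj (V $$ (b, j)))"
      unfolding mat_mult_index[OF VQ mat_adjoint_carrier[OF V] ab]
      using mat_mult_index[OF V Q ab(1)] mat_adjoint_index[OF V _ ab(2)] by (intro sum.cong) auto
    then show "cnj (x a) * (V * Q * mat_adjoint V) $$ (a, b) * x b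
      = (\<Sum>j<n. \<Sum>i<n. ?T a b i j)"
      by (simp only:) (simp add: sum_distrib_left sum_distrib_right mult.assoc)
  qed
  also have "\<dots> = (\<Sum>a<n. \<Sum>j<n. \<Sum>b<n. \<Sum>i<n. ?T a b i j)"
    by (intro sum.cong refl sum.swap)
  also have "\<dots> = (\<Sum>j<n. \<Sum>a<n. \<Sum>i<n. \<Sum>b<n. ?T a b i j)"
    by (subst sum.swap, intro sum.cong refl sum.swap)
  also have "\<dots> = (\<Sum>j<n. \<Sum>i<n. \<Sum>a<n. \<Sum>b<n. ?T a b i j)"
    by (intro sum.cong refl sum.swap)
  also have "\<dots> = (\<Sum>i<n. \<Sum>j<n. \<Sum>a<n. \<Sum>b<n. ?T a b i j)"
    by (rule sum.swap)
  also have "\<dots> = quad_form n Q (coef n V x)"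
    unfolding quad_form_def coef_def
  proof (intro sum.cong refl)
    fix i j
    have "cnj (\<Sum>a<n. cnj (V $$ (a, i)) * x a) * Q $$ (i, j) * (\<Sum>b<n. cnj (V $$ (b, j)) * x b)
      = Q $$ (i, j) * ((\<Sum>a<n. cnj (x a) * V $$ (a, i)) * (\<Sum>b<n. cnj (V $$ (b, j)) * x b))"
      by (simp add: mult_ac)
    also have "\<dots> = (\<Sum>a<n. \<Sum>b<n. Q $$ (i, j) * (cnj (x a) * V $$ (a, i) * (cnj (V $$ (b, j)) * x b)))"
      unfolding sum_product by (simp only: sum_distrib_left)
    finally show "(\<Sum>a<n. \<Sum>b<n. ?T a b i j)
      = cnj (\<Sum>a<n. cnj (V $$ (a, i)) * x a) * Q $$ (i, j) * (\<Sum>b<n. cnj (V $$ (b, j)) * x b)"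
      by (simp add: mult_ac)
  qed
  finally show ?thesis .
qed

text \<open>Each eigenvector u_i is truncated to its components along the v_j with l s_j <= r_i, and
  the test is a projection whose range contains these truncations. Its expectation in u_i is then at
  least the squared length of the truncation.\<close>

lemma exists_test:
  assumes A: "eigen_dec n A U r" and r: "\<And>i. i < n \<Longrightarrow> 0 \<le> r i"
    and B: "eigen_dec n B V s"
  shows "\<exists>P\<in>tests n. l * Re (mat_trace (P * B)) \<le> (\<Sum>i<n. r i) \<and>
    (\<Sum>i<n. \<Sum>j<n. if l * s j \<le> r i then r i * overlap n U V i j else 0) \<le> Re (mat_trace (P * A))"
proof -
  have U: "unitary_mat n U" and V: "unitary_mat n V" and Vc: "V \<in> carrier_mat n n"
    using eigen_dec_carrier[OF A] eigen_dec_carrier[OF B] by auto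
  define c where "c i = coef n V (\<lambda>a. U $$ (a, i))" for i
  define v where "v i j = (if l * s j \<le> r i then c i j else 0)" for i j
  have "\<exists>P. nested_projection n l s r v {..<n} P"
    using r by (intro exists_nested_projection) (auto simp: v_def split: if_splits)
  then obtain P where P: "nested_projection n l s r v {..<n} P" by blast
  note herm = nested_projectionD(1)[OF P] and idem = nested_projectionD(2)[OF P]
    and fixed = nested_projectionD(3)[OF P] and tr = nested_projectionD(5)[OF P]
  define Q where "Q = Matrix.mat n n (\<lambda>(a, b). P a b)"
  have Q: "Q \<in> carrier_mat n n" by (simp add: Q_def)
  \<comment> \<open>Back from the eigenbasis of \<open>B\<close> to the standard basis.\<close>
  define T where "T = V * Q * mat_adjoint V"
  have Tc: "T \<in> carrier_mat n n" unfolding T_def using Vc Q by (metis mult_carrier_mat mat_adjoint_carrier)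
  define p where "p x a = (\<Sum>b<n. P a b * x b)" for x a
  have swap: "(\<Sum>a<n. cnj (x a) * p y a) = (\<Sum>a<n. cnj (p x a) * y a)" for x y
  proof -
    have "(\<Sum>a<n. cnj (x a) * p y a) = (\<Sum>a<n. \<Sum>b<n. cnj (x a) * P a b * y b)"
      by (simp add: p_def sum_distrib_left mult.assoc)
    also have "\<dots> = (\<Sum>b<n. \<Sum>a<n. cnj (P b a) * cnj (x a) * y b)"
    proof (subst sum.swap, intro sum.cong refl)
      fix a b assume "a \<in> {..<n}" "b \<in> {..<n}"
      then have "P a b = cnj (P b a)" using herm by blast
      then show "cnj (x a) * P a b * y b = cnj (P b a) * cnj (x a) * y b" by (simp only: mult.commute)
    qed
    also have "\<dots> = (\<Sum>a<n. cnj (p x a) * y a)" by (simp add: p_def sum_distrib_right)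
    finally show ?thesis .
  qed
  have pp: "p (p x) a = p x a" if "a < n" for x a
  proof -
    have "p (p x) a = (\<Sum>b<n. \<Sum>c<n. P a b * P b c * x c)"
      by (simp add: p_def sum_distrib_left mult.assoc)
    also have "\<dots> = (\<Sum>c<n. (\<Sum>b<n. P a b * P b c) * x c)"
      by (subst sum.swap) (simp add: sum_distrib_right)
    also have "\<dots> = p x a" using idem[OF that] by (simp add: p_def)
    finally show ?thesis .
  qed
  have nrm: "(\<Sum>a<n. cnj (x a) * x a) = of_real (\<Sum>a<n. (cmod (x a))\<^sup>2)" for x
    unfolding of_real_sum complex_norm_square by (simp add: mult.commute)
  have qf: "quad_form n Q x = (\<Sum>a<n. cnj (x a) * p x a)" for x
    unfolding quad_form_def p_def by (simp add: Q_def sum_distrib_left mult.assoc)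
  have qfQ: "quad_form n Q x = of_real (\<Sum>a<n. (cmod (p x a))\<^sup>2)" for x
  proof -
    have "quad_form n Q x = (\<Sum>a<n. cnj (x a) * p (p x) a)" unfolding qf using pp by simp
    then show ?thesis unfolding swap[of x "p x"] nrm .
  qed
  have dist: "(\<Sum>a<n. (cmod (x a - y a))\<^sup>2) = (\<Sum>a<n. (cmod (x a))\<^sup>2) - 2 * Re (\<Sum>a<n. cnj (x a) * y a) + (\<Sum>a<n. (cmod (y a))\<^sup>2)"
    for x y :: "nat \<Rightarrow> complex"
  proof -
    have "(cmod (x a - y a))\<^sup>2 = (cmod (x a))\<^sup>2 - 2 * Re (cnj (x a) * y a) + (cmod (y a))\<^sup>2" for a
      unfolding cmod_power2 by (simp add: power2_eq_square algebra_simps)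
    then show ?thesis by (simp add: sum.distrib sum_subtractf sum_distrib_left)
  qed
  have qfT: "quad_form n T x = of_real (\<Sum>a<n. (cmod (p (coef n V x) a))\<^sup>2)" for x
    unfolding T_def quad_form_conj[OF Vc Q] qfQ ..
  have "T \<in> tests n" unfolding tests_iff
  proof (intro conjI allI)
    have Qh: "mat_adjoint Q = Q"
    proof -
      have "hermitian_mat n Q" unfolding hermitian_mat_index by (auto simp: Q_def intro: herm)
      then show ?thesis by (simp add: hermitian_mat_def)
    qed
    have VV: "mat_adjoint (mat_adjoint V) = V"
      by (rule mat_adjoint_adjoint[OF Vc])
    show "hermitian_mat n T" unfolding hermitian_mat_def
      using Tc Vc Q unfolding T_def
      by (simp add: mat_adjoint_mult[of _ n n _ n] Qh VV assoc_mult_mat[of _ n n _ n _ n])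
    fix x
    show "0 \<le> Re (quad_form n T x)" unfolding qfT by (simp add: sum_nonneg)
    define y where "y = coef n V x"
    have "0 \<le> (\<Sum>a<n. (cmod (y a - p y a))\<^sup>2)" by (intro sum_nonneg) auto
    then have "(\<Sum>a<n. (cmod (p y a))\<^sup>2) \<le> (\<Sum>a<n. (cmod (y a))\<^sup>2)"
      unfolding dist qf[symmetric] qfQ by simp
    then show "Re (quad_form n T x) \<le> (\<Sum>a<n. (cmod (x a))\<^sup>2)"
      unfolding qfT y_def coef_parseval_norm[OF V] by simp
  qed
  moreover have "l * Re (mat_trace (T * B)) \<le> (\<Sum>i<n. r i)"
  proof -
    have "quad_form n T (\<lambda>a. V $$ (a, j)) = P j j" if j: "j < n" for j
    proof -
      have "quad_form n T (\<lambda>a. V $$ (a, j)) = (\<Sum>a<n. \<Sum>b<n. cnj (coef n V (\<lambda>a. V $$ (a, j)) a) * Q $$ (a, b) * coef n V (\<lambda>a. V $$ (a, j)) b)"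
        unfolding T_def quad_form_conj[OF Vc Q] by (simp add: quad_form_def)
      also have "\<dots> = (\<Sum>a<n. \<Sum>b<n. if b = j then (if a = j then P j j else 0) else 0)"
        by (intro sum.cong refl) (auto simp: coef_col[OF V j] Q_def)
      also have "\<dots> = P j j" using j by simp
      finally show ?thesis .
    qed
    then have "l * Re (mat_trace (T * B)) = (\<Sum>a<n. l * s a * Re (P a a))"
      unfolding trace_mult_eigen_dec[OF Tc B] by (simp add: sum_distrib_left mult_ac)
    then show ?thesis using tr by simp
  qed
  moreover have "(\<Sum>i<n. \<Sum>j<n. if l * s j \<le> r i then r i * overlap n U V i j else 0) \<le> Re (mat_trace (T * A))"
  proof -
    have "(\<Sum>j<n. if l * s j \<le> r i then r i * overlap n U V i j else 0) \<le> r i * Re (quad_form n T (\<lambda>a. U $$ (a, i)))"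
      if i: "i < n" for i
    proof -
      have pv: "p (v i) a = v i a" if "a < n" for a using fixed[of i a] i that by (simp add: p_def)
      have "(\<Sum>a<n. cnj (p (c i) a) * v i a) = (\<Sum>a<n. cnj (c i a) * v i a)"
        unfolding swap[symmetric] using pv by simp
      also have "\<dots> = (\<Sum>a<n. cnj (v i a) * v i a)" by (intro sum.cong) (auto simp: v_def)
      finally have "(\<Sum>a<n. cnj (p (c i) a) * v i a) = of_real (\<Sum>a<n. (cmod (v i a))\<^sup>2)" by (simp only: nrm)
      \<comment> \<open>As \<open>p\<close> fixes \<open>v i\<close>, the inner product of
        \<open>p (c i)\<close> with \<open>v i\<close> equals |v i|^2. Expanding this square then
        gives |v i|^2 <= |p (c i)|^2.\<close>
      moreover have "0 \<le> (\<Sum>a<n. (cmod (p (c i) a - v i a))\<^sup>2)" by (intro sum_nonneg) auto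
      ultimately have "(\<Sum>a<n. (cmod (v i a))\<^sup>2) \<le> (\<Sum>a<n. (cmod (p (c i) a))\<^sup>2)"
        unfolding dist by simp
      then have "(\<Sum>a<n. (cmod (v i a))\<^sup>2) \<le> Re (quad_form n T (\<lambda>a. U $$ (a, i)))"
        unfolding qfT c_def by simp
      then have "r i * (\<Sum>a<n. (cmod (v i a))\<^sup>2) \<le> r i * Re (quad_form n T (\<lambda>a. U $$ (a, i)))"
        using r[OF i] by (rule mult_left_mono)
      moreover have "r i * (\<Sum>a<n. (cmod (v i a))\<^sup>2) = (\<Sum>j<n. if l * s j \<le> r i then r i * overlap n U V i j else 0)"
        unfolding sum_distrib_left by (intro sum.cong) (auto simp: v_def overlap_def c_def)
      ultimately show ?thesis by simp
    qed
    then show ?thesis unfolding trace_mult_eigen_dec[OF Tc A] by (auto intro!: sum_mono)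
  qed
  ultimately show ?thesis by blast
qed

section \<open>Nussbaum--Szkola sums of tensor powers\<close>

definition ns_pair ::
    "nat \<Rightarrow> complex mat \<Rightarrow> complex mat \<Rightarrow> complex mat \<Rightarrow> (nat \<Rightarrow> real) \<Rightarrow> complex mat \<Rightarrow> (nat \<Rightarrow> real) \<Rightarrow> bool"
  where
  "ns_pair n A B U r V s \<longleftrightarrow> eigen_dec n A U r \<and> (\<forall>i<n. 0 \<le> r i) \<and> (\<Sum>i<n. r i) = 1 \<and>
     eigen_dec n B V s \<and> (\<forall>j<n. 0 \<le> s j) \<and> (\<Sum>j<n. s j) = 1"

text \<open>The sum is the quasi-entropy \<open>Tr [A\<^sup>u B\<^sup>v]\<close>; note that \<open>0 powr v = 0\<close> for all \<open>v\<close>.\<close>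

definition ns_sum ::
    "nat \<Rightarrow> complex mat \<Rightarrow> (nat \<Rightarrow> real) \<Rightarrow> complex mat \<Rightarrow> (nat \<Rightarrow> real) \<Rightarrow> real \<Rightarrow> real \<Rightarrow> real"
  where
  "ns_sum n U r V s u v = (\<Sum>i<n. \<Sum>j<n. r i powr u * s j powr v * overlap n U V i j)"

lemma ns_pairD:
  assumes "ns_pair n A B U r V s"
  shows "eigen_dec n A U r" "eigen_dec n B V s" "unitary_mat n U" "unitary_mat n V"
    "\<And>i. i < n \<Longrightarrow> 0 \<le> r i" "\<And>j. j < n \<Longrightarrow> 0 \<le> s j"
    "(\<Sum>i<n. r i) = 1" "(\<Sum>j<n. s j) = 1" "\<And>i. i < n \<Longrightarrow> r i \<le> 1" "\<And>j. j < n \<Longrightarrow> s j \<le> 1"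
proof -
  show "eigen_dec n A U r" "eigen_dec n B V s" "unitary_mat n U" "unitary_mat n V"
    "(\<Sum>i<n. r i) = 1" "(\<Sum>j<n. s j) = 1"
    using assms eigen_dec_carrier(3) by (auto simp: ns_pair_def)
  show r: "\<And>i. i < n \<Longrightarrow> 0 \<le> r i" and s: "\<And>j. j < n \<Longrightarrow> 0 \<le> s j"
    using assms by (auto simp: ns_pair_def)
  show "r i \<le> 1" if "i < n" for i
    using member_le_sum[of i "{..<n}" r] r that \<open>(\<Sum>i<n. r i) = 1\<close> by simp
  show "s j \<le> 1" if "j < n" for j
    using member_le_sum[of j "{..<n}" s] s that \<open>(\<Sum>j<n. s j) = 1\<close> by simp
qed

lemma ns_pair_exists:
  assumes A: "A \<in> density_ops n" and B: "B \<in> density_ops n"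
  obtains U r V s where "ns_pair n A B U r V s"
proof -
  have A': "psd_mat n A" "mat_trace A = 1" and B': "psd_mat n B" "mat_trace B = 1"
    using A B by (auto simp: density_ops_def)
  obtain U r where U: "eigen_dec n A U r" "\<And>i. i < n \<Longrightarrow> 0 \<le> r i" using psd_eigen_dec[OF A'(1)] by metis
  obtain V s where V: "eigen_dec n B V s" "\<And>i. i < n \<Longrightarrow> 0 \<le> s i" using psd_eigen_dec[OF B'(1)] by metis
  have "(\<Sum>i<n. r i) = 1" "(\<Sum>j<n. s j) = 1"
    using trace_eigen_dec[OF U(1)] trace_eigen_dec[OF V(1)] A' B' by (metis of_real_eq_1_iff)+
  then have "ns_pair n A B U r V s" using U V by (simp add: ns_pair_def)
  then show ?thesis by (rule that)
qed

lemma ns_sum_nonneg: "0 \<le> ns_sum n U r V s u v"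
  unfolding ns_sum_def by (intro sum_nonneg mult_nonneg_nonneg) auto

lemma ns_pair_sum_overlap:
  assumes ns: "ns_pair n A B U r V s"
  shows "(\<Sum>i<n. \<Sum>j<n. r i * overlap n U V i j) = 1"
proof -
  have "(\<Sum>i<n. \<Sum>j<n. r i * overlap n U V i j) = (\<Sum>i<n. r i)"
    using overlap_sum_right[OF ns_pairD(3,4)[OF ns]]
    by (intro sum.cong) (auto simp flip: sum_distrib_left)
  then show ?thesis using ns_pairD(7)[OF ns] by simp
qed

abbreviation index_prod :: "nat \<Rightarrow> (nat \<Rightarrow> real) \<Rightarrow> (nat \<Rightarrow> real) \<Rightarrow> nat \<Rightarrow> real" where
  "index_prod m f g \<equiv> \<lambda>i. f (i div m) * g (i mod m)"

lemma ns_pair_kron: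
  assumes 1: "ns_pair n A B U r V s" and 2: "ns_pair m A' B' U' r' V' s'"
  shows "ns_pair (n * m) (kron A A') (kron B B') (kron U U') (index_prod m r r')
    (kron V V') (index_prod m s s')"
proof -
  have "(\<Sum>i<n * m. f (i div m) * f' (i mod m)) = 1" if "(\<Sum>i<n. f i) = 1" "(\<Sum>i<m. f' i) = 1" for f f' :: "nat \<Rightarrow> real"
    using sum_div_mod[of "\<lambda>i j. f i * f' j" m n] that by (simp add: sum_product[symmetric])
  then show ?thesis
    using 1 2 eigen_dec_kron div_mod_less unfolding ns_pair_def by (auto intro!: mult_nonneg_nonneg)
qed

lemma ns_sum_kron:
  assumes 1: "ns_pair n A B U r V s" and 2: "ns_pair m A' B' U' r' V' s'"
  shows "ns_sum (n * m) (kron U U') (index_prod m r r') (kron V V') (index_prod m s s') u v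
    = ns_sum n U r V s u v * ns_sum m U' r' V' s' u v"
proof -
  have c: "U \<in> carrier_mat n n" "U' \<in> carrier_mat m m" "V \<in> carrier_mat n n" "V' \<in> carrier_mat m m"
    using ns_pairD(3,4)[OF 1] ns_pairD(3,4)[OF 2] by (auto simp: unitary_mat_def)
  let ?g = "\<lambda>i j. r i powr u * s j powr v * overlap n U V i j"
  let ?g' = "\<lambda>i j. r' i powr u * s' j powr v * overlap m U' V' i j"
  have "ns_sum (n * m) (kron U U') (index_prod m r r') (kron V V') (index_prod m s s') u v
    = (\<Sum>i<n * m. \<Sum>j<n * m. ?g (i div m) (j div m) * ?g' (i mod m) (j mod m))"
    unfolding ns_sum_def by (intro sum.cong refl) (auto simp: overlap_kron[OF c] powr_mult)
  also have "\<dots> = (\<Sum>i<n * m. \<Sum>a<n. \<Sum>b<m. ?g (i div m) a * ?g' (i mod m) b)"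
    using sum_div_mod[of "\<lambda>a b. ?g (i div m) a * ?g' (i mod m) b" m n for i] by simp
  also have "\<dots> = (\<Sum>i<n. \<Sum>k<m. \<Sum>a<n. \<Sum>b<m. ?g i a * ?g' k b)"
    by (rule sum_div_mod[of "\<lambda>i k. \<Sum>a<n. \<Sum>b<m. ?g i a * ?g' k b"])
  also have "\<dots> = ns_sum n U r V s u v * ns_sum m U' r' V' s' u v"
    unfolding ns_sum_def by (simp only: sum_product)
  finally show ?thesis .
qed

lemma dominated_kron:
  assumes 1: "ns_pair n A B U r V s" and 2: "ns_pair m A' B' U' r' V' s'"
    and "dominated n U r V s" and "dominated m U' r' V' s'"
  shows "dominated (n * m) (kron U U') (index_prod m r r') (kron V V') (index_prod m s s')"
proof -
  have c: "U \<in> carrier_mat n n" "U' \<in> carrier_mat m m" "V \<in> carrier_mat n n" "V' \<in> carrier_mat m m"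
    using ns_pairD(3,4)[OF 1] ns_pairD(3,4)[OF 2] by (auto simp: unitary_mat_def)
  show ?thesis unfolding dominated_def
  proof (intro allI impI)
    fix i j assume ij: "i < n * m" "j < n * m" and "s (j div m) * s' (j mod m) = 0"
    then consider "s (j div m) = 0" | "s' (j mod m) = 0" by auto
    then have "r (i div m) * overlap n U V (i div m) (j div m) = 0 \<or>
        r' (i mod m) * overlap m U' V' (i mod m) (j mod m) = 0"
      using assms(3,4) div_mod_less[OF ij(1)] div_mod_less[OF ij(2)] unfolding dominated_def
      by cases blast+
    then show "r (i div m) * r' (i mod m) * overlap (n * m) (kron U U') (kron V V') i j = 0"
      unfolding overlap_kron[OF c ij] by auto
  qed
qed

text \<open>The flag \<open>b\<close> lets one induction serve both directions: the converse needs
  domination, achievability must also cover states without it. The factors may differ from letter to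
  letter; only the bound \<open>c\<close> is common.\<close>

lemma ns_pair_tensor_list:
  assumes "\<And>x. x \<in> set xs \<Longrightarrow> \<exists>U r V s. ns_pair d (F x) (G x) U r V s \<and>
    (b \<longrightarrow> dominated d U r V s) \<and> ns_sum d U r V s u v \<le> c"
  shows "\<exists>U r V s. ns_pair (d ^ length xs) (tensor_list (map F xs)) (tensor_list (map G xs)) U r V s \<and>
    (b \<longrightarrow> dominated (d ^ length xs) U r V s) \<and> ns_sum (d ^ length xs) U r V s u v \<le> c ^ length xs"
  using assms
proof (induction xs)
  case Nil
  have u: "unitary_mat 1 (1\<^sub>m 1)" by (intro unitary_matI) auto
  have e: "eigen_dec 1 (1\<^sub>m 1) (1\<^sub>m 1) (\<lambda>_. 1)" by (intro eigen_decI u) auto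
  have "ns_pair 1 (1\<^sub>m 1) (1\<^sub>m 1) (1\<^sub>m 1) (\<lambda>_. 1) (1\<^sub>m 1) (\<lambda>_. 1)" using e by (simp add: ns_pair_def)
  moreover have "overlap 1 (1\<^sub>m 1) (1\<^sub>m 1) 0 0 = 1" by (simp add: overlap_def coef_def)
  then have "ns_sum 1 (1\<^sub>m 1) (\<lambda>_. 1) (1\<^sub>m 1) (\<lambda>_. 1) u v \<le> c ^ 0" by (simp add: ns_sum_def)
  moreover have "dominated 1 (1\<^sub>m 1) (\<lambda>_. 1) (1\<^sub>m 1) (\<lambda>_. 1)" by (simp add: dominated_def)
  ultimately show ?case unfolding tensor_list_def
    by (intro exI[of _ "1\<^sub>m 1"] exI[of _ "\<lambda>_. 1"]) simp
next
  case (Cons x xs)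
  from Cons.prems[of x] obtain U r V s where
    1: "ns_pair d (F x) (G x) U r V s" "b \<longrightarrow> dominated d U r V s" "ns_sum d U r V s u v \<le> c" by auto
  from Cons.IH Cons.prems obtain U' r' V' s' where
    2: "ns_pair (d ^ length xs) (tensor_list (map F xs)) (tensor_list (map G xs)) U' r' V' s'"
      "b \<longrightarrow> dominated (d ^ length xs) U' r' V' s'"
      "ns_sum (d ^ length xs) U' r' V' s' u v \<le> c ^ length xs" by auto
  let ?m = "d ^ length xs"
  have "ns_pair (d * ?m) (kron (F x) (tensor_list (map F xs))) (kron (G x) (tensor_list (map G xs)))
    (kron U U') (index_prod ?m r r') (kron V V') (index_prod ?m s s')"
    by (rule ns_pair_kron[OF 1(1) 2(1)])
  moreover have "b \<longrightarrow> dominated (d * ?m) (kron U U') (index_prod ?m r r') (kron V V') (index_prod ?m s s')"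
    using dominated_kron[OF 1(1) 2(1)] 1(2) 2(2) by blast
  moreover have "ns_sum (d * ?m) (kron U U') (index_prod ?m r r') (kron V V') (index_prod ?m s s') u v
      \<le> c * c ^ length xs"
    unfolding ns_sum_kron[OF 1(1) 2(1)] using 1(3) 2(3) ns_sum_nonneg[of d U r V s u v]
    by (intro mult_mono ns_sum_nonneg) linarith+
  moreover have "tensor_list (map H (x # xs)) = kron (H x) (tensor_list (map H xs))" for H
    by (simp add: tensor_list_def)
  ultimately show ?case unfolding length_Cons power_Suc by (simp only:) blast
qed

section \<open>Bounds on the hypothesis testing divergence\<close>

lemma neg_log2_antimono: "x \<le> y \<Longrightarrow> neg_log2 y \<le> neg_log2 x"
  by (auto simp: neg_log2_def)

lemma hyp_div_lower:
  assumes ns: "ns_pair n A B U r V s" and l: "l > 0" and t: "0 \<le> t" "t < 1"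
    and small: "l powr t * ns_sum n U r V s (1 - t) t \<le> \<epsilon>"
  shows "ereal (log 2 l) \<le> hyp_div \<epsilon> A B"
proof -
  note D = ns_pairD[OF ns]
  have An: "dim_row A = n" using eigen_dec_carrier(1)[OF D(1)] by simp
  obtain P where P: "P \<in> tests n" and PB: "l * Re (mat_trace (P * B)) \<le> 1"
    and PA: "(\<Sum>i<n. \<Sum>j<n. if l * s j \<le> r i then r i * overlap n U V i j else 0) \<le> Re (mat_trace (P * A))"
    using exists_test[OF D(1,5,2), of l] D(7) by auto
  have "1 - \<epsilon> \<le> (\<Sum>i<n. \<Sum>j<n. r i * overlap n U V i j) - l powr t * ns_sum n U r V s (1 - t) t"
    using small ns_pair_sum_overlap[OF ns] by simp
  also have "\<dots> = (\<Sum>i<n. \<Sum>j<n. r i * overlap n U V i j - l powr t * (r i powr (1 - t) * s j powr t * overlap n U V i j))"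
    by (simp add: ns_sum_def sum_subtractf sum_distrib_left)
  also have "\<dots> \<le> (\<Sum>i<n. \<Sum>j<n. if l * s j \<le> r i then r i * overlap n U V i j else 0)"
  proof (intro sum_mono)
    fix i j assume "i \<in> {..<n}" "j \<in> {..<n}"
    then have ij: "i < n" "j < n" by auto
    have "r i \<le> l powr t * (r i powr (1 - t) * s j powr t)" if lt: "r i < l * s j"
    proof (cases "r i = 0")
      case False
      then have r0: "r i > 0" using D(5)[OF ij(1)] by simp
      \<comment> \<open>Positivity of \<open>s j\<close> makes the convention
        \<open>0 powr t = 0\<close> harmless here.\<close>
      have s0: "s j > 0" using lt l r0 by (metis less_trans zero_less_mult_pos)
      have "r i = r i powr (1 - t) * r i powr t" using r0 by (simp flip: powr_add)
      also have "\<dots> \<le> r i powr (1 - t) * (l * s j) powr t"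
        using lt r0 t by (intro mult_left_mono powr_mono2) auto
      finally show ?thesis by (simp add: powr_mult mult_ac)
    qed simp
    then have "r i * overlap n U V i j \<le> l powr t * (r i powr (1 - t) * s j powr t) * overlap n U V i j"
      if "\<not> l * s j \<le> r i" using that by (intro mult_right_mono) auto
    then show "r i * overlap n U V i j - l powr t * (r i powr (1 - t) * s j powr t * overlap n U V i j)
        \<le> (if l * s j \<le> r i then r i * overlap n U V i j else 0)"
      by (auto simp: mult.assoc)
  qed
  also note PA
  finally have PA': "1 - \<epsilon> \<le> Re (mat_trace (P * A))" .
  \<comment> \<open>Bounds the set of type II errors from below, without which the real infimum
    could not be estimated.\<close>
  have nonneg: "0 \<le> Re (mat_trace (Q * B))" if "Q \<in> tests n" for Q
  proof -
    have Q: "Q \<in> carrier_mat n n" using that tests_iff by (auto simp: hermitian_mat_def)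
    have "\<And>x. 0 \<le> Re (quad_form n Q x)" using that tests_iff by blast
    then show ?thesis unfolding trace_mult_eigen_dec[OF Q D(2)] using D(6) by (auto intro!: sum_nonneg)
  qed
  have "(INF Q\<in>{Q \<in> tests (dim_row A). Re (mat_trace (Q * A)) \<ge> 1 - \<epsilon>}. Re (mat_trace (Q * B)))
      \<le> Re (mat_trace (P * B))"
    using P PA' nonneg An by (intro cINF_lower bdd_belowI2[where m = 0]) auto
  also have "\<dots> \<le> 1 / l" using PB l by (simp add: field_simps)
  finally have "neg_log2 (1 / l) \<le> hyp_div \<epsilon> A B" unfolding hyp_div_def by (rule neg_log2_antimono)
  moreover have "neg_log2 (1 / l) = ereal (log 2 l)" using l by (simp add: neg_log2_def log_divide)
  ultimately show ?thesis by simp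
qed

text \<open>Where r > l s > 0, also r <= l^(-u) r^(1+u) s^(-u), so the minima in
  \<open>test_converse_bound\<close> sum to at least 1 - \<delta>. Domination covers s_j = 0, where
  \<open>powr\<close> returns 0 instead of infinity.\<close>

lemma hyp_div_upper:
  assumes ns: "ns_pair n A B U r V s" and dom: "dominated n U r V s" and l: "l > 0" and u: "u > 0"
    and small: "l powr (- u) * ns_sum n U r V s (1 + u) (- u) \<le> \<delta>"
    and t: "t > 0" and pos: "0 < 1 - \<delta> - (1 + t) * \<epsilon>" and \<epsilon>: "0 \<le> \<epsilon>"
  shows "hyp_div \<epsilon> A B \<le> ereal (log 2 l - log 2 ((1 - \<delta> - (1 + t) * \<epsilon>) / (1 + 1 / t)))"
proof -
  note D = ns_pairD[OF ns]
  have Ac: "A \<in> carrier_mat n n" and An: "dim_row A = n" using eigen_dec_carrier(1)[OF D(1)] by auto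
  \<comment> \<open>What \<open>test_converse_bound\<close> leaves as a lower bound on
    \<open>l\<close> times the type II error, once the type I error is at most \<epsilon>.\<close>
  define \<kappa> where "\<kappa> = (1 - \<delta> - (1 + t) * \<epsilon>) / (1 + 1 / t)"
  have t1: "1 + 1 / t > 0" using t by (simp add: add_pos_pos)
  have \<kappa>: "\<kappa> > 0" unfolding \<kappa>_def using pos t1 by simp
  have "1 - \<delta> \<le> (\<Sum>i<n. \<Sum>j<n. r i * overlap n U V i j) - l powr (- u) * ns_sum n U r V s (1 + u) (- u)"
    using small ns_pair_sum_overlap[OF ns] by simp
  also have "\<dots> = (\<Sum>i<n. \<Sum>j<n. r i * overlap n U V i j - l powr (- u) * (r i powr (1 + u) * s j powr (- u) * overlap n U V i j))"
    by (simp add: ns_sum_def sum_subtractf sum_distrib_left)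
  also have "\<dots> \<le> (\<Sum>i<n. \<Sum>j<n. min (r i) (l * s j) * overlap n U V i j)"
  proof (intro sum_mono)
    fix i j assume "i \<in> {..<n}" "j \<in> {..<n}"
    then have ij: "i < n" "j < n" by auto
    have m0: "0 \<le> min (r i) (l * s j) * overlap n U V i j" using D(5,6) ij l by (intro mult_nonneg_nonneg) auto
    show "r i * overlap n U V i j - l powr (- u) * (r i powr (1 + u) * s j powr (- u) * overlap n U V i j)
      \<le> min (r i) (l * s j) * overlap n U V i j"
    proof (cases "l * s j < r i")
      case True
      show ?thesis
      proof (cases "s j = 0")
        case True
        have "r i * overlap n U V i j = 0" using dom ij True unfolding dominated_def by blast
        then have "r i * overlap n U V i j - l powr (- u) * (r i powr (1 + u) * s j powr (- u) * overlap n U V i j) = 0"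
          using True by auto
        then show ?thesis using m0 by linarith
      next
        case False
        then have s0: "s j > 0" using D(6) ij by (metis less_le)
        have r0: "r i > 0" using True s0 l by (meson less_trans mult_pos_pos)
        have "1 \<le> (r i / (l * s j)) powr u" using True s0 l u by (intro ge_one_powr_ge_zero) auto
        then have "r i * 1 \<le> r i * (r i / (l * s j)) powr u" using r0 by (intro mult_left_mono) auto
        also have "\<dots> = l powr (- u) * (r i powr (1 + u) * s j powr (- u))"
          using r0 s0 l by (simp add: powr_add powr_divide powr_mult powr_minus field_simps)
        finally have "r i * overlap n U V i j \<le> l powr (- u) * (r i powr (1 + u) * s j powr (- u)) * overlap n U V i j"
          by (intro mult_right_mono) auto
        then show ?thesis using m0 by (simp add: mult.assoc)
      qed
    next
      case False
      then have "min (r i) (l * s j) = r i" by simp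
      moreover have "0 \<le> l powr (- u) * (r i powr (1 + u) * s j powr (- u) * overlap n U V i j)" by simp
      ultimately show ?thesis by linarith
    qed
  qed
  finally have lower: "1 - \<delta> \<le> (\<Sum>i<n. \<Sum>j<n. min (r i) (l * s j) * overlap n U V i j)" .
  have each: "\<kappa> / l \<le> Re (mat_trace (P * B))" if P: "P \<in> tests n" "1 - \<epsilon> \<le> Re (mat_trace (P * A))" for P
  proof -
    have "1 - \<delta> \<le> (1 + t) * (1 - Re (mat_trace (P * A))) + (1 + 1 / t) * (l * Re (mat_trace (P * B)))"
      using lower test_converse_bound[OF D(1,5,2,6) P(1) t, of l] l D(7) by simp
    also have "(1 + t) * (1 - Re (mat_trace (P * A))) \<le> (1 + t) * \<epsilon>" using P(2) t by (intro mult_left_mono) auto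
    finally have "1 - \<delta> - (1 + t) * \<epsilon> \<le> (l * Re (mat_trace (P * B))) * (1 + 1 / t)" by (simp add: mult.commute)
    then have "\<kappa> \<le> l * Re (mat_trace (P * B))" unfolding \<kappa>_def by (subst pos_divide_le_eq[OF t1])
    then show ?thesis using l by (simp add: field_simps)
  qed
  \<comment> \<open>The identity satisfies the type I constraint, so the infimum is not taken over
    the empty set.\<close>
  have one: "1\<^sub>m n \<in> tests n"
  proof -
    have "quad_form n (1\<^sub>m n) x = of_real (\<Sum>a<n. (cmod (x a))\<^sup>2)" for x
    proof -
      have "quad_form n (1\<^sub>m n) x = (\<Sum>a<n. \<Sum>b<n. if b = a then cnj (x a) * x a else 0)"
        unfolding quad_form_def by (intro sum.cong) auto
      also have "\<dots> = of_real (\<Sum>a<n. (cmod (x a))\<^sup>2)"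
        unfolding of_real_sum complex_norm_square by (simp add: mult.commute)
      finally show ?thesis .
    qed
    moreover have "hermitian_mat n (1\<^sub>m n)" unfolding hermitian_mat_index by auto
    ultimately show ?thesis unfolding tests_iff by (auto intro: sum_nonneg)
  qed
  moreover have "Re (mat_trace (1\<^sub>m n * A)) = 1"
    using trace_eigen_dec[OF D(1)] D(7) left_mult_one_mat[OF Ac] by simp
  ultimately have "{Q \<in> tests (dim_row A). Re (mat_trace (Q * A)) \<ge> 1 - \<epsilon>} \<noteq> {}"
    using \<epsilon> An by force
  then have "\<kappa> / l \<le> (INF Q\<in>{Q \<in> tests (dim_row A). Re (mat_trace (Q * A)) \<ge> 1 - \<epsilon>}. Re (mat_trace (Q * B)))"
    using each An by (intro cINF_greatest) auto
  then have "hyp_div \<epsilon> A B \<le> neg_log2 (\<kappa> / l)" unfolding hyp_div_def by (rule neg_log2_antimono)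
  also have "neg_log2 (\<kappa> / l) = ereal (log 2 l - log 2 \<kappa>)"
    using \<kappa> l by (simp add: neg_log2_def log_divide)
  finally show ?thesis by (simp add: \<kappa>_def)
qed

section \<open>Single-letter estimates\<close>

text \<open>Second-order Taylor formula; the intermediate point is at most |y| in modulus, and the
  factor 1/2 is given away.\<close>

lemma exp_quadratic_bound:
  fixes y :: real
  shows "exp y \<le> 1 + y + y\<^sup>2 * exp \<bar>y\<bar>"
proof -
  obtain t where t: "\<bar>t\<bar> \<le> \<bar>y\<bar>" "exp y = (\<Sum>m<2. y ^ m / fact m) + exp t / fact 2 * y ^ 2"
    using Maclaurin_exp_le[of y 2] by blast
  have "exp t \<le> exp \<bar>y\<bar>" using t(1) by simp
  then have "exp t / 2 \<le> exp \<bar>y\<bar>" using exp_gt_zero[of t] by linarith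
  then have "exp t / 2 * y\<^sup>2 \<le> exp \<bar>y\<bar> * y\<^sup>2" by (rule mult_right_mono) simp
  then show ?thesis using t(2) by (simp add: numeral_2_eq_2 mult.commute)
qed

text \<open>Second-order expansion of the moment generating function of ln (r / s) under the weights
  r * overlap: the mean is \<open>ln 2 * d\<close>, and each of the \<open>n * n\<close> pairs adds
  at most \<open>K\<close> to the remainder. The exponential on the right, from 1 + y <= exp y,
  combines well with the rate factor \<open>2 powr _\<close>.\<close>

lemma ns_sum_exp_bound:
  assumes ns: "ns_pair n A B U r V s" and dom: "dominated n U r V s"
    and K: "\<And>i j. i < n \<Longrightarrow> j < n \<Longrightarrow> 0 < r i * overlap n U V i j \<Longrightarrow>
      r i * overlap n U V i j * ((ln (r i) - ln (s j))\<^sup>2 * exp (\<bar>u\<bar> * \<bar>ln (r i) - ln (s j)\<bar>)) \<le> K"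
    and K0: "K \<ge> 0"
  defines "d \<equiv> (\<Sum>i<n. \<Sum>j<n. r i * overlap n U V i j * (lg0 (r i) - lg0 (s j)))"
  shows "ns_sum n U r V s (1 + u) (- u) \<le> exp (u * ln 2 * d + u\<^sup>2 * (real n * real n * K))"
proof -
  note D = ns_pairD[OF ns]
  \<comment> \<open>Equals ln (r i / s j) wherever the weight is positive; \<open>ln 2\<close>
    undoes the base of \<open>log\<close>.\<close>
  define x where "x i j = ln 2 * (lg0 (r i) - lg0 (s j))" for i j
  have "ns_sum n U r V s (1 + u) (- u)
      \<le> (\<Sum>i<n. \<Sum>j<n. r i * overlap n U V i j + u * (r i * overlap n U V i j * x i j) + u\<^sup>2 * K)"
    unfolding ns_sum_def
  proof (intro sum_mono)
    fix i j assume "i \<in> {..<n}" "j \<in> {..<n}"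
    then have ij: "i < n" "j < n" by auto
    have w0: "0 \<le> r i * overlap n U V i j" using D(5)[OF ij(1)] by simp
    show "r i powr (1 + u) * s j powr (- u) * overlap n U V i j
        \<le> r i * overlap n U V i j + u * (r i * overlap n U V i j * x i j) + u\<^sup>2 * K"
    proof (cases "r i * overlap n U V i j = 0")
      case True
      then show ?thesis using K0 by auto
    next
      case False
      then have w: "0 < r i * overlap n U V i j" using w0 by (simp only: less_le) simp
      have r0: "r i > 0" using False D(5)[OF ij(1)] by (metis less_le mult_zero_left)
      have s0: "s j > 0" using False dom ij D(6)[OF ij(2)] unfolding dominated_def by (metis less_le)
      have xl: "x i j = ln (r i) - ln (s j)" using r0 s0 by (simp add: x_def log_def right_diff_distrib)
      have "r i powr (1 + u) * s j powr (- u) = r i * exp (u * x i j)"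
        using r0 s0 by (simp add: xl powr_def exp_add[symmetric] right_diff_distrib distrib_right exp_diff exp_minus divide_inverse exp_add)
      also have "\<dots> \<le> r i * (1 + u * x i j + (u * x i j)\<^sup>2 * exp \<bar>u * x i j\<bar>)"
        using r0 exp_quadratic_bound by (intro mult_left_mono) auto
      finally have "r i powr (1 + u) * s j powr (- u) * overlap n U V i j
          \<le> r i * (1 + u * x i j + (u * x i j)\<^sup>2 * exp \<bar>u * x i j\<bar>) * overlap n U V i j"
        by (intro mult_right_mono) auto
      also have "\<dots> = r i * overlap n U V i j + u * (r i * overlap n U V i j * x i j)
          + u\<^sup>2 * (r i * overlap n U V i j * ((x i j)\<^sup>2 * exp (\<bar>u\<bar> * \<bar>x i j\<bar>)))"
        by (simp add: algebra_simps power_mult_distrib abs_mult)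
      also have "\<dots> \<le> r i * overlap n U V i j + u * (r i * overlap n U V i j * x i j) + u\<^sup>2 * K"
        using K[OF ij w] unfolding xl by (intro add_left_mono mult_left_mono) auto
      finally show ?thesis .
    qed
  qed
  also have "\<dots> = 1 + u * ln 2 * d + u\<^sup>2 * (real n * real n * K)"
  proof -
    have "(\<Sum>i<n. \<Sum>j<n. u * (r i * overlap n U V i j * x i j)) = u * ln 2 * d"
      unfolding d_def x_def sum_distrib_left by (intro sum.cong refl) (simp only: mult_ac)
    then show ?thesis using ns_pair_sum_overlap[OF ns] by (simp add: sum.distrib)
  qed
  also have "\<dots> \<le> exp (u * ln 2 * d + u\<^sup>2 * (real n * real n * K))"
    using exp_ge_add_one_self[of "u * ln 2 * d + u\<^sup>2 * (real n * real n * K)"] by linarith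
  finally show ?thesis .
qed

lemma power_tendsto_zero_eventually_le:
  fixes q \<epsilon> :: real
  assumes "0 \<le> q" "q < 1" "\<epsilon> > 0"
  shows "eventually (\<lambda>n. q ^ n \<le> \<epsilon>) sequentially"
proof -
  have "(\<lambda>n. q ^ n) \<longlonglongrightarrow> 0" using assms by (intro LIMSEQ_power_zero) simp
  then have "eventually (\<lambda>n. q ^ n < \<epsilon>) sequentially" using assms(3) by (rule order_tendstoD)
  then show ?thesis by (rule eventually_mono) simp
qed

text \<open>Under domination the product is 1 at t = 0 and its logarithm has slope ln 2 * (c - D) <
  0 there, D being the divergence, so a small positive \<open>t\<close> works.\<close>

lemma ns_sum_lower_exponent:
  assumes ns: "ns_pair n A B U r V s" and c: "ereal c < rel_entropy A B"
  obtains t where "0 \<le> t" "t < 1" "2 powr (c * t) * ns_sum n U r V s (1 - t) t < 1"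
proof (cases "dominated n U r V s")
  case True
  note D = ns_pairD[OF ns]
  define d where "d = (\<Sum>i<n. \<Sum>j<n. r i * overlap n U V i j * (lg0 (r i) - lg0 (s j)))"
  have cd: "c < d" using c True unfolding rel_entropy_eigen_dec[OF D(1,2)] d_def by simp
  define k where "k i j = r i * overlap n U V i j * ((ln (r i) - ln (s j))\<^sup>2 * exp \<bar>ln (r i) - ln (s j)\<bar>)" for i j
  define K where "K = (\<Sum>i<n. \<Sum>j<n. k i j)"
  have k0: "0 \<le> k i j" if "i < n" for i j using D(5)[OF that] by (simp add: k_def)
  have K0: "0 \<le> K" unfolding K_def using k0 by (intro sum_nonneg) auto
  have kK: "k i j \<le> K" if "i < n" "j < n" for i j
  proof -
    have "k i j \<le> (\<Sum>j<n. k i j)" using k0 that by (intro member_le_sum) auto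
    also have "\<dots> \<le> K" unfolding K_def using k0 that
      by (intro member_le_sum[of i "{..<n}" "\<lambda>i. \<Sum>j<n. k i j"]) (auto intro: sum_nonneg)
    finally show ?thesis .
  qed
  \<comment> \<open>The summand 1 keeps \<open>M\<close> positive for the division below.\<close>
  define M where "M = real n * real n * K + 1"
  have M: "M > 0" unfolding M_def using K0 by (simp add: add_nonneg_pos)
  \<comment> \<open>The bound 1/2 keeps \<open>t < 1\<close>, as \<open>hyp_div_lower\<close>
    requires; the other one makes the quadratic term at most half of the linear gain.\<close>
  define t where "t = min (1 / 2) (ln 2 * (d - c) / (2 * M))"
  have t: "0 < t" "t < 1" "t * (2 * M) \<le> ln 2 * (d - c)"
  proof -
    show "0 < t" "t < 1" using cd M by (auto simp: t_def)
    have "t \<le> ln 2 * (d - c) / (2 * M)" by (simp add: t_def)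
    then show "t * (2 * M) \<le> ln 2 * (d - c)" using M by (simp add: field_simps)
  qed
  have "ns_sum n U r V s (1 + (- t)) (- (- t)) \<le> exp ((- t) * ln 2 * d + (- t)\<^sup>2 * (real n * real n * K))"
    unfolding d_def
  proof (rule ns_sum_exp_bound[OF ns True _ K0])
    fix i j assume ij: "i < n" "j < n" and w: "0 < r i * overlap n U V i j"
    have "r i * overlap n U V i j * ((ln (r i) - ln (s j))\<^sup>2 * exp (\<bar>- t\<bar> * \<bar>ln (r i) - ln (s j)\<bar>)) \<le> k i j"
      unfolding k_def using w t by (intro mult_left_mono) (auto intro: mult_left_le_one_le)
    then show "r i * overlap n U V i j * ((ln (r i) - ln (s j))\<^sup>2 * exp (\<bar>- t\<bar> * \<bar>ln (r i) - ln (s j)\<bar>)) \<le> K"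
      using kK[OF ij] by linarith
  qed
  then have "2 powr (c * t) * ns_sum n U r V s (1 - t) t
      \<le> 2 powr (c * t) * exp (- t * ln 2 * d + t\<^sup>2 * (real n * real n * K))"
    by (intro mult_left_mono) auto
  also have "\<dots> = exp (t * (ln 2 * (c - d) + t * (M - 1)))"
    by (simp add: powr_def M_def exp_add[symmetric] power2_eq_square algebra_simps)
  also have "\<dots> < exp 0"
  proof -
    have "t * M \<le> ln 2 * (d - c) / 2" using t(3) by simp
    moreover have "0 < ln 2 * (d - c)" using cd by simp
    moreover have "ln 2 * (c - d) = - (ln 2 * (d - c))" "t * (M - 1) = t * M - t" by (simp_all add: algebra_simps)
    ultimately have "ln 2 * (c - d) + t * (M - 1) < 0" using t(1) by linarith
    then show ?thesis using t(1) by (simp add: mult_pos_neg)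
  qed
  finally show ?thesis using that[of t] t by simp
next
  case False
  note D = ns_pairD[OF ns]
  \<comment> \<open>Since \<open>0 powr 0 = 0\<close>, the sum at t = 0 only counts pairs with
    \<open>s j\<close> nonzero. The pair (i0, j0) is a strict loss, and the factor
    \<open>2 powr (c * 0)\<close> is 1 whatever \<open>c\<close> is.\<close>
  then obtain i0 j0 where ij0: "i0 < n" "j0 < n" "s j0 = 0" "r i0 * overlap n U V i0 j0 \<noteq> 0"
    using False unfolding dominated_def by blast
  have "(\<Sum>i<n. \<Sum>j<n. r i * s j powr 0 * overlap n U V i j) < (\<Sum>i<n. \<Sum>j<n. r i * overlap n U V i j)"
  proof (rule sum_strict_mono_ex1)
    have le: "r i * s j powr 0 * overlap n U V i j \<le> r i * overlap n U V i j" if "i < n" for i j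
      using D(5)[OF that] by auto
    then show "\<forall>i\<in>{..<n}. (\<Sum>j<n. r i * s j powr 0 * overlap n U V i j) \<le> (\<Sum>j<n. r i * overlap n U V i j)"
      by (auto intro!: sum_mono)
    have "0 < r i0 * overlap n U V i0 j0" using ij0 D(5) by (simp add: less_le)
    then have "(\<Sum>j<n. r i0 * s j powr 0 * overlap n U V i0 j) < (\<Sum>j<n. r i0 * overlap n U V i0 j)"
      using ij0 le[OF ij0(1)] by (intro sum_strict_mono_ex1) (auto intro!: bexI[of _ j0])
    then show "\<exists>i\<in>{..<n}. (\<Sum>j<n. r i * s j powr 0 * overlap n U V i j) < (\<Sum>j<n. r i * overlap n U V i j)"
      using ij0 by blast
  qed simp
  moreover have "ns_sum n U r V s (1 - 0) 0 = (\<Sum>i<n. \<Sum>j<n. r i * s j powr 0 * overlap n U V i j)"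
    unfolding ns_sum_def using D(5) by (intro sum.cong refl) simp
  ultimately have "2 powr (c * 0) * ns_sum n U r V s (1 - 0) 0 < 1" using ns_pair_sum_overlap[OF ns] by simp
  then show ?thesis using that[of 0] by simp
qed

text \<open>The threshold is l = 2^(n c). By multiplicativity the Markov bound is the n-th power of
  a number below 1, so it eventually drops below \<epsilon>.\<close>

lemma stein_achievability:
  assumes ns: "ns_pair d A B U r V s" and c: "ereal c < rel_entropy A B" and \<epsilon>: "\<epsilon> > 0"
  shows "eventually (\<lambda>n. ereal (real n * c)
    \<le> hyp_div \<epsilon> (tensor_list (replicate n A)) (tensor_list (replicate n B))) sequentially"
proof -
  obtain t where t: "0 \<le> t" "t < 1" "2 powr (c * t) * ns_sum d U r V s (1 - t) t < 1"
    using ns_sum_lower_exponent[OF ns c] .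
  define q where "q = ns_sum d U r V s (1 - t) t"
  have q0: "0 \<le> q" unfolding q_def by (rule ns_sum_nonneg)
  have "eventually (\<lambda>n. (2 powr (c * t) * q) ^ n \<le> \<epsilon>) sequentially"
    using t q0 \<epsilon> by (intro power_tendsto_zero_eventually_le) (auto simp: q_def)
  then show ?thesis
  proof (rule eventually_mono)
    fix n assume n: "(2 powr (c * t) * q) ^ n \<le> \<epsilon>"
    \<comment> \<open>A dummy list of units of length \<open>n\<close> specializes the product lemma
      to identical factors.\<close>
    have "\<exists>U r V s. ns_pair (d ^ length (replicate n ())) (tensor_list (map (\<lambda>_. A) (replicate n ())))
      (tensor_list (map (\<lambda>_. B) (replicate n ()))) U r V s \<and>
      (False \<longrightarrow> dominated (d ^ length (replicate n ())) U r V s) \<and>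
      ns_sum (d ^ length (replicate n ())) U r V s (1 - t) t \<le> q ^ length (replicate n ())"
      using ns by (intro ns_pair_tensor_list) (auto simp: q_def)
    then obtain U' r' V' s' where n': "ns_pair (d ^ n) (tensor_list (replicate n A)) (tensor_list (replicate n B)) U' r' V' s'"
      "ns_sum (d ^ n) U' r' V' s' (1 - t) t \<le> q ^ n" by (auto simp: map_replicate)
    have e: "(2 powr (real n * c)) powr t = (2 powr (c * t)) ^ n"
      by (simp add: powr_powr powr_realpow[symmetric] mult_ac)
    have "(2 powr (c * t)) ^ n * ns_sum (d ^ n) U' r' V' s' (1 - t) t \<le> (2 powr (c * t)) ^ n * q ^ n"
      using n'(2) by (intro mult_left_mono) auto
    then have "(2 powr (real n * c)) powr t * ns_sum (d ^ n) U' r' V' s' (1 - t) t \<le> \<epsilon>"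
      using n unfolding e power_mult_distrib by linarith
    from hyp_div_lower[OF n'(1) _ t(1,2) this]
    show "ereal (real n * c) \<le> hyp_div \<epsilon> (tensor_list (replicate n A)) (tensor_list (replicate n B))"
      by simp
  qed
qed

section \<open>Channels\<close>

text \<open>Complete positivity for k = 1, where the ampliation is the channel itself.\<close>

lemma channel_psd:
  assumes N: "N \<in> CPTP dA dB" and X: "psd_mat dA X"
  shows "psd_mat dB (N X)"
proof -
  have Xc: "X \<in> carrier_mat dA dA" using X by (simp add: psd_mat_def hermitian_mat_def)
  have NX: "N X \<in> carrier_mat dB dB" using N Xc by (auto simp: CPTP_def linear_superop_def)
  have "psd_mat (1 * dB) (ampliation 1 dA dB N X)"
    using N X unfolding CPTP_def completely_positive_def by (metis (mono_tags, lifting) mem_Collect_eq mult_1)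
  moreover have "mat_block dA X 0 0 = X" using Xc by (intro eq_matI) (auto simp: mat_block_def)
  then have "ampliation 1 dA dB N X = N X"
    using NX by (intro eq_matI) (auto simp: ampliation_def)
  ultimately show ?thesis by simp
qed

lemma channel_density:
  assumes N: "N \<in> CPTP dA dB" and X: "X \<in> density_ops dA"
  shows "N X \<in> density_ops dB"
proof -
  have "X \<in> carrier_mat dA dA" using X by (simp add: density_ops_def psd_mat_def hermitian_mat_def)
  then show ?thesis using channel_psd[OF N] N X
    by (auto simp: density_ops_def CPTP_def trace_preserving_def)
qed

section \<open>The Choi matrix and the polynomial form of a channel\<close>

definition matrix_unit :: "nat \<Rightarrow> nat \<Rightarrow> nat \<Rightarrow> complex mat" where
  "matrix_unit d i j = Matrix.mat d d (\<lambda>(a, b). if a = i \<and> b = j then 1 else 0)"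

lemma superop_expand:
  assumes N: "linear_superop dA dB N" and X: "X \<in> carrier_mat dA dA" and ab: "a < dB" "b < dB"
  shows "N X $$ (a, b) = (\<Sum>i<dA. \<Sum>j<dA. X $$ (i, j) * N (matrix_unit dA i j) $$ (a, b))"
proof -
  have car: "N Y \<in> carrier_mat dB dB" if "Y \<in> carrier_mat dA dA" for Y
    using N that by (auto simp: linear_superop_def)
  have add: "N (Y + Z) = N Y + N Z" if "Y \<in> carrier_mat dA dA" "Z \<in> carrier_mat dA dA" for Y Z
    using N that by (auto simp: linear_superop_def)
  have smult: "N (c \<cdot>\<^sub>m Y) = c \<cdot>\<^sub>m N Y" if "Y \<in> carrier_mat dA dA" for c Y
    using N that by (auto simp: linear_superop_def)
  \<comment> \<open>Keeps the entries of \<open>X\<close> at the positions in \<open>S\<close>;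
    induction over \<open>S\<close> extends additivity to the sum of all matrix units.\<close>
  define F where "F S = Matrix.mat dA dA (\<lambda>(i, j). if (i, j) \<in> S then X $$ (i, j) else 0)" for S
  have Fc: "F S \<in> carrier_mat dA dA" for S by (simp add: F_def)
  have uc: "matrix_unit dA i j \<in> carrier_mat dA dA" for i j by (simp add: matrix_unit_def)
  have "N (F S) $$ (a, b) = (\<Sum>(i, j)\<in>S. X $$ (i, j) * N (matrix_unit dA i j) $$ (a, b))"
    if "finite S" "S \<subseteq> {..<dA} \<times> {..<dA}" for S
    using that
  proof (induction S)
    case empty
    have "F {} = 0 \<cdot>\<^sub>m F {}" by (intro eq_matI) (auto simp: F_def)
    then have "N (F {}) = 0 \<cdot>\<^sub>m N (F {})" using smult[OF Fc] by metis
    moreover have "(0 \<cdot>\<^sub>m N (F {})) $$ (a, b) = 0" using car[OF Fc, of "{}"] ab by simp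
    ultimately show ?case by simp
  next
    case (insert p S)
    obtain i j where p: "p = (i, j)" by (cases p)
    have "F (insert p S) = F S + X $$ (i, j) \<cdot>\<^sub>m matrix_unit dA i j"
      using insert.hyps by (intro eq_matI) (auto simp: F_def matrix_unit_def p)
    then have "N (F (insert p S)) = N (F S) + X $$ (i, j) \<cdot>\<^sub>m N (matrix_unit dA i j)"
      using add[OF Fc smult_carrier_mat[OF uc]] smult[OF uc] by simp
    then show ?case using insert car[OF Fc, of S] car[OF uc, of i j] ab by (simp add: p add.commute)
  qed
  from this[of "{..<dA} \<times> {..<dA}"]
  have "N (F ({..<dA} \<times> {..<dA})) $$ (a, b) = (\<Sum>i<dA. \<Sum>j<dA. X $$ (i, j) * N (matrix_unit dA i j) $$ (a, b))"
    by (simp add: sum.cartesian_product)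
  moreover have "F ({..<dA} \<times> {..<dA}) = X" using X by (intro eq_matI) (auto simp: F_def)
  ultimately show ?thesis by simp
qed

definition choi :: "nat \<Rightarrow> nat \<Rightarrow> (complex mat \<Rightarrow> complex mat) \<Rightarrow> complex mat" where
  "choi dA dB N = Matrix.mat (dA * dB) (dA * dB)
     (\<lambda>(p, q). N (matrix_unit dA (p div dB) (q div dB)) $$ (p mod dB, q mod dB))"

text \<open>The Choi matrix is the ampliation applied to the unnormalized maximally entangled
  projector, whose vector is \<open>w\<close>.\<close>

lemma choi_psd:
  assumes N: "N \<in> CPTP dA dB"
  shows "psd_mat (dA * dB) (choi dA dB N)"
proof -
  define w :: "nat \<Rightarrow> complex" where "w p = (if p div dA = p mod dA then 1 else 0)" for p
  define X where "X = Matrix.mat (dA * dA) (dA * dA) (\<lambda>(p, q). w p * w q)"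
  have "psd_mat (dA * dA) X" unfolding psd_mat_quad_form
  proof (intro conjI allI)
    show "hermitian_mat (dA * dA) X" unfolding hermitian_mat_index by (auto simp: X_def w_def)
    fix x
    define S where "S = (\<Sum>q<dA * dA. w q * x q)"
    have "quad_form (dA * dA) X x = (\<Sum>p<dA * dA. \<Sum>q<dA * dA. cnj (w p * x p) * (w q * x q))"
      unfolding quad_form_def by (intro sum.cong refl) (auto simp: X_def w_def)
    also have "\<dots> = cnj S * S" by (simp add: S_def sum_product)
    also have "\<dots> = of_real ((cmod S)\<^sup>2)" by (simp add: complex_norm_square mult.commute del: of_real_power)
    finally show "0 \<le> Re (quad_form (dA * dA) X x)" by simp
  qed
  then have "psd_mat (dA * dB) (ampliation dA dA dB N X)"
    using N unfolding CPTP_def completely_positive_def by blast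
  moreover have block: "mat_block dA X i j = matrix_unit dA i j" if ij: "i < dA" "j < dA" for i j
    using mult_add_less[OF ij(1)] mult_add_less[OF ij(2)]
    by (intro eq_matI) (auto simp: mat_block_def matrix_unit_def X_def w_def)
  have "ampliation dA dA dB N X = choi dA dB N"
    using div_mod_less(1)[of _ dA dB] by (intro eq_matI) (auto simp: ampliation_def choi_def block)
  ultimately show ?thesis by simp
qed

lemma sum_reorder:
  "(\<Sum>a\<in>A. \<Sum>b\<in>B. \<Sum>i\<in>I. \<Sum>j\<in>J. \<Sum>l\<in>L. f l i a j b) = (\<Sum>l\<in>L. \<Sum>i\<in>I. \<Sum>a\<in>A. \<Sum>j\<in>J. \<Sum>b\<in>B. f l i a j b)"
proof -
  have "(\<Sum>a\<in>A. \<Sum>b\<in>B. \<Sum>i\<in>I. \<Sum>j\<in>J. \<Sum>l\<in>L. f l i a j b) = (\<Sum>a\<in>A. \<Sum>b\<in>B. \<Sum>i\<in>I. \<Sum>l\<in>L. \<Sum>j\<in>J. f l i a j b)"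
    by (intro sum.cong refl sum.swap)
  also have "\<dots> = (\<Sum>a\<in>A. \<Sum>b\<in>B. \<Sum>l\<in>L. \<Sum>i\<in>I. \<Sum>j\<in>J. f l i a j b)"
    by (intro sum.cong refl sum.swap)
  also have "\<dots> = (\<Sum>a\<in>A. \<Sum>l\<in>L. \<Sum>b\<in>B. \<Sum>i\<in>I. \<Sum>j\<in>J. f l i a j b)"
    by (intro sum.cong refl sum.swap)
  also have "\<dots> = (\<Sum>l\<in>L. \<Sum>a\<in>A. \<Sum>b\<in>B. \<Sum>i\<in>I. \<Sum>j\<in>J. f l i a j b)"
    by (rule sum.swap)
  also have "\<dots> = (\<Sum>l\<in>L. \<Sum>a\<in>A. \<Sum>i\<in>I. \<Sum>b\<in>B. \<Sum>j\<in>J. f l i a j b)"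
    by (intro sum.cong refl sum.swap)
  also have "\<dots> = (\<Sum>l\<in>L. \<Sum>i\<in>I. \<Sum>a\<in>A. \<Sum>b\<in>B. \<Sum>j\<in>J. f l i a j b)"
    by (intro sum.cong refl sum.swap)
  also have "\<dots> = (\<Sum>l\<in>L. \<Sum>i\<in>I. \<Sum>a\<in>A. \<Sum>j\<in>J. \<Sum>b\<in>B. f l i a j b)"
    by (intro sum.cong refl sum.swap)
  finally show ?thesis .
qed

text \<open>
  Every positive operator is a Gram matrix \<open>X X\<^sup>*\<close>. The entries of the conjugate of \<open>X\<close> and of
  an output vector \<open>f\<close> are the variables \<open>Inl\<close> and \<open>Inr\<close> below; the conjugation makes
  \<open>\<langle>f, N (X X\<^sup>*) f\<rangle>\<close> a sum of squared absolute values of polynomials (no conjugates).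
\<close>

definition gram :: "nat \<Rightarrow> ((nat \<times> nat) + nat \<Rightarrow> complex) \<Rightarrow> complex mat" where
  "gram d z = Matrix.mat d d (\<lambda>(i, j). \<Sum>l<d. cnj (z (Inl (i, l))) * z (Inl (j, l)))"

lemma gram_quad_form:
  "quad_form d (gram d z) y = of_real (\<Sum>l<d. (cmod (\<Sum>j<d. z (Inl (j, l)) * y j))\<^sup>2)"
proof -
  have "quad_form d (gram d z) y = (\<Sum>i<d. \<Sum>j<d. \<Sum>l<d. cnj (z (Inl (i, l)) * y i) * (z (Inl (j, l)) * y j))"
    unfolding quad_form_def by (intro sum.cong refl) (auto simp: gram_def sum_distrib_left sum_distrib_right mult_ac)
  also have "\<dots> = (\<Sum>i<d. \<Sum>l<d. \<Sum>j<d. cnj (z (Inl (i, l)) * y i) * (z (Inl (j, l)) * y j))"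
    by (intro sum.cong refl sum.swap)
  also have "\<dots> = (\<Sum>l<d. \<Sum>i<d. \<Sum>j<d. cnj (z (Inl (i, l)) * y i) * (z (Inl (j, l)) * y j))"
    by (rule sum.swap)
  also have "\<dots> = (\<Sum>l<d. cnj (\<Sum>j<d. z (Inl (j, l)) * y j) * (\<Sum>j<d. z (Inl (j, l)) * y j))"
    by (simp only: cnj_sum sum_product)
  also have "\<dots> = of_real (\<Sum>l<d. (cmod (\<Sum>j<d. z (Inl (j, l)) * y j))\<^sup>2)"
    unfolding of_real_sum complex_norm_square by (simp add: mult.commute)
  finally show ?thesis .
qed

lemma gram_trace: "mat_trace (gram d z) = of_real (\<Sum>i<d. \<Sum>l<d. (cmod (z (Inl (i, l))))\<^sup>2)"
  unfolding of_real_sum complex_norm_square by (simp add: mat_trace_def gram_def mult.commute)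

text \<open>Each column of the Gram factor, tensored with \<open>f\<close>, is a vector at which the
  form of the Choi matrix is evaluated. With the conjugated factor as variable, the entries of this
  vector contain no conjugates.\<close>

lemma channel_quad_form:
  assumes N: "N \<in> CPTP dA dB"
  shows "quad_form dB (N (gram dA z)) f
    = (\<Sum>l<dA. quad_form (dA * dB) (choi dA dB N) (\<lambda>p. z (Inl (p div dB, l)) * f (p mod dB)))"
proof -
  define J where "J i a j b = N (matrix_unit dA i j) $$ (a, b)" for i a j b
  have lin: "linear_superop dA dB N" using N by (simp add: CPTP_def)
  have gc: "gram dA z \<in> carrier_mat dA dA" by (simp add: gram_def)
  let ?T = "\<lambda>l i a j b. cnj (z (Inl (i, l)) * f a) * J i a j b * (z (Inl (j, l)) * f b)"
  have "quad_form dB (N (gram dA z)) f = (\<Sum>a<dB. \<Sum>b<dB. \<Sum>i<dA. \<Sum>j<dA. \<Sum>l<dA. ?T l i a j b)"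
    unfolding quad_form_def
  proof (intro sum.cong refl)
    fix a b assume "a \<in> {..<dB}" "b \<in> {..<dB}"
    then have ab: "a < dB" "b < dB" by auto
    have "cnj (f a) * N (gram dA z) $$ (a, b) * f b
      = (\<Sum>i<dA. \<Sum>j<dA. cnj (f a) * (gram dA z $$ (i, j) * J i a j b) * f b)"
      unfolding superop_expand[OF lin gc ab] J_def by (simp add: sum_distrib_left sum_distrib_right)
    also have "\<dots> = (\<Sum>i<dA. \<Sum>j<dA. \<Sum>l<dA. ?T l i a j b)"
      by (intro sum.cong refl) (auto simp: gram_def sum_distrib_left sum_distrib_right mult_ac)
    finally show "cnj (f a) * N (gram dA z) $$ (a, b) * f b = (\<Sum>i<dA. \<Sum>j<dA. \<Sum>l<dA. ?T l i a j b)" .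
  qed
  also have "\<dots> = (\<Sum>l<dA. \<Sum>i<dA. \<Sum>a<dB. \<Sum>j<dA. \<Sum>b<dB. ?T l i a j b)" by (rule sum_reorder)
  also have "\<dots> = (\<Sum>l<dA. quad_form (dA * dB) (choi dA dB N) (\<lambda>p. z (Inl (p div dB, l)) * f (p mod dB)))"
  proof (intro sum.cong refl)
    fix l
    have "quad_form (dA * dB) (choi dA dB N) (\<lambda>p. z (Inl (p div dB, l)) * f (p mod dB))
      = (\<Sum>p<dA * dB. \<Sum>q<dA * dB. ?T l (p div dB) (p mod dB) (q div dB) (q mod dB))"
      unfolding quad_form_def by (intro sum.cong refl) (auto simp: choi_def J_def)
    also have "\<dots> = (\<Sum>p<dA * dB. \<Sum>j<dA. \<Sum>b<dB. ?T l (p div dB) (p mod dB) j b)"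
      by (intro sum.cong[OF refl], rule sum_div_mod)
    also have "\<dots> = (\<Sum>i<dA. \<Sum>a<dB. \<Sum>j<dA. \<Sum>b<dB. ?T l i a j b)"
      by (rule sum_div_mod[of "\<lambda>i a. \<Sum>j<dA. \<Sum>b<dB. ?T l i a j b"])
    finally show "(\<Sum>i<dA. \<Sum>a<dB. \<Sum>j<dA. \<Sum>b<dB. ?T l i a j b)
      = quad_form (dA * dB) (choi dA dB N) (\<lambda>p. z (Inl (p div dB, l)) * f (p mod dB))" by simp
  qed
  finally show ?thesis .
qed

text \<open>Diagonalizing the Choi matrix turns its form into eigenvalues times squared moduli of
  coordinates. With the square roots of the eigenvalues absorbed, the coordinates are the bilinear
  polynomials of a Kraus representation.\<close>

lemma channel_polys:
  assumes N: "N \<in> CPTP dA dB"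
  shows "\<exists>p. (\<forall>a. p a \<in> polyfun) \<and>
    (\<forall>z. quad_form dB (N (gram dA z)) (\<lambda>b. z (Inr b)) = of_real (\<Sum>a<dA * (dA * dB). (cmod (p a z))\<^sup>2))"
proof -
  let ?m = "dA * dB"
  obtain W l where W: "eigen_dec ?m (choi dA dB N) W l" and l: "\<And>k. k < ?m \<Longrightarrow> 0 \<le> l k"
    using psd_eigen_dec[OF choi_psd[OF N]] by metis
  define y where "y i k z = of_real (sqrt (l k)) * coef ?m W (\<lambda>p. z (Inl (p div dB, i)) * z (Inr (p mod dB))) k"
    for i k :: nat and z :: "(nat \<times> nat) + nat \<Rightarrow> complex"
  have "y i k \<in> polyfun" for i k unfolding y_def coef_def
    by (intro polyfun_mult polyfun_sum polyfun_const polyfun_var)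
  moreover have "quad_form dB (N (gram dA z)) (\<lambda>b. z (Inr b))
      = of_real (\<Sum>a<dA * ?m. (cmod (y (a div ?m) (a mod ?m) z))\<^sup>2)" for z
  proof -
    have "quad_form dB (N (gram dA z)) (\<lambda>b. z (Inr b)) = of_real (\<Sum>i<dA. \<Sum>k<?m. (cmod (y i k z))\<^sup>2)"
      unfolding channel_quad_form[OF N] quad_form_eigen_dec[OF W] of_real_sum
      by (intro sum.cong refl) (auto simp: y_def norm_mult power_mult_distrib l)
    also have "(\<Sum>i<dA. \<Sum>k<?m. (cmod (y i k z))\<^sup>2) = (\<Sum>a<dA * ?m. (cmod (y (a div ?m) (a mod ?m) z))\<^sup>2)"
      by (rule sum_div_mod[symmetric])
    finally show ?thesis .
  qed
  ultimately show ?thesis by (intro exI[of _ "\<lambda>a. y (a div ?m) (a mod ?m)"]) blast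
qed

text \<open>A positive operator whose form vanishes at \<open>f\<close> has \<open>f\<close> in its
  kernel, and domination puts the kernel of \<open>B\<close> inside the kernel of
  \<open>A\<close>.\<close>

lemma dominated_quad_form_zero:
  assumes ns: "ns_pair n A B U r V s" and dom: "dominated n U r V s" and 0: "quad_form n B f = 0"
  shows "quad_form n A f = 0"
proof -
  note D = ns_pairD[OF ns]
  have "(\<Sum>j<n. s j * (cmod (coef n V f j))\<^sup>2) = 0"
    using 0 unfolding quad_form_eigen_dec[OF D(2)] by (simp only: of_real_eq_0_iff)
  then have z: "s j = 0 \<or> coef n V f j = 0" if "j < n" for j
    using D(6) that by (subst (asm) sum_nonneg_eq_0_iff) auto
  have "r i * (cmod (coef n U f i))\<^sup>2 = 0" if i: "i < n" for i
  proof (cases "r i = 0")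
    case False
    have "coef n U f i = coef n U (\<lambda>a. \<Sum>j<n. V $$ (a, j) * coef n V f j) i"
      by (intro coef_cong coef_expand[OF D(4), symmetric])
    also have "\<dots> = (\<Sum>j<n. coef n U (\<lambda>a. V $$ (a, j)) i * coef n V f j)" by (rule coef_linear_comb)
    also have "\<dots> = 0"
    proof (intro sum.neutral ballI)
      fix j assume "j \<in> {..<n}"
      then have j: "j < n" by simp
      show "coef n U (\<lambda>a. V $$ (a, j)) i * coef n V f j = 0"
      proof (cases "s j = 0")
        case True
        then have "overlap n U V i j = 0" using dom i j False unfolding dominated_def by auto
        then show ?thesis unfolding overlap_commute[of n U V] by (simp add: overlap_def)
      qed (use z[OF j] in auto)
    qed
    finally show ?thesis by simp
  qed simp
  then have "(\<Sum>i<n. r i * (cmod (coef n U f i))\<^sup>2) = 0" by (intro sum.neutral) auto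
  then show ?thesis unfolding quad_form_eigen_dec[OF D(1)] by (simp only: of_real_0)
qed

text \<open>
  Finiteness of the divergence only says that \<open>\<langle>f, M \<phi> f\<rangle> = 0\<close> implies \<open>\<langle>f, N \<phi> f\<rangle> = 0\<close>, and
  \<open>N \<phi> \<le> C * M \<phi>\<close> may fail for every \<open>C\<close>; the polynomial inequality below is the substitute
  that makes all estimates uniform in the input \<open>\<phi>\<close>.
\<close>

lemma channel_uniform_bound:
  assumes N: "N \<in> CPTP dA dB" and M: "M \<in> CPTP dA dB"
    and fin: "\<And>\<phi>. \<phi> \<in> density_ops dA \<Longrightarrow> rel_entropy (N \<phi>) (M \<phi>) \<noteq> \<infinity>"
  shows "\<exists>C\<ge>1. \<exists>k::nat. \<forall>\<phi>\<in>density_ops dA. \<forall>U r V s. ns_pair dB (N \<phi>) (M \<phi>) U r V s \<longrightarrow>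
    (\<forall>i<dB. \<forall>j<dB. (r i * overlap dB U V i j) ^ k \<le> C * s j)"
proof -
  let ?K = "dA * (dA * dB)"
  obtain p where p: "\<And>a. p a \<in> polyfun"
    and pq: "\<And>z. quad_form dB (N (gram dA z)) (\<lambda>b. z (Inr b)) = of_real (\<Sum>a<?K. (cmod (p a z))\<^sup>2)"
    using channel_polys[OF N] by blast
  obtain q where q: "\<And>a. q a \<in> polyfun"
    and qq: "\<And>z. quad_form dB (M (gram dA z)) (\<lambda>b. z (Inr b)) = of_real (\<Sum>a<?K. (cmod (q a z))\<^sup>2)"
    using channel_polys[OF M] by blast
  \<comment> \<open>The hypothesis of \<open>lojasiewicz\<close> at an arbitrary point. If the Gram
    matrix has nonzero trace, dividing by the trace gives an input state and \<open>fin\<close>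
    applies; otherwise the form of the output of \<open>N\<close> vanishes anyway.\<close>
  have zeros: "p a z = 0" if qz: "\<And>b. b < ?K \<Longrightarrow> q b z = 0" and a: "a < ?K" for z a
  proof -
    define f where "f = (\<lambda>b. z (Inr b))"
    have M0: "quad_form dB (M (gram dA z)) f = 0" using qq[of z] qz by (simp add: f_def)
    have "quad_form dB (N (gram dA z)) f = 0"
    proof (cases "mat_trace (gram dA z) = 0")
      case True
      then have "(\<Sum>i<dA. \<Sum>l<dA. (cmod (z (Inl (i, l))))\<^sup>2) = 0"
        unfolding gram_trace by (simp only: of_real_eq_0_iff)
      then have "z (Inl (i, l)) = 0" if "i < dA" "l < dA" for i l
        using that by (simp add: sum_nonneg sum_nonneg_eq_0_iff)
      then have "quad_form (dA * dB) (choi dA dB N) (\<lambda>p. z (Inl (p div dB, l)) * f (p mod dB)) = 0" if "l < dA" for l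
        unfolding quad_form_def using that div_mod_less(1)[of _ dA dB] by (intro sum.neutral ballI) auto
      then show ?thesis unfolding channel_quad_form[OF N] by simp
    next
      case False
      define \<tau> where "\<tau> = (\<Sum>i<dA. \<Sum>l<dA. (cmod (z (Inl (i, l))))\<^sup>2)"
      have \<tau>: "mat_trace (gram dA z) = of_real \<tau>" unfolding \<tau>_def by (rule gram_trace)
      have "\<tau> \<ge> 0" unfolding \<tau>_def by (intro sum_nonneg) auto
      then have \<tau>0: "\<tau> > 0" using False \<tau> by (simp add: less_le)
      define c where "c = complex_of_real (1 / \<tau>)"
      define \<phi> where "\<phi> = c \<cdot>\<^sub>m gram dA z"
      have gc: "gram dA z \<in> carrier_mat dA dA" by (simp add: gram_def)
      have qs: "quad_form n (c \<cdot>\<^sub>m A) x = c * quad_form n A x" if "A \<in> carrier_mat n n" for n A x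
        using that by (auto simp: quad_form_def sum_distrib_left mult_ac intro!: sum.cong)
      have "psd_mat dA \<phi>" unfolding psd_mat_quad_form
      proof (intro conjI allI)
        show "hermitian_mat dA \<phi>" unfolding hermitian_mat_index \<phi>_def
          by (auto simp: c_def gram_def mult.commute)
        fix x
        have "quad_form dA \<phi> x = of_real (1 / \<tau> * (\<Sum>l<dA. (cmod (\<Sum>j<dA. z (Inl (j, l)) * x j))\<^sup>2))"
          unfolding \<phi>_def qs[OF gc] gram_quad_form unfolding c_def by (rule of_real_mult[symmetric])
        then show "0 \<le> Re (quad_form dA \<phi> x)"
          using \<tau>0 by (simp add: sum_nonneg del: of_real_mult)
      qed
      moreover have "mat_trace \<phi> = c * mat_trace (gram dA z)"
        using gc by (simp add: \<phi>_def mat_trace_def sum_distrib_left)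
      then have "mat_trace \<phi> = 1" unfolding \<tau> c_def using \<tau>0 by (simp flip: of_real_mult)
      ultimately have \<phi>: "\<phi> \<in> density_ops dA" by (simp add: density_ops_def)
      obtain U r V s where ns: "ns_pair dB (N \<phi>) (M \<phi>) U r V s"
        using ns_pair_exists[OF channel_density[OF N \<phi>] channel_density[OF M \<phi>]] .
      have dom: "dominated dB U r V s"
        using fin[OF \<phi>] unfolding rel_entropy_eigen_dec[OF ns_pairD(1,2)[OF ns]] by (auto split: if_splits)
      have sm: "quad_form dB (L \<phi>) f = c * quad_form dB (L (gram dA z)) f" if "L \<in> CPTP dA dB" for L
      proof -
        have "L \<phi> = c \<cdot>\<^sub>m L (gram dA z)" "L (gram dA z) \<in> carrier_mat dB dB"
          using that gc by (auto simp: CPTP_def linear_superop_def \<phi>_def)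
        then show ?thesis using qs by simp
      qed
      have "quad_form dB (M \<phi>) f = 0" using sm[OF M] M0 by simp
      then have "quad_form dB (N \<phi>) f = 0" by (rule dominated_quad_form_zero[OF ns dom])
      then show ?thesis using sm[OF N] \<tau>0 by (simp add: c_def)
    qed
    then have "(\<Sum>a<?K. (cmod (p a z))\<^sup>2) = 0" using pq[of z] unfolding f_def by (simp only: of_real_eq_0_iff)
    then show ?thesis using a by (simp add: sum_nonneg_eq_0_iff)
  qed
  obtain C k where C: "C \<ge> 1" and loj: "\<And>z. (\<forall>v. cmod (z v) \<le> 1) \<Longrightarrow>
      (\<Sum>a<?K. (cmod (p a z))\<^sup>2) ^ k \<le> C * (\<Sum>b<?K. cmod (q b z))"
    using lojasiewicz[of ?K p ?K q, OF p q zeros] by blast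
  \<comment> \<open>\<open>lojasiewicz\<close> bounds by the sum of |q_b|, whereas s_j is the sum of
    |q_b|^2, so each |q_b| is at most sqrt s_j. Squaring removes the root: hence the square here and
    the exponent \<open>2 * k\<close>. The summand 1 keeps \<open>C'\<close> at least 1 when
    \<open>?K = 0\<close>.\<close>
  define C' where "C' = (C * (real ?K + 1))\<^sup>2"
  have C'1: "C' \<ge> 1" unfolding C'_def using C by (simp add: one_le_power mult_ge1_I)
  have "(r i * overlap dB U V i j) ^ (2 * k) \<le> C' * s j"
    if \<phi>: "\<phi> \<in> density_ops dA" and ns: "ns_pair dB (N \<phi>) (M \<phi>) U r V s" and ij: "i < dB" "j < dB"
    for \<phi> U r V s i j
  proof -
    note D = ns_pairD[OF ns]
    have ps: "psd_mat dA \<phi>" "mat_trace \<phi> = 1" using \<phi> by (auto simp: density_ops_def)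
    obtain X x where X: "eigen_dec dA \<phi> X x" and x0: "\<And>l. l < dA \<Longrightarrow> 0 \<le> x l"
      using psd_eigen_dec[OF ps(1)] by metis
    have "(\<Sum>l<dA. x l) = 1" using trace_eigen_dec[OF X] ps(2) by (metis of_real_eq_1_iff)
    then have x1: "x l \<le> 1" if "l < dA" for l
      using member_le_sum[of l "{..<dA}" x] x0 that by simp
    have U1: "cmod (Y $$ (a, l)) \<le> 1" if Y: "unitary_mat n Y" and al: "a < n" "l < n" for n Y a l
    proof -
      have "(cmod (Y $$ (a, l)))\<^sup>2 \<le> 1"
        using member_le_sum[of a "{..<n}" "\<lambda>a. (cmod (Y $$ (a, l)))\<^sup>2"]
          unitary_mat_col_norm[OF Y al(2)] al by simp
      then show ?thesis by (simp add: abs_square_le_1)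
    qed
    \<comment> \<open>The point that represents \<phi> and the output vector v_j: its first block is
      the conjugate of a factor of \<phi>, the eigenvectors scaled by the roots of the eigenvalues.
      All entries have modulus at most 1, as \<open>loj\<close> demands.\<close>
    define z where "z = case_sum
      (\<lambda>(i, l). if i < dA \<and> l < dA then cnj (X $$ (i, l)) * of_real (sqrt (x l)) else 0)
      (\<lambda>b. if b < dB then V $$ (b, j) else 0)"
    have "cmod (z v) \<le> 1" for v
    proof (cases v)
      case (Inl il)
      obtain i l where il: "il = (i, l)" by (cases il)
      have "cmod (X $$ (i, l)) * sqrt (x l) \<le> 1 * 1" if "i < dA" "l < dA"
        using U1[OF eigen_dec_carrier(3)[OF X] that] x0[OF that(2)] x1[OF that(2)] by (intro mult_mono) auto
      then show ?thesis using x0 by (auto simp: z_def Inl il norm_mult)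
    qed (use U1[OF D(4) _ ij(2)] in \<open>auto simp: z_def\<close>)
    then have L: "(\<Sum>a<?K. (cmod (p a z))\<^sup>2) ^ k \<le> C * (\<Sum>b<?K. cmod (q b z))" using loj by blast
    have "gram dA z = \<phi>"
    proof (rule eq_matI)
      fix a b assume "a < dim_row \<phi>" "b < dim_col \<phi>"
      then have ab: "a < dA" "b < dA" using eigen_dec_carrier(1)[OF X] by auto
      have "gram dA z $$ (a, b) = (\<Sum>l<dA. X $$ (a, l) * of_real (sqrt (x l)) * (cnj (X $$ (b, l)) * of_real (sqrt (x l))))"
        using ab by (simp add: gram_def z_def)
      also have "\<dots> = (\<Sum>l<dA. X $$ (a, l) * of_real (sqrt (x l) * sqrt (x l)) * cnj (X $$ (b, l)))"
        by (simp only: of_real_mult mult_ac)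
      also have "\<dots> = \<phi> $$ (a, b)" unfolding eigen_dec_index[OF X ab] using x0 by (intro sum.cong) auto
      finally show "gram dA z $$ (a, b) = \<phi> $$ (a, b)" .
    qed (use eigen_dec_carrier(1)[OF X] in \<open>auto simp: gram_def\<close>)
    moreover have "quad_form dB A (\<lambda>b. z (Inr b)) = quad_form dB A (\<lambda>b. V $$ (b, j))" for A
      by (intro quad_form_cong) (simp add: z_def)
    ultimately have "of_real (\<Sum>a<?K. (cmod (p a z))\<^sup>2) = quad_form dB (N \<phi>) (\<lambda>b. V $$ (b, j))"
      and "of_real (\<Sum>a<?K. (cmod (q a z))\<^sup>2) = quad_form dB (M \<phi>) (\<lambda>b. V $$ (b, j))"
      using pq[of z] qq[of z] by simp_all
    then have g: "(\<Sum>a<?K. (cmod (p a z))\<^sup>2) = (\<Sum>i<dB. r i * overlap dB U V i j)"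
      and h: "(\<Sum>a<?K. (cmod (q a z))\<^sup>2) = s j"
      unfolding quad_form_col[OF D(1)] eigen_dec_eigenvalue[OF D(2) ij(2)] by (simp_all only: of_real_eq_iff)
    have w0: "0 \<le> r i * overlap dB U V i j" using D(5)[OF ij(1)] by simp
    have "r i * overlap dB U V i j \<le> (\<Sum>i<dB. r i * overlap dB U V i j)"
      using D(5) ij by (intro member_le_sum) auto
    then have "(r i * overlap dB U V i j) ^ k \<le> (\<Sum>a<?K. (cmod (p a z))\<^sup>2) ^ k"
      unfolding g using w0 by (rule power_mono)
    also note L
    also have "(\<Sum>b<?K. cmod (q b z)) \<le> (\<Sum>b<?K. sqrt (s j))"
    proof (intro sum_mono)
      fix b assume "b \<in> {..<?K}"
      then have "(cmod (q b z))\<^sup>2 \<le> s j" unfolding h[symmetric] by (intro member_le_sum) auto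
      then show "cmod (q b z) \<le> sqrt (s j)" by (simp add: real_le_rsqrt)
    qed
    also have "(\<Sum>b<?K. sqrt (s j)) \<le> (real ?K + 1) * sqrt (s j)"
      using D(6)[OF ij(2)] by (simp add: algebra_simps)
    finally have "(r i * overlap dB U V i j) ^ k \<le> C * ((real ?K + 1) * sqrt (s j))" using C by simp
    then have "((r i * overlap dB U V i j) ^ k)\<^sup>2 \<le> (C * ((real ?K + 1) * sqrt (s j)))\<^sup>2"
      using w0 by (intro power_mono) auto
    also have "\<dots> = C' * s j" using D(6)[OF ij(2)] by (simp add: C'_def power_mult_distrib)
    finally show ?thesis by (simp add: power_mult[symmetric] mult.commute)
  qed
  then show ?thesis using C'1 by (intro exI[of _ C'] conjI exI[of _ "2 * k"]) blast+
qed

section \<open>The converse\<close>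

text \<open>Here \<open>a\<close> stands for a weight r_i * overlap. The logarithms of
  \<open>r\<close> and \<open>s\<close> are of order L = - ln a, which gives |ln r - ln s| <= u,
  while a = exp (- L) decays exponentially in u. The bound on \<eta> lets the exponential factor
  consume only half of this decay, 2 w.\<close>

lemma moment_bound:
  fixes a r s C \<eta> :: real and k :: nat
  assumes a: "0 < a" "a \<le> r" "r \<le> 1" and s: "s \<le> 1" and C: "C \<ge> 1" and as: "a ^ k \<le> C * s"
    and \<eta>: "0 \<le> \<eta>" "\<eta> * (2 * (real k + 1)) \<le> 1"
  shows "a * ((ln r - ln s)\<^sup>2 * exp (\<eta> * \<bar>ln r - ln s\<bar>)) \<le> 8 * C * (real k + 1)\<^sup>2"
proof -
  define L where "L = - ln a"
  define u where "u = (real k + 1) * L + ln C"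
  define w where "w = u / (2 * (real k + 1))"
  have k1: "real k + 1 > 0" by simp
  have L: "0 \<le> L" unfolding L_def using a by simp
  have lC: "0 \<le> ln C" using C by simp
  have u0: "0 \<le> u" unfolding u_def using L lC by simp
  have w0: "0 \<le> w" unfolding w_def using u0 by simp
  have uw: "u = 2 * (real k + 1) * w" unfolding w_def by simp
  have "0 < C * s" using as a(1) by (meson less_le_trans zero_less_power)
  then have s0: "0 < s" using C by (simp add: zero_less_mult_iff)
  have r0: "0 < r" using a by linarith
  have "ln (a ^ k) \<le> ln (C * s)" using as a(1) by (intro ln_mono) auto
  then have "- (real k * L) \<le> ln C + ln s" using a(1) C s0 by (simp add: L_def ln_realpow ln_mult)
  moreover have "ln s \<le> 0" "ln r \<le> 0" "- L \<le> ln r" using s s0 a r0 by (auto simp: L_def)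
  moreover have "u = real k * L + L + ln C" by (simp add: u_def algebra_simps)
  moreover have "0 \<le> real k * L" using L by simp
  ultimately have x: "\<bar>ln r - ln s\<bar> \<le> u" using lC L by linarith
  have "a * ((ln r - ln s)\<^sup>2 * exp (\<eta> * \<bar>ln r - ln s\<bar>)) \<le> (C * exp (- (2 * w))) * (u\<^sup>2 * exp w)"
  proof (intro mult_mono)
    have "L = 2 * w - ln C / (real k + 1)" using uw k1 by (simp add: u_def field_simps)
    moreover have "ln C / (real k + 1) \<le> ln C" using lC by (simp add: divide_le_eq mult_left_le algebra_simps)
    ultimately have "- L \<le> ln C - 2 * w" by linarith
    then have "exp (- L) \<le> exp (ln C - 2 * w)" by simp
    then show "a \<le> C * exp (- (2 * w))" using a(1) C by (simp add: L_def exp_diff exp_minus divide_inverse)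
    show "(ln r - ln s)\<^sup>2 \<le> u\<^sup>2" using power_mono[OF x, of 2] by simp
    have "\<eta> * \<bar>ln r - ln s\<bar> \<le> \<eta> * u" using x \<eta>(1) by (rule mult_left_mono)
    also have "\<dots> = (\<eta> * (2 * (real k + 1))) * w" by (simp add: uw mult_ac)
    also have "\<dots> \<le> 1 * w" using \<eta>(2) w0 by (rule mult_right_mono)
    finally show "exp (\<eta> * \<bar>ln r - ln s\<bar>) \<le> exp w" by simp
  qed (use C a in auto)
  also have "\<dots> = 4 * C * (real k + 1)\<^sup>2 * (w\<^sup>2 * exp (- w))"
  proof -
    have "exp (- (2 * w)) * exp w = exp (- w)" by (simp flip: exp_add)
    moreover have "(C * exp (- (2 * w))) * (u\<^sup>2 * exp w) = C * u\<^sup>2 * (exp (- (2 * w)) * exp w)"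
      by (simp only: mult_ac)
    moreover have "u\<^sup>2 = 4 * (real k + 1)\<^sup>2 * w\<^sup>2" by (simp only: uw power_mult_distrib) simp
    ultimately show ?thesis by simp
  qed
  \<comment> \<open>Since w >= 0, the term w^2 / 2 of the exponential series is at most exp
    w.\<close>
  also have "w\<^sup>2 * exp (- w) \<le> 2"
  proof -
    have "w\<^sup>2 \<le> 2 * exp w" using exp_lower_Taylor_quadratic[OF w0] w0 by linarith
    then show ?thesis by (simp add: exp_minus field_simps)
  qed
  finally show ?thesis using C by (simp add: mult_left_mono)
qed

text \<open>The order of the quantifiers is the point: \<eta> and \<open>q\<close> are fixed before
  the states, because \<open>moment_bound\<close> supplies a second-order constant that depends only
  on \<open>C\<close> and \<open>k\<close>.\<close>

lemma ns_sum_upper_exponent: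
  fixes C d c :: real and k n :: nat
  assumes C: "C \<ge> 1" and cd: "d < c"
  shows "\<exists>\<eta>>0. \<exists>q\<ge>0. 2 powr (- (c * \<eta>)) * q < 1 \<and>
    (\<forall>A B U r V s. ns_pair n A B U r V s \<longrightarrow> dominated n U r V s \<longrightarrow>
      (\<forall>i<n. \<forall>j<n. (r i * overlap n U V i j) ^ k \<le> C * s j) \<longrightarrow> rel_entropy A B \<le> ereal d \<longrightarrow>
      ns_sum n U r V s (1 + \<eta>) (- \<eta>) \<le> q)"
proof -
  define K where "K = 8 * C * (real k + 1)\<^sup>2"
  define M where "M = real n * real n * K + 1"
  have K0: "K \<ge> 0" using C by (simp add: K_def)
  have M: "M > 0" unfolding M_def using K0 by (simp add: add_nonneg_pos)
  \<comment> \<open>The first bound is what \<open>moment_bound\<close> tolerates; the second makes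
    the quadratic term at most half of the linear gain.\<close>
  define \<eta> where "\<eta> = min (1 / (2 * (real k + 1))) (ln 2 * (c - d) / (2 * M))"
  have \<eta>: "0 < \<eta>" using cd M by (auto simp: \<eta>_def)
  have "\<eta> \<le> 1 / (2 * (real k + 1))" by (simp add: \<eta>_def)
  then have \<eta>1: "\<eta> * (2 * (real k + 1)) \<le> 1" by (simp add: field_simps)
  have "\<eta> \<le> ln 2 * (c - d) / (2 * M)" by (simp add: \<eta>_def)
  then have \<eta>2: "\<eta> * (2 * M) \<le> ln 2 * (c - d)" using M by (simp add: field_simps)
  define q where "q = exp (\<eta> * ln 2 * d + \<eta>\<^sup>2 * (real n * real n * K))"
  have "2 powr (- (c * \<eta>)) * q = exp (\<eta> * (ln 2 * (d - c) + \<eta> * (M - 1)))"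
    by (simp add: q_def powr_def M_def exp_add[symmetric] power2_eq_square algebra_simps)
  also have "\<dots> < exp 0"
  proof -
    have "\<eta> * M \<le> ln 2 * (c - d) / 2" using \<eta>2 by simp
    moreover have "0 < ln 2 * (c - d)" using cd by simp
    moreover have "ln 2 * (d - c) = - (ln 2 * (c - d))" "\<eta> * (M - 1) = \<eta> * M - \<eta>" by (simp_all add: algebra_simps)
    ultimately have "ln 2 * (d - c) + \<eta> * (M - 1) < 0" using \<eta> by linarith
    then show ?thesis using \<eta> by (simp add: mult_pos_neg)
  qed
  finally have q1: "2 powr (- (c * \<eta>)) * q < 1" by simp
  have "ns_sum n U r V s (1 + \<eta>) (- \<eta>) \<le> q"
    if ns: "ns_pair n A B U r V s" and dom: "dominated n U r V s"
      and w: "\<forall>i<n. \<forall>j<n. (r i * overlap n U V i j) ^ k \<le> C * s j" and D: "rel_entropy A B \<le> ereal d"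
    for A B U r V s
  proof -
    note nD = ns_pairD[OF ns]
    define d' where "d' = (\<Sum>i<n. \<Sum>j<n. r i * overlap n U V i j * (lg0 (r i) - lg0 (s j)))"
    have d': "d' \<le> d" using D dom unfolding rel_entropy_eigen_dec[OF nD(1,2)] d'_def by simp
    have "ns_sum n U r V s (1 + \<eta>) (- \<eta>) \<le> exp (\<eta> * ln 2 * d' + \<eta>\<^sup>2 * (real n * real n * K))"
      unfolding d'_def
    proof (rule ns_sum_exp_bound[OF ns dom _ K0])
      fix i j assume ij: "i < n" "j < n" and w0: "0 < r i * overlap n U V i j"
      have "r i * overlap n U V i j \<le> r i * 1"
        using nD(5)[OF ij(1)] overlap_le_1[OF nD(3,4) ij] by (intro mult_left_mono) auto
      then show "r i * overlap n U V i j * ((ln (r i) - ln (s j))\<^sup>2 * exp (\<bar>\<eta>\<bar> * \<bar>ln (r i) - ln (s j)\<bar>)) \<le> K"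
        unfolding K_def using w ij \<eta> nD(9)[OF ij(1)] nD(10)[OF ij(2)]
        by (intro moment_bound w0 C) (use \<eta>1 in auto)
    qed
    also have "\<dots> \<le> q" unfolding q_def using d' \<eta> by simp
    finally show ?thesis .
  qed
  then show ?thesis using \<eta> q1 by (intro exI[of _ \<eta>] conjI exI[of _ q]) (auto simp: q_def)
qed

text \<open>The factor \<open>q\<close> bounds every letter whatever its input, so varying inputs
  still give q^n, and with l = 2^(n c) the Markov term tends to 0. The additive loss depends neither
  on \<open>n\<close> nor on the inputs.\<close>

lemma stein_converse:
  assumes N: "N \<in> CPTP dA dB" and M: "M \<in> CPTP dA dB" and \<epsilon>: "0 < \<epsilon>" "\<epsilon> < 1"
    and d: "channel_div dA N M \<le> ereal d" and cd: "d < c"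
  shows "\<exists>C. eventually (\<lambda>n. hyp_div_PRO \<epsilon> dA N M n \<le> ereal (real n * c + C)) sequentially"
proof -
  have dphi: "rel_entropy (N \<phi>) (M \<phi>) \<le> ereal d" if "\<phi> \<in> density_ops dA" for \<phi>
    using d SUP_upper[OF that, of "\<lambda>\<phi>. rel_entropy (N \<phi>) (M \<phi>)"] unfolding channel_div_def by (rule order_trans[rotated])
  then have fin: "rel_entropy (N \<phi>) (M \<phi>) \<noteq> \<infinity>" if "\<phi> \<in> density_ops dA" for \<phi>
    using that by fastforce
  obtain C k where C: "C \<ge> 1" and w: "\<And>\<phi> U r V s. \<phi> \<in> density_ops dA \<Longrightarrow> ns_pair dB (N \<phi>) (M \<phi>) U r V s \<Longrightarrow>
      \<forall>i<dB. \<forall>j<dB. (r i * overlap dB U V i j) ^ k \<le> C * s j"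
    using channel_uniform_bound[OF N M fin] by blast
  obtain \<eta> q where \<eta>: "\<eta> > 0" and q: "q \<ge> 0" and q1: "2 powr (- (c * \<eta>)) * q < 1"
    and qb: "\<And>A B U r V s. ns_pair dB A B U r V s \<Longrightarrow> dominated dB U r V s \<Longrightarrow>
      \<forall>i<dB. \<forall>j<dB. (r i * overlap dB U V i j) ^ k \<le> C * s j \<Longrightarrow> rel_entropy A B \<le> ereal d \<Longrightarrow>
      ns_sum dB U r V s (1 + \<eta>) (- \<eta>) \<le> q"
    using ns_sum_upper_exponent[OF C cd, of dB k] by blast
  have letter: "\<exists>U r V s. ns_pair dB (N \<phi>) (M \<phi>) U r V s \<and> (True \<longrightarrow> dominated dB U r V s) \<and>
      ns_sum dB U r V s (1 + \<eta>) (- \<eta>) \<le> q" if \<phi>: "\<phi> \<in> density_ops dA" for \<phi>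
  proof -
    obtain U r V s where ns: "ns_pair dB (N \<phi>) (M \<phi>) U r V s"
      using ns_pair_exists[OF channel_density[OF N \<phi>] channel_density[OF M \<phi>]] .
    have dom: "dominated dB U r V s"
      using fin[OF \<phi>] unfolding rel_entropy_eigen_dec[OF ns_pairD(1,2)[OF ns]] by (auto split: if_splits)
    show ?thesis using ns dom qb[OF ns dom w[OF \<phi> ns] dphi[OF \<phi>]] by blast
  qed
  \<comment> \<open>Makes \<open>(1 + t) * \<epsilon>\<close> the midpoint of \<epsilon> and 1;
    \<delta> then takes half of the remaining (1 - \<epsilon>) / 2.\<close>
  define t where "t = (1 - \<epsilon>) / (2 * \<epsilon>)"
  define \<delta> where "\<delta> = (1 - \<epsilon>) / 4"
  have t: "t > 0" and \<delta>: "\<delta> > 0" using \<epsilon> by (auto simp: t_def \<delta>_def)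
  have "(1 + t) * \<epsilon> = (1 + \<epsilon>) / 2" using \<epsilon> by (simp add: t_def field_simps)
  then have pos: "0 < 1 - \<delta> - (1 + t) * \<epsilon>" using \<epsilon> by (simp add: \<delta>_def field_simps)
  define E where "E = - log 2 ((1 - \<delta> - (1 + t) * \<epsilon>) / (1 + 1 / t))"
  have "eventually (\<lambda>n. (2 powr (- (c * \<eta>)) * q) ^ n \<le> \<delta>) sequentially"
    using q q1 \<delta> by (intro power_tendsto_zero_eventually_le) auto
  then have "eventually (\<lambda>n. hyp_div_PRO \<epsilon> dA N M n \<le> ereal (real n * c + E)) sequentially"
  proof (rule eventually_mono)
    fix n assume n: "(2 powr (- (c * \<eta>)) * q) ^ n \<le> \<delta>"
    show "hyp_div_PRO \<epsilon> dA N M n \<le> ereal (real n * c + E)"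
      unfolding hyp_div_PRO_def
    proof (rule SUP_least)
      fix \<phi>s assume "\<phi>s \<in> {\<phi>s. length \<phi>s = n \<and> set \<phi>s \<subseteq> density_ops dA}"
      then have len: "length \<phi>s = n" and dens: "set \<phi>s \<subseteq> density_ops dA" by auto
      have "\<exists>U r V s. ns_pair (dB ^ length \<phi>s) (tensor_list (map N \<phi>s)) (tensor_list (map M \<phi>s)) U r V s \<and>
        (True \<longrightarrow> dominated (dB ^ length \<phi>s) U r V s) \<and>
        ns_sum (dB ^ length \<phi>s) U r V s (1 + \<eta>) (- \<eta>) \<le> q ^ length \<phi>s"
        using letter dens by (intro ns_pair_tensor_list) blast
      then obtain U r V s where
        ns: "ns_pair (dB ^ n) (tensor_list (map N \<phi>s)) (tensor_list (map M \<phi>s)) U r V s"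
        and dom: "dominated (dB ^ n) U r V s" and le: "ns_sum (dB ^ n) U r V s (1 + \<eta>) (- \<eta>) \<le> q ^ n"
        unfolding len by blast
      have e: "(2 powr (real n * c)) powr (- \<eta>) = (2 powr (- (c * \<eta>))) ^ n"
        by (simp add: powr_powr powr_realpow[symmetric] mult_ac)
      have "(2 powr (- (c * \<eta>))) ^ n * ns_sum (dB ^ n) U r V s (1 + \<eta>) (- \<eta>) \<le> (2 powr (- (c * \<eta>))) ^ n * q ^ n"
        using le by (intro mult_left_mono) auto
      then have small: "(2 powr (real n * c)) powr (- \<eta>) * ns_sum (dB ^ n) U r V s (1 + \<eta>) (- \<eta>) \<le> \<delta>"
        using n unfolding e power_mult_distrib by linarith
      show "hyp_div \<epsilon> (tensor_list (map N \<phi>s)) (tensor_list (map M \<phi>s)) \<le> ereal (real n * c + E)"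
        using hyp_div_upper[OF ns dom _ \<eta> small t pos] \<epsilon>(1) by (simp add: E_def)
    qed
  qed
  then show ?thesis by blast
qed

theorem theorem25:
  fixes N M :: "complex mat \<Rightarrow> complex mat" and dA dB :: nat and \<epsilon> :: real
  assumes "N \<in> CPTP dA dB" and "M \<in> CPTP dA dB"
    and "0 < \<epsilon>" and "\<epsilon> < 1"
  shows "stein_PRO_sup \<epsilon> dA N M = stein_PRO_inf \<epsilon> dA N M \<and>
         stein_PRO_inf \<epsilon> dA N M = channel_div dA N M"
proof -
  define h where "h n = ereal (1 / real n) * hyp_div_PRO \<epsilon> dA N M n" for n
  \<comment> \<open>A single input with divergence above \<open>c\<close>, repeated n times, already
    reaches the rate \<open>c\<close>.\<close>
  have lower: "channel_div dA N M \<le> liminf h"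
  proof (rule ccontr)
    assume "\<not> channel_div dA N M \<le> liminf h"
    then obtain c where c: "liminf h < ereal c" "ereal c < channel_div dA N M"
      using ereal_dense2[of "liminf h" "channel_div dA N M"] unfolding not_le by blast
    then obtain \<phi> where \<phi>: "\<phi> \<in> density_ops dA" "ereal c < rel_entropy (N \<phi>) (M \<phi>)"
      unfolding channel_div_def less_SUP_iff by blast
    obtain U r V s where ns: "ns_pair dB (N \<phi>) (M \<phi>) U r V s"
      using ns_pair_exists[OF channel_density[OF assms(1) \<phi>(1)] channel_density[OF assms(2) \<phi>(1)]] .
    \<comment> \<open>The case n = 0 has to be set aside, because there \<open>1 / real n\<close> is
      0.\<close>
    have "eventually (\<lambda>n. ereal c \<le> h n) sequentially"
      using stein_achievability[OF ns \<phi>(2) assms(3)] eventually_gt_at_top[of 0]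
    proof eventually_elim
      fix n :: nat
      assume n: "0 < n" and le: "ereal (real n * c)
        \<le> hyp_div \<epsilon> (tensor_list (replicate n (N \<phi>))) (tensor_list (replicate n (M \<phi>)))"
      have "hyp_div \<epsilon> (tensor_list (map N (replicate n \<phi>))) (tensor_list (map M (replicate n \<phi>)))
          \<le> hyp_div_PRO \<epsilon> dA N M n"
        unfolding hyp_div_PRO_def using \<phi>(1) by (intro SUP_upper) auto
      then have "ereal (real n * c) \<le> hyp_div_PRO \<epsilon> dA N M n" using le by (simp add: map_replicate_const)
      then have "ereal (1 / real n) * ereal (real n * c) \<le> h n"
        unfolding h_def by (intro ereal_mult_left_mono) auto
      then show "ereal c \<le> h n" using n by simp
    qed
    then have "ereal c \<le> liminf h" by (rule Liminf_bounded)
    then show False using c(1) by simp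
  qed
  have upper: "limsup h \<le> channel_div dA N M"
  \<comment> \<open>The set of inputs is empty for \<open>dA = 0\<close>, which the definitions
    admit; then both sides are minus infinity. The empty list is still a valid strategy for n = 0,
    hence the restriction to n > 0.\<close>
  proof (cases "density_ops dA = {}")
    case True
    have "eventually (\<lambda>n. h n \<le> - \<infinity>) sequentially"
      using eventually_gt_at_top[of 0]
    proof eventually_elim
      fix n :: nat assume n: "0 < n"
      have no_inputs: "{\<phi>s. length \<phi>s = n \<and> set \<phi>s \<subseteq> density_ops dA} = {}" using n by (auto simp: True)
      have "hyp_div_PRO \<epsilon> dA N M n = - \<infinity>"
        unfolding hyp_div_PRO_def no_inputs by (simp add: bot_ereal_def)
      then show "h n \<le> - \<infinity>" using n by (simp add: h_def)
    qed
    then have "limsup h \<le> - \<infinity>" by (rule Limsup_bounded)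
    then show ?thesis by simp
  next
    case False
    show ?thesis
    proof (rule ccontr)
      assume "\<not> limsup h \<le> channel_div dA N M"
      then have lt: "channel_div dA N M < limsup h" by simp
      obtain \<phi> where \<phi>: "\<phi> \<in> density_ops dA" using False by blast
      have "rel_entropy (N \<phi>) (M \<phi>) \<le> channel_div dA N M" unfolding channel_div_def using \<phi> by (rule SUP_upper)
      moreover have "rel_entropy (N \<phi>) (M \<phi>) \<noteq> - \<infinity>" by (simp add: rel_entropy_def)
      \<comment> \<open>An input exists, so the divergence is above minus infinity; it also lies
        strictly below the limsup, so it is a real number.\<close>
      ultimately obtain d where d: "channel_div dA N M = ereal d" using lt by (cases "channel_div dA N M") auto
      obtain c where c: "d < c" "ereal c < limsup h" using ereal_dense2[OF lt] d by auto
      \<comment> \<open>Room between \<open>c'\<close> and \<open>c\<close> absorbs the additive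
        constant \<open>C\<close> for large n.\<close>
      define c' where "c' = (c + d) / 2"
      have c': "d < c'" "c' < c" using c(1) by (auto simp: c'_def)
      obtain C where C: "eventually (\<lambda>n. hyp_div_PRO \<epsilon> dA N M n \<le> ereal (real n * c' + C)) sequentially"
        using stein_converse[OF assms(1-4) _ c'(1)] d by auto
      obtain m :: nat where m: "C / (c - c') < real m" using reals_Archimedean2 by blast
      have "eventually (\<lambda>n. h n \<le> ereal c) sequentially"
        using C eventually_gt_at_top[of m]
      proof eventually_elim
        fix n :: nat assume n: "m < n" and le: "hyp_div_PRO \<epsilon> dA N M n \<le> ereal (real n * c' + C)"
        have "C / (c - c') \<le> real n" using m n by linarith
        then have "C \<le> real n * (c - c')" using c' by (simp add: divide_le_eq)
        then have "real n * c' + C \<le> real n * c" by (simp add: algebra_simps)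
        then have "hyp_div_PRO \<epsilon> dA N M n \<le> ereal (real n * c)" using le by (meson ereal_less_eq(3) order_trans)
        then have "h n \<le> ereal (1 / real n) * ereal (real n * c)"
          unfolding h_def by (intro ereal_mult_left_mono) auto
        then show "h n \<le> ereal c" using n by simp
      qed
      then have "limsup h \<le> ereal c" by (rule Limsup_bounded)
      then show False using c(2) by simp
    qed
  qed
  have "liminf h \<le> limsup h" by (rule Liminf_le_Limsup) simp
  then show ?thesis
    using lower upper unfolding stein_PRO_sup_def stein_PRO_inf_def h_def[abs_def, symmetric] by (auto intro: antisym)
qed

end
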